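(* Let $\mathrm{Guess}:\mathbb{Z}_q^{m\times n}\times\mathbb{Z}_q^m\times\mathbb{Z}_q^n\times\mathbb{Z}_q\to D(\mathbb{Z}_q)$ be a non-uniform quantum polynomial-time algorithm, where $D(\mathbb{Z}_q)$ is the set of probability distributions on $\mathbb{Z}_q$. Suppose that the $\mathrm{LWE}_{n,q,G(\sigma,\tau)}$ problem is hard. Then for all $x,y\in\mathbb{Z}_q$ (possibly depending on $\lambda$), $$\Big|\Pr\big[\mathrm{Guess}(A,v,a,w)=x\,\big|\,(A,v,a,w)\leftarrow\mathcal{D}_y\big]-\Pr\big[\mathrm{Guess}(A,v,a,w)=x\,\big|\,(A,v,a,w)\leftarrow\mathcal{D}\big]\Big|\le\mathrm{negl}(\lambda)$$ for some negligible function $\mathrm{negl}$, where $\mathcal{D}_y$ and $\mathcal{D}$ are the distributions defined in the context.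
   Context: **Parameters.** $\lambda\ge 1$ is the security parameter; $n,m,q,Q,\sigma,\tau$ are functions of $\lambda$ such that: $\log q$ and $\log\sigma$ are polynomially bounded in $\lambda$ ($\log$ is base 2); $\sigma\ge 1$; $q$ is an odd prime; $Q=\lceil\log q\rceil$; $n=\lambda$; $m=n(2Q+1)$; $\tau=q/(4mQ)$. In addition, $\tau\ge 2m\sigma$. A function $f:\mathbb{N}\to\mathbb{R}_{\ge0}$ is negligible if it is $O(\lambda^{-C})$ for all $C>0$. **Notation.** $\mathbb{Z}_q=\{0,\dots,q-1\}$ with arithmetic mod $q$; $|x|=\min\{x,q-x\}$ for $x\in\mathbb{Z}_q$; $\|v\|_\infty=\max_i|v_i|$. $x\leftarrow S$ means uniform sampling from the finite set $S$, and $x\leftarrow\chi$ sampling from the distribution $\chi$. $G(s)$ ($s>0$) is the discrete Gaussian on $\mathbb{Z}$, with $P(X=x)\propto e^{-x^2/(2s^2)}$; $G(s,t)$ is $G(s)$ conditioned on $|X|\le t$; $\chi^m$ denotes $m$ independent samples. **LWE hardness.** In the $\mathrm{LWE}_{n,q,\chi}$ problem, a bit $\beta\leftarrow\{0,1\}$ and a secret $s\leftarrow\mathbb{Z}_q^n$ are sampled once. The solver gets oracle access to samples which, if $\beta=0$, are of the form $(a,a\cdot s+e)$ with $a\leftarrow\mathbb{Z}_q^n$, $e\leftarrow\chi$ fresh for each sample, and, if $\beta=1$, are uniform on $\mathbb{Z}_q^n\times\mathbb{Z}_q$; it must determine $\beta$. "Hard" means that every non-uniform quantum polynomial-time algorithm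 (family of quantum circuits of size polynomial in $\lambda$) succeeds with probability at most $\frac12+\mathrm{negl}(\lambda)$. **Trapdoors.** $\mathrm{GenTrap}()$ is a fixed probabilistic polynomial-time algorithm and $\mathrm{Invert}$ a fixed deterministic polynomial-time algorithm such that: (1) $\mathrm{GenTrap}()$ returns $(A,t)$ with $A\in\mathbb{Z}_q^{m\times n}$ within statistical distance $nQ2^{-n/2}$ of uniform; (2) for every output $(A,t)$ of $\mathrm{GenTrap}()$, every $s\in\mathbb{Z}_q^n$ and every $e\in\mathbb{Z}_q^m$ with $\|e\|_\infty\le 2\tau$, $\mathrm{Invert}(A,As+e,t)=s$. **Distributions.** For $x\in\mathbb{Z}_q$, $\mathcal{D}_x$ is the distribution on $\mathbb{Z}_q^{m\times n}\times\mathbb{Z}_q^m\times\mathbb{Z}_q^n\times\mathbb{Z}_q$ of $(A,v,a,w)$ sampled by: $(A,t)\leftarrow\mathrm{GenTrap}()$; $v=As+e$ with $s\leftarrow\mathbb{Z}_q^n$ and $e\leftarrow G(\sigma,\tau)^m$; $a=f^\top A$ with $f\leftarrow\{0,1\}^m$; $w=f^\top v+x$. ($\mathcal{D}_\alpha$ is the distribution of the message sent by the client with input $\alpha$ in the paper's remote state preparation protocol.) $\mathcal{D}$ is the uniform distribution on $\mathbb{Z}_q^{m\times n}\times\mathbb{Z}_q^m\times\mathbb{Z}_q^n\times\mathbb{Z}_q$. *)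

theory Defs
  imports
    "HOL-Probability.Probability"
    "HOL-Library.Landau_Symbols"
    "HOL-Computational_Algebra.Primes"
    "Jordan_Normal_Form.Matrix"
begin

unbundle no vec_syntax

section \<open>Asymptotics\<close>

definition poly_bounded :: "(nat \<Rightarrow> real) \<Rightarrow> bool" where
  "poly_bounded f \<longleftrightarrow> (\<exists>k::nat. f \<in> O(\<lambda>l. real l ^ k))"

definition negl :: "(nat \<Rightarrow> real) \<Rightarrow> bool" where
  "negl f \<longleftrightarrow> (\<forall>l. 0 \<le> f l) \<and> (\<forall>C>0. f \<in> O(\<lambda>l. real l powr (- C)))"


section \<open>Arithmetic modulo \<open>q\<close>\<close>

text \<open>Elements of \<open>\<int>\<^sub>q\<close> are the integers \<open>0, \<dots>, q - 1\<close>; vectors and matrices over \<open>\<int>\<^sub>q\<close> are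
  integer vectors and matrices with such entries. Bit strings in \<open>{0,1}\<^sup>m\<close> are \<open>zvec 2 m\<close>.\<close>

definition zq :: "nat \<Rightarrow> int set" where
  "zq q = {0..<int q}"

definition zvec :: "nat \<Rightarrow> nat \<Rightarrow> int vec set" where
  "zvec q d = {v \<in> carrier_vec d. \<forall>i<d. v $ i \<in> zq q}"

definition zmat :: "nat \<Rightarrow> nat \<Rightarrow> nat \<Rightarrow> int mat set" where
  "zmat q r c = {A \<in> carrier_mat r c. \<forall>i<r. \<forall>j<c. A $$ (i, j) \<in> zq q}"

definition mod_vec :: "nat \<Rightarrow> int vec \<Rightarrow> int vec" where
  "mod_vec q v = map_vec (\<lambda>x. x mod int q) v"

definition zabs :: "nat \<Rightarrow> int \<Rightarrow> int" where
  "zabs q x = min x (int q - x)"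

definition norm_inf :: "nat \<Rightarrow> int vec \<Rightarrow> int" where
  "norm_inf q v = Max ((\<lambda>i. zabs q (v $ i)) ` {..<dim_vec v})"


section \<open>Bit encodings\<close>

text \<open>\<open>zlen q\<close> = \<open>\<lceil>log q\<rceil>\<close> bits suffice for an element of \<open>\<int>\<^sub>q\<close>, least significant bit first.\<close>

definition zlen :: "nat \<Rightarrow> nat" where
  "zlen q = nat \<lceil>log 2 (real q)\<rceil>"

definition enc_z :: "nat \<Rightarrow> int \<Rightarrow> bool list" where
  "enc_z q x = map (bit x) [0..<zlen q]"

definition enc_vec :: "nat \<Rightarrow> int vec \<Rightarrow> bool list" where
  "enc_vec q v = concat (map (enc_z q) (list_of_vec v))"

definition enc_mat :: "nat \<Rightarrow> int mat \<Rightarrow> bool list" where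
  "enc_mat q A = concat (map (enc_vec q) (rows A))"


section \<open>Quantum circuits\<close>

text \<open>
  The gate set is Clifford+T, together with the (redundant) gates X and Toffoli. Wires are numbered
  from 0. A \<open>Query\<close> asks a sampling oracle that takes no input: each use draws a fresh classical
  sample, whose bits are XORed into the listed wires.
\<close>

datatype gate =
    Gate_X nat | Gate_H nat | Gate_T nat | Gate_CNOT nat nat | Gate_Toffoli nat nat nat

datatype instr = Gate gate | Query "nat list"

datatype circuit = Circuit (wires: nat) (body: "instr list") (outs: "nat list")

fun gate_wires :: "gate \<Rightarrow> nat list" where
  "gate_wires (Gate_X i) = [i]"
| "gate_wires (Gate_H i) = [i]"
| "gate_wires (Gate_T i) = [i]"
| "gate_wires (Gate_CNOT i j) = [i, j]"
| "gate_wires (Gate_Toffoli i j k) = [i, j, k]"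

fun instr_wires :: "instr \<Rightarrow> nat list" where
  "instr_wires (Gate g) = gate_wires g"
| "instr_wires (Query ws) = ws"

text \<open>A state of \<open>w\<close> qubits assigns an amplitude to each bit string of length \<open>w\<close>; values at other
  lists are irrelevant. Gates are written as the pullback of amplitudes, i.e. the value of the new
  amplitude at \<open>b\<close>; in \<open>Gate_CNOT i j\<close> and \<open>Gate_Toffoli i j k\<close> the last wire is the target.\<close>

type_synonym qstate = "bool list \<Rightarrow> complex"

fun apply_gate :: "gate \<Rightarrow> qstate \<Rightarrow> qstate" where
  "apply_gate (Gate_X i) \<psi> = (\<lambda>b. \<psi> (b[i := \<not> b ! i]))"
| "apply_gate (Gate_H i) \<psi> =
     (\<lambda>b. (\<psi> (b[i := False]) + (if b ! i then -1 else 1) * \<psi> (b[i := True])) / complex_of_real (sqrt 2))"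
| "apply_gate (Gate_T i) \<psi> = (\<lambda>b. (if b ! i then cis (pi / 4) else 1) * \<psi> b)"
| "apply_gate (Gate_CNOT i j) \<psi> = (\<lambda>b. \<psi> (b[j := (b ! j \<noteq> b ! i)]))"
| "apply_gate (Gate_Toffoli i j k) \<psi> = (\<lambda>b. \<psi> (b[k := (b ! k \<noteq> (b ! i \<and> b ! j))]))"

definition xor_bits :: "nat list \<Rightarrow> bool list \<Rightarrow> bool list \<Rightarrow> bool list" where
  "xor_bits ws d b = fold (\<lambda>(i, x) c. c[i := (c ! i \<noteq> x)]) (zip ws d) b"

text \<open>The argument \<open>ds\<close> is the list of answers of the oracle to the successive queries.\<close>

fun run :: "instr list \<Rightarrow> bool list list \<Rightarrow> qstate \<Rightarrow> qstate" where
  "run [] ds \<psi> = \<psi>"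
| "run (Gate g # is) ds \<psi> = run is ds (apply_gate g \<psi>)"
| "run (Query ws # is) (d # ds) \<psi> = run is ds (\<lambda>b. \<psi> (xor_bits ws d b))"
| "run (Query ws # is) [] \<psi> = run is [] \<psi>"

definition init_state :: "nat \<Rightarrow> bool list \<Rightarrow> qstate" where
  "init_state w x = (\<lambda>b. if b = x @ replicate (w - length x) False then 1 else 0)"

text \<open>Probability that measuring the output wires in the computational basis, after running the
  circuit on the classical input \<open>x\<close> and all other wires initially zero, yields \<open>y\<close>.\<close>

definition out_prob :: "circuit \<Rightarrow> bool list \<Rightarrow> bool list list \<Rightarrow> bool list \<Rightarrow> real" where
  "out_prob C x ds y =
     (\<Sum>b | length b = wires C \<and> map ((!) b) (outs C) = y.
        (cmod (run (body C) ds (init_state (wires C) x) b))\<^sup>2)"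

definition num_queries :: "circuit \<Rightarrow> nat" where
  "num_queries C = length (filter (\<lambda>i. \<exists>ws. i = Query ws) (body C))"

definition circuit_size :: "circuit \<Rightarrow> nat" where
  "circuit_size C = wires C + length (body C)"

text \<open>Circuits with \<open>inlen\<close> input bits, \<open>outlen\<close> output bits and oracle answers of \<open>anslen\<close> bits.\<close>

definition oracle_circuit :: "nat \<Rightarrow> nat \<Rightarrow> nat \<Rightarrow> circuit \<Rightarrow> bool" where
  "oracle_circuit inlen anslen outlen C \<longleftrightarrow>
     inlen \<le> wires C \<and>
     (\<forall>i \<in> set (body C). distinct (instr_wires i) \<and> set (instr_wires i) \<subseteq> {..<wires C}) \<and>
     (\<forall>ws. Query ws \<in> set (body C) \<longrightarrow> length ws = anslen) \<and>
     distinct (outs C) \<and> set (outs C) \<subseteq> {..<wires C} \<and> length (outs C) = outlen"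

definition quantum_circuit :: "nat \<Rightarrow> nat \<Rightarrow> circuit \<Rightarrow> bool" where
  "quantum_circuit inlen outlen C \<longleftrightarrow> oracle_circuit inlen 0 outlen C \<and> num_queries C = 0"

definition classical_circuit :: "nat \<Rightarrow> nat \<Rightarrow> circuit \<Rightarrow> bool" where
  "classical_circuit inlen outlen C \<longleftrightarrow> quantum_circuit inlen outlen C \<and>
     (\<forall>i. Gate (Gate_H i) \<notin> set (body C) \<and> Gate (Gate_T i) \<notin> set (body C))"

definition poly_size :: "(nat \<Rightarrow> circuit) \<Rightarrow> bool" where
  "poly_size C \<longleftrightarrow> poly_bounded (\<lambda>l. real (circuit_size (C l)))"

text \<open>Efficiently samplable and efficiently computable families. The random tape consists of
  independent uniform elements of \<open>\<int>\<^sub>k\<close> for the numbers \<open>k\<close> in the list \<open>ks l\<close>; fair coins are the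
  case \<open>k = 2\<close>. The circuits need not be generated uniformly in \<open>l\<close>, so every probabilistic
  (respectively deterministic) polynomial-time algorithm is covered.\<close>

definition tape_enc :: "nat list \<Rightarrow> int list \<Rightarrow> bool list" where
  "tape_enc ks r = concat (map (\<lambda>(k, x). enc_z k x) (zip ks r))"

definition efficient_sampler :: "(nat \<Rightarrow> nat) \<Rightarrow> (nat \<Rightarrow> bool list pmf) \<Rightarrow> bool" where
  "efficient_sampler outlen G \<longleftrightarrow>
     (\<exists>C ks F. poly_size C \<and>
       (\<forall>l\<ge>1. (\<forall>k \<in> set (ks l). 1 \<le> k) \<and>
          classical_circuit (sum_list (map zlen (ks l))) (outlen l) (C l) \<and>
          (\<forall>r \<in> listset (map zq (ks l)). out_prob (C l) (tape_enc (ks l) r) [] (F l r) = 1) \<and>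
          G l = map_pmf (F l) (pmf_of_set (listset (map zq (ks l))))))"

definition efficient_function ::
  "(nat \<Rightarrow> nat) \<Rightarrow> (nat \<Rightarrow> nat) \<Rightarrow> (nat \<Rightarrow> (bool list \<times> bool list) set) \<Rightarrow> bool" where
  "efficient_function inlen outlen R \<longleftrightarrow>
     (\<exists>C. poly_size C \<and>
       (\<forall>l\<ge>1. classical_circuit (inlen l) (outlen l) (C l) \<and>
          (\<forall>(x, y) \<in> R l. out_prob (C l) x [] y = 1)))"


section \<open>Discrete Gaussians\<close>

definition dgauss :: "real \<Rightarrow> int pmf" where
  "dgauss s = embed_pmf (\<lambda>x. exp (- (real_of_int x)\<^sup>2 / (2 * s\<^sup>2)) /
     (\<Sum>\<^sub>\<infinity>y::int. exp (- (real_of_int y)\<^sup>2 / (2 * s\<^sup>2))))"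

text \<open>The weights are summable, so \<open>dgauss s\<close> really has the intended mass function.\<close>

lemma summable_gauss:
  assumes "s > 0"
  shows "(\<lambda>x::int. exp (- (real_of_int x)\<^sup>2 / (2 * s\<^sup>2))) summable_on UNIV"
proof -
  define c where "c = exp (- 1 / (2 * s\<^sup>2))"
  have c: "0 < c" "c < 1" using assms by (auto simp: c_def)
  have bd: "exp (- (real_of_int x)\<^sup>2 / (2 * s\<^sup>2)) \<le> c ^ nat \<bar>x\<bar>" for x
  proof -
    have "\<bar>x\<bar> \<le> x\<^sup>2" using self_le_power[of "\<bar>x\<bar>" 2] by (cases "x = 0") auto
    hence "real_of_int \<bar>x\<bar> \<le> real_of_int (x\<^sup>2)" by linarith
    hence "- (real_of_int x)\<^sup>2 / (2 * s\<^sup>2) \<le> real (nat \<bar>x\<bar>) * (- 1 / (2 * s\<^sup>2))"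
      using assms by (simp add: field_simps)
    thus ?thesis by (simp add: c_def exp_of_nat_mult[symmetric])
  qed
  have g: "(\<lambda>k::nat. c ^ k) summable_on UNIV"
    using c by (intro norm_summable_imp_summable_on) (auto simp: summable_geometric)
  have a: "(\<lambda>x::int. c ^ nat x) summable_on {0..}"
    using summable_on_reindex_bij_betw[of nat "{0..}" UNIV "\<lambda>k. c ^ k"] g bij_betwI[of nat "{0..}" UNIV int]
    by auto
  have b: "(\<lambda>x::int. c ^ nat (- x)) summable_on {..0}"
    using summable_on_reindex_bij_betw[of "\<lambda>x. nat (- x)" "{..0}" UNIV "\<lambda>k. c ^ k"] g
      bij_betwI[of "\<lambda>x. nat (- x)" "{..0}" UNIV "\<lambda>k. - int k"]
    by auto
  have a': "(\<lambda>x::int. c ^ nat \<bar>x\<bar>) summable_on {0..}"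
    using a by (rule summable_on_cong[THEN iffD1, rotated]) auto
  have b': "(\<lambda>x::int. c ^ nat \<bar>x\<bar>) summable_on {..<0}"
    by (rule summable_on_cong[THEN iffD1, OF _ summable_on_subset_banach[OF b, of "{..<0}"]]) auto
  have "{0..} \<union> {..<0} = (UNIV :: int set)" by auto
  moreover have "{0..} \<inter> {..<0} = ({} :: int set)" by auto
  ultimately
  have "(\<lambda>x::int. c ^ nat \<bar>x\<bar>) summable_on UNIV" using summable_on_Un_disjoint[OF a' b'] by simp
  thus ?thesis by (rule summable_on_comparison_test) (use bd in auto)
qed

lemma pmf_dgauss:
  assumes "s > 0"
  shows "pmf (dgauss s) x = exp (- (real_of_int x)\<^sup>2 / (2 * s\<^sup>2)) /
     (\<Sum>\<^sub>\<infinity>y::int. exp (- (real_of_int y)\<^sup>2 / (2 * s\<^sup>2)))"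
proof -
  define g where "g = (\<lambda>x::int. exp (- (real_of_int x)\<^sup>2 / (2 * s\<^sup>2)))"
  define Z where "Z = infsum g UNIV"
  have g0: "g x > 0" for x by (simp add: g_def)
  have S: "g summable_on UNIV" unfolding g_def by (rule summable_gauss[OF assms])
  have "infsum g {0} \<le> infsum g UNIV"
    by (rule infsum_mono_neutral) (use S g0 less_imp_le in \<open>auto intro: less_imp_le\<close>)
  hence Z: "Z > 0" using g0[of 0] by (simp add: Z_def)
  have p0: "g x * inverse Z \<ge> 0" for x using Z g0[of x] by simp
  have S': "(\<lambda>x. g x * inverse Z) summable_on UNIV" by (rule summable_on_cmult_left[OF S])
  have ab: "Infinite_Set_Sum.abs_summable_on (\<lambda>x. g x * inverse Z) UNIV"
    unfolding abs_summable_equivalent[symmetric] using S' p0 by (simp only: real_norm_def abs_of_nonneg)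
  have "infsum (\<lambda>x. g x * inverse Z) UNIV = Z * inverse Z"
    unfolding Z_def by (rule infsum_cmult_left')
  also have "\<dots> = 1" using Z by simp
  finally have "(\<integral>\<^sup>+ x. ennreal (g x * inverse Z) \<partial>count_space UNIV) = 1"
    using nn_integral_conv_infsetsum[OF ab p0] infsetsum_infsum[OF ab] by simp
  hence "pmf (embed_pmf (\<lambda>x. g x * inverse Z)) x = g x * inverse Z"
    by (intro pmf_embed_pmf p0)
  thus ?thesis
    unfolding dgauss_def g_def Z_def by (simp only: divide_inverse)
qed

definition dgauss_trunc :: "real \<Rightarrow> real \<Rightarrow> int pmf" where
  "dgauss_trunc s t = cond_pmf (dgauss s) {x. real_of_int \<bar>x\<bar> \<le> t}"


section \<open>Learning with errors\<close>

definition lwe_sample :: "nat \<Rightarrow> nat \<Rightarrow> int pmf \<Rightarrow> int vec \<Rightarrow> (int vec \<times> int) pmf" where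
  "lwe_sample n q \<chi> s = do {
     a \<leftarrow> pmf_of_set (zvec q n);
     e \<leftarrow> \<chi>;
     return_pmf (a, (scalar_prod a s + e) mod int q)
   }"

definition lwe_oracle :: "nat \<Rightarrow> nat \<Rightarrow> int pmf \<Rightarrow> bool \<Rightarrow> int vec \<Rightarrow> (int vec \<times> int) pmf" where
  "lwe_oracle n q \<chi> \<beta> s = (if \<beta> then pmf_of_set (zvec q n \<times> zq q) else lwe_sample n q \<chi> s)"

definition enc_sample :: "nat \<Rightarrow> int vec \<times> int \<Rightarrow> bool list" where
  "enc_sample q = (\<lambda>(a, c). enc_vec q a @ enc_z q c)"

text \<open>The bit \<open>\<beta> = 1\<close> is represented by \<open>True\<close>. As the oracle takes no input, its
  answers can be drawn ahead of the run of the solver.\<close>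

definition lwe_success :: "nat \<Rightarrow> nat \<Rightarrow> int pmf \<Rightarrow> circuit \<Rightarrow> real" where
  "lwe_success n q \<chi> C =
     measure_pmf.expectation
       (do {
          \<beta> \<leftarrow> pmf_of_set (UNIV :: bool set);
          s \<leftarrow> pmf_of_set (zvec q n);
          ds \<leftarrow> replicate_pmf (num_queries C) (lwe_oracle n q \<chi> \<beta> s);
          return_pmf (\<beta>, ds)
        })
       (\<lambda>(\<beta>, ds). out_prob C [] (map (enc_sample q) ds) [\<beta>])"

definition lwe_hard :: "(nat \<Rightarrow> nat) \<Rightarrow> (nat \<Rightarrow> nat) \<Rightarrow> (nat \<Rightarrow> int pmf) \<Rightarrow> bool" where
  "lwe_hard n q \<chi> \<longleftrightarrow>
     (\<forall>C. poly_size C \<and> (\<forall>l\<ge>1. oracle_circuit 0 ((n l + 1) * zlen (q l)) 1 (C l)) \<longrightarrow>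
        (\<exists>\<epsilon>. negl \<epsilon> \<and> (\<forall>l\<ge>1. lwe_success (n l) (q l) (\<chi> l) (C l) \<le> 1 / 2 + \<epsilon> l)))"


section \<open>Trapdoors\<close>

definition stat_dist :: "'a pmf \<Rightarrow> 'a pmf \<Rightarrow> real" where
  "stat_dist P R = (\<Sum>\<^sub>\<infinity>x. \<bar>pmf P x - pmf R x\<bar>) / 2"

text \<open>Trapdoors are bit strings of some length \<open>tlen l\<close>.\<close>

definition gentrap_algorithm ::
  "(nat \<Rightarrow> nat) \<Rightarrow> (nat \<Rightarrow> nat) \<Rightarrow> (nat \<Rightarrow> nat) \<Rightarrow> (nat \<Rightarrow> nat) \<Rightarrow>
     (nat \<Rightarrow> (int mat \<times> bool list) pmf) \<Rightarrow> bool" where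
  "gentrap_algorithm n m q tlen GenTrap \<longleftrightarrow>
     (\<forall>l\<ge>1. \<forall>(A, t) \<in> set_pmf (GenTrap l). A \<in> zmat (q l) (m l) (n l) \<and> length t = tlen l) \<and>
     efficient_sampler (\<lambda>l. m l * n l * zlen (q l) + tlen l)
       (\<lambda>l. map_pmf (\<lambda>(A, t). enc_mat (q l) A @ t) (GenTrap l))"

definition invert_algorithm ::
  "(nat \<Rightarrow> nat) \<Rightarrow> (nat \<Rightarrow> nat) \<Rightarrow> (nat \<Rightarrow> nat) \<Rightarrow> (nat \<Rightarrow> nat) \<Rightarrow>
     (nat \<Rightarrow> int mat \<Rightarrow> int vec \<Rightarrow> bool list \<Rightarrow> int vec) \<Rightarrow> bool" where
  "invert_algorithm n m q tlen Invert \<longleftrightarrow>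
     (\<forall>l\<ge>1. \<forall>A \<in> zmat (q l) (m l) (n l). \<forall>v \<in> zvec (q l) (m l). \<forall>t. length t = tlen l \<longrightarrow>
        Invert l A v t \<in> zvec (q l) (n l)) \<and>
     efficient_function (\<lambda>l. m l * n l * zlen (q l) + m l * zlen (q l) + tlen l)
       (\<lambda>l. n l * zlen (q l))
       (\<lambda>l. {(enc_mat (q l) A @ enc_vec (q l) v @ t, enc_vec (q l) (Invert l A v t)) | A v t.
          A \<in> zmat (q l) (m l) (n l) \<and> v \<in> zvec (q l) (m l) \<and> length t = tlen l})"


section \<open>The distributions of the client's message\<close>

type_synonym message = "int mat \<times> int vec \<times> int vec \<times> int"

definition messages :: "nat \<Rightarrow> nat \<Rightarrow> nat \<Rightarrow> message set" where
  "messages n m q = zmat q m n \<times> zvec q m \<times> zvec q n \<times> zq q"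

definition client_dist ::
  "nat \<Rightarrow> nat \<Rightarrow> nat \<Rightarrow> int pmf \<Rightarrow> (int mat \<times> bool list) pmf \<Rightarrow> int \<Rightarrow> message pmf" where
  "client_dist n m q \<chi> gt x = do {
     (A, t) \<leftarrow> gt;
     s \<leftarrow> pmf_of_set (zvec q n);
     e \<leftarrow> map_pmf vec_of_list (replicate_pmf m \<chi>);
     f \<leftarrow> pmf_of_set (zvec 2 m);
     let v = mod_vec q (A *\<^sub>v s + e);
     return_pmf (A, v, mod_vec q (transpose_mat A *\<^sub>v f), (scalar_prod f v + x) mod int q)
   }"

definition uniform_dist :: "nat \<Rightarrow> nat \<Rightarrow> nat \<Rightarrow> message pmf" where
  "uniform_dist n m q = pmf_of_set (messages n m q)"

definition enc_message :: "nat \<Rightarrow> message \<Rightarrow> bool list" where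
  "enc_message q = (\<lambda>(A, v, a, w). enc_mat q A @ enc_vec q v @ enc_vec q a @ enc_z q w)"


section \<open>Guessing algorithms\<close>

definition guess_prob :: "nat \<Rightarrow> circuit \<Rightarrow> message \<Rightarrow> int \<Rightarrow> real" where
  "guess_prob q C M x = out_prob C (enc_message q M) [] (enc_z q x)"

definition guess_algorithm ::
  "(nat \<Rightarrow> nat) \<Rightarrow> (nat \<Rightarrow> nat) \<Rightarrow> (nat \<Rightarrow> nat) \<Rightarrow> (nat \<Rightarrow> circuit) \<Rightarrow> bool" where
  "guess_algorithm n m q Guess \<longleftrightarrow>
     poly_size Guess \<and>
     (\<forall>l\<ge>1. quantum_circuit ((m l * n l + m l + n l + 1) * zlen (q l)) (zlen (q l)) (Guess l) \<and>
        (\<forall>M \<in> messages (n l) (m l) (q l). (\<Sum>x \<in> zq (q l). guess_prob (q l) (Guess l) M x) = 1))"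

text \<open>The probability of \<open>Guess = x\<close> on an input drawn from \<open>D\<close>.\<close>

definition guess_prob_on :: "nat \<Rightarrow> circuit \<Rightarrow> message pmf \<Rightarrow> int \<Rightarrow> real" where
  "guess_prob_on q C D x = measure_pmf.expectation D (\<lambda>M. guess_prob q C M x)"

end

(* Three hybrids. Replacing the matrix of GenTrap by a uniform one costs twice its statistical
   distance. Replacing v = As + e by a uniform v costs the LWE advantage: m oracle samples supply A
   and v, the adversary computes a = f^T A and w = f.v + y and runs Guess. For uniform A and v the
   leftover hash lemma makes (a, w) uniform up to sqrt (q^(n+1) / 2^m) <= 2^(-n/2), because m exceeds
   (n + 1) log q by at least n.

   The adversary is nonuniform, so f can be fixed to its best value. Given the samples, the qubits
   are then in a computational basis state when Guess starts, and neither a superposition over f nor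
   uncomputation of the scratch wires is needed. *)

theory Submission
  imports Defs "HOL-Real_Asymp.Real_Asymp"
begin

text \<open>Hardness is a statement about circuits, so the LWE step needs an explicit circuit of
  polynomial size, and most of the work goes into it. The queries write the samples directly onto
  input wires of Guess; reversible gates compute a and w on scratch wires and copy them to their
  places; the gates of Guess follow unchanged; a comparison of its output wires with the encoding of
  x yields the answer. Besides f, the values x and y and one further bit s are built into the
  circuit for each security parameter. The bit s is needed because hardness bounds a success
  probability from above, while the theorem bounds an absolute value: s decides whether "Guess
  returned x" counts as evidence for LWE samples or for uniform ones, and choosing it well turns the
  success probability into 1/2 plus half the absolute difference. The scratch wires hold garbage
  that depends on the samples, but for given samples it is a fixed bit string, so Guess acts as if
  those wires were absent. The collision bound behind the leftover hash lemma rests on the fact that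
  two distinct bit vectors differ by 1 or -1 in some position, and these are units modulo q.\<close>

section \<open>NAND programs and modular arithmetic\<close>

text \<open>\<open>derives G k H\<close>: starting from the functions in \<open>G\<close>, a straight-line program of \<open>k\<close> NAND steps
  computes those in \<open>H\<close>. Keeping sets of functions instead of formulas lets intermediate results
  be shared, which the carry chains of the adder need to remain of polynomial size.\<close>

inductive derives :: "('u \<Rightarrow> bool) set \<Rightarrow> nat \<Rightarrow> ('u \<Rightarrow> bool) set \<Rightarrow> bool" for G where
  derives_refl: "derives G 0 G"
| derives_step: "\<lbrakk>derives G k H; f \<in> H; g \<in> H\<rbrakk> \<Longrightarrow> derives G (Suc k) (insert (\<lambda>u. \<not> (f u \<and> g u)) H)"

lemma derives_supset: "derives G k H \<Longrightarrow> G \<subseteq> H"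
  by (induction rule: derives.induct) auto

lemma derives_trans: "derives H j K \<Longrightarrow> derives G k H \<Longrightarrow> derives G (k + j) K"
proof (induction rule: derives.induct)
  case (derives_step j K f g)
  thus ?case using derives.derives_step[of G "k + j" K f g] by simp
qed simp

lemma derives_weaken: "derives G k H \<Longrightarrow> derives (G \<union> K) k (H \<union> K)"
proof (induction rule: derives.induct)
  case derives_refl
  show ?case by (rule derives.derives_refl)
next
  case (derives_step k H f g)
  thus ?case using derives.derives_step[of "G \<union> K" k "H \<union> K" f g] by auto
qed

text \<open>\<open>derives\<close> counts steps exactly and lists every intermediate function. Here
  the count is only bounded and by-products are ignored, so programs can be composed knowing nothing
  but what they deliver.\<close>

definition reaches :: "('u \<Rightarrow> bool) set \<Rightarrow> nat \<Rightarrow> ('u \<Rightarrow> bool) set \<Rightarrow> bool" where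
  "reaches G k T \<longleftrightarrow> (\<exists>j\<le>k. \<exists>H. derives G j H \<and> T \<subseteq> H)"

lemma reaches_refl: "T \<subseteq> G \<Longrightarrow> reaches G k T"
  unfolding reaches_def by (blast intro: derives_refl)

lemma reaches_mono:
  assumes "reaches G k T" "G \<subseteq> G'" "k \<le> k'" "T' \<subseteq> T"
  shows "reaches G' k' T'"
proof -
  obtain j H where "j \<le> k" "derives G j H" "T \<subseteq> H" using assms(1) by (auto simp: reaches_def)
  moreover from this have "derives G' j (H \<union> G')"
    using derives_weaken[of G j H G'] assms(2) by (simp add: Un_absorb1)
  ultimately show ?thesis using assms by (auto simp: reaches_def intro!: exI[of _ j] exI[of _ "H \<union> G'"])
qed

text \<open>Nothing is ever erased: the second program may read \<open>T\<close>, and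
  \<open>T\<close> is still there when it ends.\<close>

lemma reaches_trans:
  assumes "reaches G k T" "reaches (G \<union> T) j T'"
  shows "reaches G (k + j) (T \<union> T')"
proof -
  obtain a H where a: "a \<le> k" "derives G a H" "T \<subseteq> H" using assms(1) by (auto simp: reaches_def)
  obtain b K where b: "b \<le> j" "derives (G \<union> T) b K" "T' \<subseteq> K" using assms(2) by (auto simp: reaches_def)
  have "derives H b (K \<union> H)"
    using derives_weaken[OF b(2), of H] a derives_supset[OF a(2)] by (simp add: Un_absorb1)
  from derives_trans[OF this a(2)] show ?thesis
    using a b unfolding reaches_def by (intro exI[of _ "a + b"] exI[of _ "K \<union> H"] conjI) auto
qed

lemma reaches_nand:
  assumes "f \<in> G" "g \<in> G" "reaches (insert (\<lambda>u. \<not> (f u \<and> g u)) G) k T"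
  shows "reaches G (Suc k) T"
proof -
  have "reaches G 1 {\<lambda>u. \<not> (f u \<and> g u)}"
    unfolding reaches_def using derives_step[OF derives_refl assms(1,2)] by auto
  from reaches_trans[OF this, of k T] assms(3) have "reaches G (1 + k) ({\<lambda>u. \<not> (f u \<and> g u)} \<union> T)" by simp
  thus ?thesis by (rule reaches_mono) auto
qed

lemma reaches_UN:
  assumes "\<And>j. j < N \<Longrightarrow> reaches G c (T j)"
  shows "reaches G (N * c) (\<Union>j<N. T j)"
  using assms
proof (induction N)
  case (Suc N)
  have "reaches G (N * c) (\<Union>j<N. T j)" using Suc by simp
  moreover have "reaches (G \<union> (\<Union>j<N. T j)) c (T N)" by (rule reaches_mono[OF Suc(2)[of N]]) auto
  ultimately have "reaches G (N * c + c) ((\<Union>j<N. T j) \<union> T N)" by (rule reaches_trans)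
  thus ?case by (simp add: lessThan_Suc add.commute Un_commute)
qed (auto intro: reaches_refl)

text \<open>Programs start without constants, but the NAND of any function with its own negation is
  constantly true. One available function is enough, whichever it is.\<close>

lemma reaches_const:
  assumes "f \<in> G"
  shows "reaches G 3 {\<lambda>u. True, \<lambda>u. False}"
proof -
  let ?nand = "\<lambda>f g u. \<not> (f u \<and> g u)"
  define n where "n = ?nand f f"
  define t where "t = ?nand f n"
  define e where "e = ?nand t t"
  have "reaches G (Suc (Suc (Suc 0))) {t, e}"
    apply (rule reaches_nand[of f _ f, folded n_def], use assms in simp, use assms in simp)
    apply (rule reaches_nand[of f _ n, folded t_def], use assms in simp, use assms in simp)
    apply (rule reaches_nand[of t _ t, folded e_def], use assms in simp, use assms in simp)
    apply (rule reaches_refl, simp)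
    done
  moreover have "t = (\<lambda>u. True)" "e = (\<lambda>u. False)" by (simp_all add: n_def t_def e_def)
  ultimately show ?thesis by (simp add: eval_nat_numeral)
qed

text \<open>The classical full adder with nine NAND gates: two exclusive-ors of four gates each, and
  the NAND of their first gates \<open>n1\<close> and \<open>n2\<close> is the carry.\<close>

lemma reaches_full_adder:
  assumes "x \<in> G" "y \<in> G" "c \<in> G"
  shows "reaches G 9 {\<lambda>u. (x u \<noteq> y u) \<noteq> c u, \<lambda>u. (x u \<and> y u) \<or> (c u \<and> (x u \<noteq> y u))}"
proof -
  let ?nand = "\<lambda>f g u. \<not> (f u \<and> g u)"
  define n1 where "n1 = ?nand x y"
  define h1 where "h1 = ?nand x n1"
  define h2 where "h2 = ?nand y n1"
  define h where "h = ?nand h1 h2"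
  define n2 where "n2 = ?nand h c"
  define s1 where "s1 = ?nand h n2"
  define s2 where "s2 = ?nand c n2"
  define s where "s = ?nand s1 s2"
  define d where "d = ?nand n1 n2"
  note defs = n1_def h1_def h2_def h_def n2_def s1_def s2_def s_def d_def
  have "reaches G (Suc (Suc (Suc (Suc (Suc (Suc (Suc (Suc (Suc 0))))))))) {s, d}"
    apply (rule reaches_nand[of x _ y, folded n1_def], use assms in simp, use assms in simp)
    apply (rule reaches_nand[of x _ n1, folded h1_def], use assms in simp, use assms in simp)
    apply (rule reaches_nand[of y _ n1, folded h2_def], use assms in simp, use assms in simp)
    apply (rule reaches_nand[of h1 _ h2, folded h_def], use assms in simp, use assms in simp)
    apply (rule reaches_nand[of h _ c, folded n2_def], use assms in simp, use assms in simp)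
    apply (rule reaches_nand[of h _ n2, folded s1_def], use assms in simp, use assms in simp)
    apply (rule reaches_nand[of c _ n2, folded s2_def], use assms in simp, use assms in simp)
    apply (rule reaches_nand[of s1 _ s2, folded s_def], use assms in simp, use assms in simp)
    apply (rule reaches_nand[of n1 _ n2, folded d_def], use assms in simp, use assms in simp)
    apply (rule reaches_refl, simp)
    done
  moreover have "s = (\<lambda>u. (x u \<noteq> y u) \<noteq> c u)" "d = (\<lambda>u. (x u \<and> y u) \<or> (c u \<and> (x u \<noteq> y u)))"
    using assms by - (rule ext; case_tac "x u"; case_tac "y u"; case_tac "c u"; simp add: defs)+
  ultimately show ?thesis by (simp add: eval_nat_numeral)
qed

lemma reaches_mux:
  assumes "c \<in> G" "f \<in> G" "g \<in> G"
  shows "reaches G 4 {\<lambda>u. if c u then f u else g u}"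
proof -
  let ?nand = "\<lambda>f g u. \<not> (f u \<and> g u)"
  define n where "n = ?nand c c"
  define a where "a = ?nand c f"
  define b where "b = ?nand n g"
  define r where "r = ?nand a b"
  have "reaches G (Suc (Suc (Suc (Suc 0)))) {r}"
    apply (rule reaches_nand[of c _ c, folded n_def], use assms in simp, use assms in simp)
    apply (rule reaches_nand[of c _ f, folded a_def], use assms in simp, use assms in simp)
    apply (rule reaches_nand[of n _ g, folded b_def], use assms in simp, use assms in simp)
    apply (rule reaches_nand[of a _ b, folded r_def], use assms in simp, use assms in simp)
    apply (rule reaches_refl, simp)
    done
  moreover have "r = (\<lambda>u. if c u then f u else g u)"
    by (auto simp: n_def a_def b_def r_def fun_eq_iff)
  ultimately show ?thesis by (simp add: eval_nat_numeral)
qed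

lemma reaches_all:
  assumes "\<And>i. i < k \<Longrightarrow> g i \<in> G" "(\<lambda>u. True) \<in> G"
  shows "reaches G (3 * k) {\<lambda>u. \<forall>i<k. g i u = c i}"
  using assms(1)
proof (induction k)
  case 0
  thus ?case using assms by (auto intro: reaches_refl)
next
  case (Suc k)
  let ?P = "\<lambda>k u. \<forall>i<k. g i u = c i"
  let ?nand = "\<lambda>f g u. \<not> (f u \<and> g u)"
  let ?g = "\<lambda>u. g k u = c k"
  have IH: "reaches G (3 * k) {?P k}" using Suc by simp
  let ?G = "insert (?P k) G"
  define n where "n = ?nand (g k) (g k)"
  \<comment> \<open>\<open>l\<close> costs no gate of its own: it is \<open>g k\<close> or the
    negation \<open>n\<close>, depending on the constant \<open>c k\<close>.\<close>
  define l where "l = (\<lambda>u. g k u = c k)"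
  define a where "a = ?nand (?P k) l"
  have "reaches ?G (Suc (Suc (Suc 0))) {?nand a a}"
    apply (rule reaches_nand[of "g k" _ "g k", folded n_def], use Suc in simp, use Suc in simp)
    apply (rule reaches_nand[of "?P k" _ l, folded a_def], simp)
     apply (cases "c k"; use Suc in \<open>force simp: l_def n_def\<close>)
    apply (rule reaches_nand[of a _ a], simp, simp)
    apply (rule reaches_refl, simp)
    done
  moreover have "?nand a a = ?P (Suc k)" by (auto simp: a_def l_def fun_eq_iff less_Suc_eq)
  ultimately have "reaches (G \<union> {?P k}) 3 {?P (Suc k)}" by (simp add: eval_nat_numeral)
  from reaches_trans[OF IH this] show ?case by (rule reaches_mono) auto
qed

section \<open>Binary addition and reduction modulo q\<close>

text \<open>\<open>c k\<close> is the carry into position k, given without recursion: the two low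
  parts add up to less than 2 * 2^k, so bit k of their sum is the overflow. No sign condition is
  imposed, because \<open>take_bit\<close> reads negative integers in two's complement; the
  subtraction of the modulus relies on this.\<close>

lemma bit_add_carry:
  fixes a b :: int
  defines "c k \<equiv> bit (take_bit k a + take_bit k b) k"
  shows "bit (a + b) k \<longleftrightarrow> (bit a k \<noteq> bit b k) \<noteq> c k"
    and "c (Suc k) \<longleftrightarrow> (bit a k \<and> bit b k) \<or> (c k \<and> (bit a k \<noteq> bit b k))"
proof -
  define s where "s = take_bit k a + take_bit k b"
  define x y :: int where "x = of_bool (bit a k)" and "y = of_bool (bit b k)"
  have s: "0 \<le> s" "s < 2 * 2 ^ k"
    using take_bit_int_less_exp[of k a] take_bit_int_less_exp[of k b] by (simp_all add: s_def del: take_bit_int_less_exp)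
  have c: "c k \<longleftrightarrow> s \<ge> 2 ^ k"
  proof (cases "s \<ge> 2 ^ k")
    case True
    have "s div 2 ^ k = 1" using s True by (intro int_div_pos_eq[where r = "s - 2 ^ k"]) auto
    thus ?thesis using True by (simp add: c_def s_def[symmetric] bit_iff_odd)
  next
    case False
    thus ?thesis using s by (simp add: c_def s_def[symmetric] bit_iff_odd)
  qed
  have S: "take_bit (Suc k) a + take_bit (Suc k) b = s + 2 ^ k * (x + y)"
    by (simp add: take_bit_Suc_from_most s_def x_def y_def algebra_simps)
  have ge: "bit t (Suc k) \<longleftrightarrow> t \<ge> 2 * 2 ^ k" if "0 \<le> t" "t < 4 * 2 ^ k" for t :: int
  proof (cases "t \<ge> 2 * 2 ^ k")
    case True
    have "t div (2 * 2 ^ k) = 1" using that True by (intro int_div_pos_eq[where r = "t - 2 * 2 ^ k"]) auto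
    thus ?thesis using True by (simp add: bit_iff_odd)
  next
    case False
    thus ?thesis using that by (simp add: bit_iff_odd)
  qed
  have "c (Suc k) \<longleftrightarrow> bit (s + 2 ^ k * (x + y)) (Suc k)" by (simp only: c_def S)
  also have "\<dots> \<longleftrightarrow> s + 2 ^ k * (x + y) \<ge> 2 * 2 ^ k"
    using s by (intro ge) (auto simp: x_def y_def)
  also have "\<dots> \<longleftrightarrow> (bit a k \<and> bit b k) \<or> (s \<ge> 2 ^ k \<and> (bit a k \<noteq> bit b k))"
    using s by (auto simp: x_def y_def)
  finally show "c (Suc k) \<longleftrightarrow> (bit a k \<and> bit b k) \<or> (c k \<and> (bit a k \<noteq> bit b k))" by (simp add: c)
  have T: "take_bit (Suc k) (a + b) = take_bit (Suc k) (s + 2 ^ k * (x + y))"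
    by (simp only: S[symmetric] take_bit_add)
  have "bit t k \<longleftrightarrow> bit (take_bit (Suc k) t) k" for t :: int by (simp only: bit_take_bit_iff) simp
  hence "bit (a + b) k \<longleftrightarrow> bit (s + 2 ^ k * (x + y)) k" using T by metis
  also have "\<dots> \<longleftrightarrow> odd (s div 2 ^ k + (x + y))"
  proof -
    have "(s + 2 ^ k * (x + y)) div 2 ^ k = s div 2 ^ k + (x + y)" by simp
    thus ?thesis by (simp only: bit_iff_odd)
  qed
  also have "\<dots> \<longleftrightarrow> (bit a k \<noteq> bit b k) \<noteq> c k"
    by (auto simp: c_def s_def[symmetric] bit_iff_odd[of s] x_def y_def)
  finally show "bit (a + b) k \<longleftrightarrow> (bit a k \<noteq> bit b k) \<noteq> c k" .
qed

lemma reaches_add: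
  fixes X Y :: "'u \<Rightarrow> int"
  assumes "\<And>i. i < k \<Longrightarrow> (\<lambda>u. bit (X u) i) \<in> G" "\<And>i. i < k \<Longrightarrow> (\<lambda>u. bit (Y u) i) \<in> G"
    and "(\<lambda>u. False) \<in> G"
  shows "reaches G (9 * k) ((\<lambda>i u. bit (X u + Y u) i) ` {..<k})"
proof -
  define c where "c k u = bit (take_bit k (X u) + take_bit k (Y u)) k" for k u
  \<comment> \<open>The carry belongs to the induction invariant, since the next full adder consumes
    it; it is dropped at the end.\<close>
  have "reaches G (9 * k) (insert (c k) ((\<lambda>i u. bit (X u + Y u) i) ` {..<k}))"
    using assms(1,2)
  proof (induction k)
    case 0
    have "c 0 = (\<lambda>u. False)" by (simp add: c_def fun_eq_iff)
    thus ?case using assms(3) by (intro reaches_refl) simp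
  next
    case (Suc k)
    let ?T = "insert (c k) ((\<lambda>i u. bit (X u + Y u) i) ` {..<k})"
    have IH: "reaches G (9 * k) ?T" using Suc by simp
    have "(\<lambda>u. bit (X u + Y u) k) = (\<lambda>u. (bit (X u) k \<noteq> bit (Y u) k) \<noteq> c k u)"
      "c (Suc k) = (\<lambda>u. (bit (X u) k \<and> bit (Y u) k) \<or> (c k u \<and> (bit (X u) k \<noteq> bit (Y u) k)))"
      unfolding c_def by (rule ext, rule bit_add_carry)+
    hence "reaches (G \<union> ?T) 9 {\<lambda>u. bit (X u + Y u) k, c (Suc k)}"
      using reaches_full_adder[of "\<lambda>u. bit (X u) k" "G \<union> ?T" "\<lambda>u. bit (Y u) k" "c k"] Suc(2)[of k] Suc(3)[of k]
      by simp
    from reaches_trans[OF IH this] show ?case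
      by (rule reaches_mono) (auto simp add: lessThan_Suc)
  qed
  thus ?thesis by (rule reaches_mono) auto
qed

lemma bit_eq_False: "0 \<le> x \<Longrightarrow> x < 2 ^ k \<Longrightarrow> \<not> bit (x :: int) k"
  by (simp add: bit_iff_odd)

text \<open>The modulus is subtracted by adding \<open>- q\<close> in two's complement; bit \<open>z\<close> of the result is its
  sign and selects between the two candidates.\<close>

lemma reaches_mod_add:
  fixes X Y :: "'u \<Rightarrow> int"
  assumes X: "\<And>i. i < z \<Longrightarrow> (\<lambda>u. bit (X u) i) \<in> G" "\<And>u. 0 \<le> X u \<and> X u < q"
    and Y: "\<And>i. i < z \<Longrightarrow> (\<lambda>u. bit (Y u) i) \<in> G" "\<And>u. 0 \<le> Y u \<and> Y u < q"
    and const: "(\<lambda>u. True) \<in> G" "(\<lambda>u. False) \<in> G"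
    and q: "q \<le> 2 ^ z"
  shows "reaches G (22 * Suc z) ((\<lambda>i u. bit ((X u + Y u) mod q) i) ` {..<z})"
proof -
  \<comment> \<open>The sum of two residues may need one bit more than z, so both operands are
    padded with a zero at position z.\<close>
  have ext: "(\<lambda>u. bit (V u) i) \<in> G" if "\<And>i. i < z \<Longrightarrow> (\<lambda>u. bit (V u) i) \<in> G" "\<And>u. 0 \<le> V u \<and> V u < q" "i < Suc z"
    for V :: "'u \<Rightarrow> int" and i
  proof (cases "i = z")
    case True
    have "(\<lambda>u. bit (V u) z) = (\<lambda>u. False)"
      using that(2) q by (intro ext) (meson bit_eq_False order_less_le_trans)
    thus ?thesis using True const by simp
  qed (use that in auto)
  define S where "S u = X u + Y u" for u
  define T where "T u = S u + (- q)" for u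
  let ?S = "(\<lambda>i u. bit (S u) i) ` {..<Suc z}"
  let ?T = "(\<lambda>i u. bit (T u) i) ` {..<Suc z}"
  let ?R = "(\<lambda>i u. bit ((X u + Y u) mod q) i) ` {..<z}"
  have 1: "reaches G (9 * Suc z) ?S" unfolding S_def by (rule reaches_add) (use ext X Y const in auto)
  have 2: "reaches (G \<union> ?S) (9 * Suc z) ?T"
    unfolding T_def
  proof (rule reaches_add)
    show "(\<lambda>u. bit (- q) i) \<in> G \<union> ?S" for i using const by (cases "bit (- q) i") auto
  qed (use const in auto)
  \<comment> \<open>\<open>T u\<close> lies between - 2^z and 2^z - 1, where bit z of the two's
    complement is the sign. In the negative case adding 2^(z+1) gives the residue that exposes this
    bit.\<close>
  have sgn: "bit (T u) z \<longleftrightarrow> S u < q" for u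
  proof (cases "S u < q")
    case True
    have r: "T u mod 2 ^ Suc z = T u + 2 ^ Suc z"
      using True X(2)[of u] Y(2)[of u] q
      by (intro mod_pos_pos_trivial[of "T u + 2 ^ Suc z" "2 ^ Suc z", simplified mod_add_self2])
         (auto simp: T_def S_def)
    have "bit (T u) z = bit (T u mod 2 ^ Suc z) z" by (simp only: take_bit_eq_mod[symmetric] bit_take_bit_iff) simp
    also have "\<dots> = odd ((T u + 2 ^ Suc z) div 2 ^ z)" unfolding r by (simp add: bit_iff_odd)
    also have "(T u + 2 ^ Suc z) div 2 ^ z = 1"
      using True X(2)[of u] Y(2)[of u] q
      by (intro int_div_pos_eq[where r = "T u + 2 ^ z"]) (auto simp: T_def S_def)
    finally show ?thesis using True by simp
  next
    case False
    thus ?thesis using X(2)[of u] Y(2)[of u] q bit_eq_False[of "T u" z] by (auto simp: T_def S_def)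
  qed
  have val: "(X u + Y u) mod q = (if bit (T u) z then S u else T u)" for u
  proof (cases "S u < q")
    case True
    thus ?thesis using sgn[of u] X(2)[of u] Y(2)[of u] by (simp add: S_def)
  next
    case False
    have "(X u + Y u) mod q = (S u - q) mod q" by (simp add: S_def)
    also have "\<dots> = S u - q" using False X(2)[of u] Y(2)[of u] by (intro mod_pos_pos_trivial) (auto simp: S_def)
    finally show ?thesis using False sgn[of u] by (simp add: T_def)
  qed
  let ?G = "G \<union> (?S \<union> ?T)"
  have 3: "reaches ?G (z * 4) (\<Union>i<z. {\<lambda>u. bit ((X u + Y u) mod q) i})"
  proof (rule reaches_UN)
    fix i assume "i < z"
    have "reaches ?G 4 {\<lambda>u. if bit (T u) z then bit (S u) i else bit (T u) i}"
      using \<open>i < z\<close> by (intro reaches_mux) auto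
    also have "(\<lambda>u. if bit (T u) z then bit (S u) i else bit (T u) i) = (\<lambda>u. bit ((X u + Y u) mod q) i)"
      by (simp add: val fun_eq_iff)
    finally show "reaches ?G 4 {\<lambda>u. bit ((X u + Y u) mod q) i}" .
  qed
  \<comment> \<open>Two additions of z + 1 bits and z selections cost 18 (z + 1) + 4 z, which is
    rounded up to 22 (z + 1).\<close>
  have "reaches G ((9 * Suc z + 9 * Suc z) + z * 4) ((?S \<union> ?T) \<union> (\<Union>i<z. {\<lambda>u. bit ((X u + Y u) mod q) i}))"
    by (rule reaches_trans[OF reaches_trans[OF 1 2] 3])
  thus ?thesis by (rule reaches_mono) auto
qed

text \<open>The coefficients are constants of the program, so no multiplication occurs: a term is
  added or skipped. The accumulator starts with the constant bits of y mod q and is reduced after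
  each addition, which keeps it within z bits.\<close>

lemma reaches_mod_subset_sum:
  fixes X :: "nat \<Rightarrow> 'u \<Rightarrow> int"
  assumes X: "\<And>i j. i < m \<Longrightarrow> j < z \<Longrightarrow> (\<lambda>u. bit (X i u) j) \<in> G" "\<And>i u. i < m \<Longrightarrow> 0 \<le> X i u \<and> X i u < q"
    and c: "\<And>i. i < m \<Longrightarrow> c i \<in> {0, 1}"
    and const: "(\<lambda>u. True) \<in> G" "(\<lambda>u. False) \<in> G"
    and q: "0 < q" "q \<le> 2 ^ z"
  shows "reaches G (m * (22 * Suc z)) ((\<lambda>j u. bit (((\<Sum>i<m. c i * X i u) + y) mod q) j) ` {..<z})"
  using X c
proof (induction m)
  case 0
  have "(\<lambda>u. bit (y mod q) j) \<in> G" for j using const by (cases "bit (y mod q) j") auto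
  thus ?case by (intro reaches_refl) auto
next
  case (Suc m)
  define P where "P u = ((\<Sum>i<m. c i * X i u) + y) mod q" for u
  let ?T = "(\<lambda>j u. bit (P u) j) ` {..<z}"
  have IH: "reaches G (m * (22 * Suc z)) ?T" unfolding P_def using Suc by simp
  have "c m = 0 \<or> c m = 1" using Suc(4)[of m] by simp
  thus ?case
  proof
    assume "c m = 0"
    hence "?T = (\<lambda>j u. bit (((\<Sum>i<Suc m. c i * X i u) + y) mod q) j) ` {..<z}" by (simp add: P_def)
    thus ?thesis using reaches_mono[OF IH, of G "Suc m * (22 * Suc z)" ?T] by simp
  next
    assume c: "c m = 1"
    have "reaches (G \<union> ?T) (22 * Suc z) ((\<lambda>j u. bit ((P u + X m u) mod q) j) ` {..<z})"
      by (rule reaches_mod_add) (use Suc(2,3) const q in \<open>auto simp: P_def\<close>)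
    moreover have "(P u + X m u) mod q = ((\<Sum>i<Suc m. c i * X i u) + y) mod q" for u
      using c by (simp add: P_def mod_simps ac_simps)
    ultimately have "reaches (G \<union> ?T) (22 * Suc z) ((\<lambda>j u. bit (((\<Sum>i<Suc m. c i * X i u) + y) mod q) j) ` {..<z})"
      by simp
    from reaches_trans[OF IH this] show ?thesis by (rule reaches_mono) auto
  qed
qed

section \<open>Reversible circuits\<close>

text \<open>The values at H and T are only defaults. The lemmas that relate this map to
  \<open>apply_gate\<close> assume a classical gate.\<close>

fun gate_perm :: "gate \<Rightarrow> bool list \<Rightarrow> bool list" where
  "gate_perm (Gate_X i) b = b[i := \<not> b ! i]"
| "gate_perm (Gate_H i) b = b"
| "gate_perm (Gate_T i) b = b"
| "gate_perm (Gate_CNOT i j) b = b[j := (b ! j \<noteq> b ! i)]"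
| "gate_perm (Gate_Toffoli i j k) b = b[k := (b ! k \<noteq> (b ! i \<and> b ! j))]"

definition classical_gate :: "gate \<Rightarrow> bool" where
  "classical_gate g \<longleftrightarrow> (\<forall>i. g \<noteq> Gate_H i \<and> g \<noteq> Gate_T i)"

definition valid_gate :: "nat \<Rightarrow> gate \<Rightarrow> bool" where
  "valid_gate w g \<longleftrightarrow> distinct (gate_wires g) \<and> set (gate_wires g) \<subseteq> {..<w}"

definition reversible :: "nat \<Rightarrow> gate list \<Rightarrow> bool" where
  "reversible w gs \<longleftrightarrow> (\<forall>g \<in> set gs. classical_gate g \<and> valid_gate w g)"

lemma reversible_append [simp]: "reversible w (gs @ hs) \<longleftrightarrow> reversible w gs \<and> reversible w hs"
  by (auto simp: reversible_def)

lemma length_gate_perm [simp]: "length (gate_perm g b) = length b"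
  by (cases g) auto

lemma length_fold_gate_perm [simp]: "length (fold gate_perm gs b) = length b"
  by (induction gs arbitrary: b) auto

text \<open>Validity keeps the target apart from the controls, so the second application sees the
  same controls and flips back.\<close>

lemma gate_perm_involution:
  assumes "valid_gate (length b) g"
  shows "gate_perm g (gate_perm g b) = b"
  using assms by (cases g) (auto simp: valid_gate_def intro!: nth_equalityI simp: nth_list_update split: if_splits)

lemma fold_gate_perm_rev:
  assumes "reversible (length b) gs"
  shows "fold gate_perm gs (fold gate_perm (rev gs) b) = b"
  using assms
proof (induction gs arbitrary: b rule: rev_induct)
  case (snoc g gs)
  thus ?case by (simp add: reversible_def gate_perm_involution)
qed simp

lemma fold_gate_perm_rev':
  assumes "reversible (length b) gs"
  shows "fold gate_perm (rev gs) (fold gate_perm gs b) = b"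
  using fold_gate_perm_rev[of b "rev gs"] assms by (simp add: reversible_def)

section \<open>Compiling NAND programs into reversible gates\<close>

text \<open>The wire of a function must not depend on the input u, as the circuit is fixed before
  the samples are known. Only its existence is recorded, so several functions may share a
  wire.\<close>

definition tracks :: "'u set \<Rightarrow> ('u \<Rightarrow> bool list) \<Rightarrow> nat set \<Rightarrow> ('u \<Rightarrow> bool) set \<Rightarrow> bool" where
  "tracks U b P H \<longleftrightarrow> (\<forall>h\<in>H. \<exists>p\<in>P. \<forall>u\<in>U. b u ! p = h u)"

definition fresh_from :: "'u set \<Rightarrow> ('u \<Rightarrow> bool list) \<Rightarrow> nat \<Rightarrow> nat \<Rightarrow> bool" where
  "fresh_from U b p0 w \<longleftrightarrow> (\<forall>u\<in>U. length (b u) = w \<and> (\<forall>p. p0 \<le> p \<longrightarrow> p < w \<longrightarrow> \<not> b u ! p))"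

text \<open>A NAND program is turned into gates by giving each step a fresh wire. The two operands may
  be the same function, in which case a Toffoli gate is not available.\<close>

lemma reversible_of_derives:
  assumes "derives G k H" "tracks U b P G" "P \<subseteq> {..<p0}" "fresh_from U b p0 w" "p0 + k \<le> w"
  shows "\<exists>gs. length gs = 2 * k \<and> reversible w gs \<and> tracks U (\<lambda>u. fold gate_perm gs (b u)) (P \<union> {p0..<p0 + k}) H \<and>
    fresh_from U (\<lambda>u. fold gate_perm gs (b u)) (p0 + k) w \<and> (\<forall>u\<in>U. \<forall>p<p0. fold gate_perm gs (b u) ! p = b u ! p)"
  using assms(1,5)
proof (induction rule: derives.induct)
  case derives_refl
  show ?case by (rule exI[of _ "[]"]) (use assms in \<open>simp add: reversible_def\<close>)
next
  case (derives_step k H f g)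
  let ?p = "p0 + k"
  obtain gs where gs: "length gs = 2 * k" "reversible w gs"
    and H: "tracks U (\<lambda>u. fold gate_perm gs (b u)) (P \<union> {p0..<?p}) H"
    and fresh: "fresh_from U (\<lambda>u. fold gate_perm gs (b u)) ?p w"
    and old: "\<forall>u\<in>U. \<forall>p<p0. fold gate_perm gs (b u) ! p = b u ! p"
  proof -
    have "p0 + k \<le> w" using derives_step.prems by simp
    from derives_step.IH[OF this] show ?thesis by (elim exE conjE) (rule that)
  qed
  have loc: "\<exists>p\<in>P \<union> {p0..<?p}. \<forall>u\<in>U. fold gate_perm gs (b u) ! p = h u" if "h \<in> H" for h
    using H[unfolded tracks_def] that by (rule bspec)
  have sub: "P \<union> {p0..<?p} \<subseteq> {..<?p}" using assms(3) by auto
  obtain pf where pf: "pf \<in> {..<?p}" "\<forall>u\<in>U. fold gate_perm gs (b u) ! pf = f u"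
    using loc[OF derives_step.hyps(2)] sub by auto
  obtain pg where pg: "pg \<in> {..<?p}" "\<forall>u\<in>U. fold gate_perm gs (b u) ! pg = g u"
    using loc[OF derives_step.hyps(3)] sub by auto
  have w: "?p < w" using derives_step.prems by simp
  define a where "a = (if pf = pg then Gate_CNOT pf ?p else Gate_Toffoli pf pg ?p)"
  \<comment> \<open>Two gates per NAND step: the first writes the conjunction onto the fresh zero
    wire, the second negates it.\<close>
  define gs' where "gs' = gs @ [a, Gate_X ?p]"
  have new: "fold gate_perm gs' (b u) = (fold gate_perm gs (b u))[?p := \<not> (f u \<and> g u)]"
    and len: "length (b u) = w" if "u \<in> U" for u
  proof -
    show "length (b u) = w" using fresh that by (simp add: fresh_from_def)
    moreover have "\<not> fold gate_perm gs (b u) ! ?p" using fresh that w by (simp add: fresh_from_def)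
    ultimately show "fold gate_perm gs' (b u) = (fold gate_perm gs (b u))[?p := \<not> (f u \<and> g u)]"
      using bspec[OF pf(2) that] bspec[OF pg(2) that] w by (auto simp: a_def gs'_def)
  qed
  have nth: "fold gate_perm gs' (b u) ! p = (if p = ?p then \<not> (f u \<and> g u) else fold gate_perm gs (b u) ! p)"
    if "u \<in> U" for u p
    unfolding new[OF that] using w len[OF that] by (simp add: nth_list_update)
  have "\<exists>p\<in>P \<union> {p0..<p0 + Suc k}. \<forall>u\<in>U. fold gate_perm gs' (b u) ! p = h u" if h: "h \<in> insert (\<lambda>u. \<not> (f u \<and> g u)) H" for h
    using h
  proof
    assume "h = (\<lambda>u. \<not> (f u \<and> g u))"
    thus ?thesis using nth by (intro bexI[of _ ?p]) simp_all
  next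
    assume "h \<in> H"
    from loc[OF this] obtain p where p: "p \<in> P \<union> {p0..<?p}" "\<forall>u\<in>U. fold gate_perm gs (b u) ! p = h u" by (rule bexE)
    have "p \<noteq> ?p" using p(1) sub by auto
    hence "\<forall>u\<in>U. fold gate_perm gs' (b u) ! p = h u" using p(2) nth by simp
    moreover have "p \<in> P \<union> {p0..<p0 + Suc k}" using p(1) by auto
    ultimately show ?thesis by (rule bexI)
  qed
  hence "tracks U (\<lambda>u. fold gate_perm gs' (b u)) (P \<union> {p0..<p0 + Suc k}) (insert (\<lambda>u. \<not> (f u \<and> g u)) H)"
    unfolding tracks_def by (rule ballI)
  moreover have "fresh_from U (\<lambda>u. fold gate_perm gs' (b u)) (p0 + Suc k) w"
    using fresh by (simp add: fresh_from_def nth len)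
  moreover have "\<forall>u\<in>U. \<forall>p<p0. fold gate_perm gs' (b u) ! p = b u ! p"
    using old by (simp add: nth)
  moreover have "length gs' = 2 * Suc k" "reversible w gs'"
    using gs w pf(1) pg(1) by (auto simp: gs'_def reversible_def a_def classical_gate_def valid_gate_def)
  ultimately show ?case by blast
qed

lemma reversible_of_reaches:
  assumes "reaches G k T" "tracks U b P G" "P \<subseteq> {..<p0}" "fresh_from U b p0 w" "p0 + k \<le> w"
  obtains gs where "length gs \<le> 2 * k" "reversible w gs"
    "tracks U (\<lambda>u. fold gate_perm gs (b u)) (P \<union> {p0..<p0 + k}) T"
    "fresh_from U (\<lambda>u. fold gate_perm gs (b u)) (p0 + k) w"
    "\<And>u p. u \<in> U \<Longrightarrow> p < p0 \<Longrightarrow> fold gate_perm gs (b u) ! p = b u ! p"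
proof -
  obtain j H where j: "j \<le> k" "derives G j H" "T \<subseteq> H" using assms(1) by (auto simp: reaches_def)
  have "p0 + j \<le> w" using j(1) assms(5) by simp
  from reversible_of_derives[OF j(2) assms(2-4) this]
  obtain gs where gs: "length gs = 2 * j" "reversible w gs" "tracks U (\<lambda>u. fold gate_perm gs (b u)) (P \<union> {p0..<p0 + j}) H"
    "fresh_from U (\<lambda>u. fold gate_perm gs (b u)) (p0 + j) w"
    "\<forall>u\<in>U. \<forall>p<p0. fold gate_perm gs (b u) ! p = b u ! p"
    by auto
  show ?thesis
  proof (rule that[of gs])
    show "tracks U (\<lambda>u. fold gate_perm gs (b u)) (P \<union> {p0..<p0 + k}) T"
      unfolding tracks_def
    proof
      fix h assume "h \<in> T"
      hence "h \<in> H" by (rule subsetD[OF j(3)])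
      from bspec[OF gs(3)[unfolded tracks_def] this]
      obtain p where p: "p \<in> P \<union> {p0..<p0 + j}" "\<forall>u\<in>U. fold gate_perm gs (b u) ! p = h u" by (rule bexE)
      have "p \<in> P \<union> {p0..<p0 + k}" using p(1) j(1) by auto
      with p(2) show "\<exists>p\<in>P \<union> {p0..<p0 + k}. \<forall>u\<in>U. fold gate_perm gs (b u) ! p = h u" by (rule bexI)
    qed
    show "fresh_from U (\<lambda>u. fold gate_perm gs (b u)) (p0 + k) w" using gs(4) j(1) by (simp add: fresh_from_def)
    show "length gs \<le> 2 * k" using gs(1) j(1) by simp
    show "reversible w gs" by (rule gs(2))
    show "fold gate_perm gs (b u) ! p = b u ! p" if "u \<in> U" "p < p0" for u p
      by (rule gs(5)[rule_format, OF that])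
  qed
qed

text \<open>No source is a target and no target occurs twice, so the gates do not influence each
  other. Sources may repeat.\<close>

lemma fold_CNOT:
  fixes ps :: "(nat \<times> nat) list"
  defines "gs \<equiv> map (\<lambda>(p, d). Gate_CNOT p d) ps"
  assumes "distinct (map snd ps)" "set (map fst ps) \<inter> set (map snd ps) = {}"
    "set (map snd ps) \<subseteq> {..<length b}"
  shows "(\<forall>(p, d) \<in> set ps. fold gate_perm gs b ! d = (b ! d \<noteq> b ! p)) \<and>
     (\<forall>d. d \<notin> set (map snd ps) \<longrightarrow> fold gate_perm gs b ! d = b ! d)"
  using assms(2-) unfolding gs_def
proof (induction ps arbitrary: b)
  case (Cons x ps)
  obtain p d where x: "x = (p, d)" by force
  let ?b = "b[d := (b ! d \<noteq> b ! p)]"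
  let ?f = "fold gate_perm (map (\<lambda>(p, d). Gate_CNOT p d) ps) ?b"
  have IH: "\<forall>(p, d) \<in> set ps. ?f ! d = (?b ! d \<noteq> ?b ! p)" "\<forall>d. d \<notin> set (map snd ps) \<longrightarrow> ?f ! d = ?b ! d"
    using Cons.IH[of ?b] Cons(2-) by (simp_all add: x)
  have b: "?b ! d' = b ! d'" if "d' \<noteq> d" for d' using that by (simp add: nth_list_update)
  have bd: "?b ! d = (b ! d \<noteq> b ! p)" using Cons(4) by (simp add: x)
  have ne: "p' \<noteq> d \<and> d' \<noteq> d" if "(p', d') \<in> set ps" for p' d'
  proof -
    have "p' \<in> fst ` set ps" "d' \<in> snd ` set ps" using imageI[OF that, of fst] imageI[OF that, of snd] by simp_all
    thus ?thesis using Cons(2,3) by (auto simp: x)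
  qed
  have "d \<notin> set (map snd ps)" using Cons(2) by (simp add: x)
  hence 1: "?f ! d = (b ! d \<noteq> b ! p)" using IH(2) bd by blast
  have 2: "?f ! d' = (b ! d' \<noteq> b ! p')" if "(p', d') \<in> set ps" for p' d'
    using bspec[OF IH(1) that] ne[OF that] b[of d'] b[of p'] by simp
  have 3: "?f ! d' = b ! d'" if "d' \<notin> set (map snd (x # ps))" for d'
    using IH(2) that b[of d'] by (simp add: x)
  have 4: "fold gate_perm (map (\<lambda>(p, d). Gate_CNOT p d) (x # ps)) b = ?f" by (simp add: x)
  show ?case
    unfolding 4
  proof (intro conjI ballI allI impI)
    fix y assume "y \<in> set (x # ps)"
    moreover obtain p' d' where y: "y = (p', d')" by force
    ultimately consider "p' = p" "d' = d" | "(p', d') \<in> set ps" by (auto simp: x)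
    hence "?f ! d' = (b ! d' \<noteq> b ! p')" using 1 2 by cases blast+
    thus "case y of (p', d') \<Rightarrow> ?f ! d' = (b ! d' \<noteq> b ! p')" by (simp add: y)
  qed (rule 3)
qed simp

lemma reversible_CNOT:
  assumes "set (map fst ps) \<inter> set (map snd ps) = {}" "set (map fst ps) \<union> set (map snd ps) \<subseteq> {..<w}"
  shows "reversible w (map (\<lambda>(p, d). Gate_CNOT p d) ps)"
  unfolding reversible_def
proof
  fix g assume "g \<in> set (map (\<lambda>(p, d). Gate_CNOT p d) ps)"
  then obtain p d where g: "g = Gate_CNOT p d" and "(p, d) \<in> set ps" by auto
  hence pd: "p \<in> set (map fst ps)" "d \<in> set (map snd ps)" by force+
  hence "p \<noteq> d" using assms(1) by (metis disjoint_iff)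
  moreover have "p < w" "d < w" using assms(2) pd by auto
  ultimately show "classical_gate g \<and> valid_gate w g" by (simp add: g classical_gate_def valid_gate_def)
qed

section \<open>Action on quantum states\<close>

lemma apply_gate_classical: "classical_gate g \<Longrightarrow> apply_gate g \<psi> = (\<lambda>b. \<psi> (gate_perm g b))"
  by (cases g) (auto simp: classical_gate_def)

text \<open>Gates act on amplitudes by pullback, and pullbacks compose in the opposite order; hence
  the reversal.\<close>

lemma fold_apply_gate_classical:
  assumes "reversible w gs"
  shows "fold apply_gate gs \<psi> = (\<lambda>b. \<psi> (fold gate_perm (rev gs) b))"
  using assms
  by (induction gs arbitrary: \<psi>) (auto simp: reversible_def apply_gate_classical)

definition basis :: "bool list \<Rightarrow> qstate" where
  "basis c = (\<lambda>b. if b = c then 1 else 0)"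

text \<open>Each gate is its own inverse, so the reversed list undoes the original one, and the
  pullback of a basis state along the inverse is the basis state at the image.\<close>

lemma fold_apply_gate_basis:
  assumes "reversible (length c) gs"
  shows "fold apply_gate gs (basis c) = basis (fold gate_perm gs c)"
proof -
  have "fold gate_perm (rev gs) b = c \<longleftrightarrow> b = fold gate_perm gs c" for b
  proof (cases "length b = length c")
    case True
    thus ?thesis using fold_gate_perm_rev[of b gs] fold_gate_perm_rev'[of c gs] assms by auto
  next
    case False
    thus ?thesis by (metis length_fold_gate_perm)
  qed
  thus ?thesis by (simp add: fold_apply_gate_classical[OF assms] basis_def)
qed

section \<open>Oracle queries on basis states\<close>

lemma xor_bits_Nil [simp]: "xor_bits [] d b = b"
  by (simp add: xor_bits_def)

lemma xor_bits_Cons [simp]: "xor_bits (i # ws) (x # d) b = xor_bits ws d (b[i := (b ! i \<noteq> x)])"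
  by (simp add: xor_bits_def)

lemma length_xor_bits [simp]: "length (xor_bits ws d b) = length b"
proof -
  have "length (fold (\<lambda>(i, x) c. c[i := (c ! i \<noteq> x)]) ps b) = length b" for ps :: "(nat \<times> bool) list"
    by (induction ps arbitrary: b) auto
  thus ?thesis by (simp add: xor_bits_def)
qed

lemma nth_xor_bits:
  assumes "length ws = length d" "distinct ws" "set ws \<subseteq> {..<length b}"
  shows "(\<forall>i<length ws. xor_bits ws d b ! (ws ! i) = (b ! (ws ! i) \<noteq> d ! i)) \<and>
    (\<forall>p. p \<notin> set ws \<longrightarrow> xor_bits ws d b ! p = b ! p)"
  using assms
proof (induction ws d arbitrary: b rule: list_induct2)
  case (Cons i ws x d)
  let ?b = "b[i := (b ! i \<noteq> x)]"
  have IH: "\<forall>i<length ws. xor_bits ws d ?b ! (ws ! i) = (?b ! (ws ! i) \<noteq> d ! i)"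
    "\<forall>p. p \<notin> set ws \<longrightarrow> xor_bits ws d ?b ! p = ?b ! p"
    using Cons.IH[of ?b] Cons.prems by auto
  have "xor_bits (i # ws) (x # d) b ! ((i # ws) ! j) = (b ! ((i # ws) ! j) \<noteq> (x # d) ! j)"
    if "j < length (i # ws)" for j
  proof (cases j)
    case 0
    thus ?thesis using IH(2) Cons.prems by simp
  next
    case (Suc j')
    hence "ws ! j' \<noteq> i" using that Cons.prems by auto
    thus ?thesis using IH(1) Suc that by simp
  qed
  thus ?case using IH(2) by auto
qed simp

lemma xor_bits_involution:
  assumes "length ws = length d" "distinct ws" "set ws \<subseteq> {..<length b}"
  shows "xor_bits ws d (xor_bits ws d b) = b"
proof (rule nth_equalityI)
  fix p assume "p < length (xor_bits ws d (xor_bits ws d b))"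
  have "set ws \<subseteq> {..<length (xor_bits ws d b)}" using assms by simp
  note n = nth_xor_bits[OF assms] nth_xor_bits[OF assms(1,2) this]
  show "xor_bits ws d (xor_bits ws d b) ! p = b ! p"
  proof (cases "p \<in> set ws")
    case True
    then obtain i where "i < length ws" "p = ws ! i" by (auto simp: in_set_conv_nth)
    thus ?thesis using n by auto
  next
    case False
    thus ?thesis using n by simp
  qed
qed simp

lemma run_gates: "run (map Gate gs @ is) ds \<psi> = run is ds (fold apply_gate gs \<psi>)"
  by (induction gs arbitrary: \<psi>) auto

text \<open>With its answer given, a query maps basis states to basis states. A block of queries on
  disjoint wires is therefore a single XOR with the concatenated answers, and it uses up all of
  them, which leaves \<open>[]\<close> for the rest of the circuit.\<close>

lemma run_queries:
  assumes "length wss = length ds" "\<And>i. i < length wss \<Longrightarrow> length (wss ! i) = length (ds ! i)"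
    "distinct (concat wss)" "set (concat wss) \<subseteq> {..<length c}"
  shows "run (map Query wss @ is) ds (basis c) = run is [] (basis (xor_bits (concat wss) (concat ds) c))"
  using assms
proof (induction wss ds arbitrary: c rule: list_induct2)
  case (Cons ws wss d ds)
  have l: "length ws = length d" using Cons.prems(1)[of 0] by simp
  have "xor_bits ws d b = c \<longleftrightarrow> b = xor_bits ws d c" for b
  proof (cases "length b = length c")
    case True
    thus ?thesis using xor_bits_involution[of ws d b] xor_bits_involution[of ws d c] l Cons.prems by auto
  next
    case False
    thus ?thesis by (metis length_xor_bits)
  qed
  hence "(\<lambda>b. basis c (xor_bits ws d b)) = basis (xor_bits ws d c)" by (simp add: basis_def)
  moreover have "xor_bits (ws @ vs) (d @ e) c = xor_bits vs e (xor_bits ws d c)" for vs e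
    using l by (simp add: xor_bits_def)
  moreover have "run (map Query wss @ is) ds (basis (xor_bits ws d c)) =
      run is [] (basis (xor_bits (concat wss) (concat ds) (xor_bits ws d c)))"
    using Cons.prems(1)[of "Suc _"] Cons.prems(2,3) by (intro Cons.IH) auto
  ultimately show ?case by simp
qed simp

text \<open>The state \<open>\<psi>\<close> of the first \<open>W\<close> qubits together with the remaining qubits in the classical
  state \<open>r\<close>.\<close>

definition attach :: "nat \<Rightarrow> bool list \<Rightarrow> qstate \<Rightarrow> qstate" where
  "attach W r \<psi> = (\<lambda>b. if drop W b = r then \<psi> (take W b) else 0)"

lemma basis_append: "length c = W \<Longrightarrow> basis (c @ r) = attach W r (basis c)"
  unfolding basis_def attach_def fun_eq_iff by (metis append_eq_conv_conj append_take_drop_id)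

lemma apply_gate_attach:
  assumes "valid_gate W g" "r \<noteq> []"
  shows "apply_gate g (attach W r \<psi>) = attach W r (apply_gate g \<psi>)"
proof
  fix b
  have len: "W < length b" if "drop W b = r" using that assms(2) by auto
  have 1: "drop W (b[i := v]) = drop W b" if "i < W" for i v using that by simp
  have 2: "take W (b[i := v]) = (take W b)[i := v]" for i v by (rule take_update_swap)
  have 3: "take W b ! i = b ! i" if "i < W" for i using that by simp
  show "apply_gate g (attach W r \<psi>) b = attach W r (apply_gate g \<psi>) b"
    using assms(1) by (cases g) (auto simp: valid_gate_def attach_def 1 2 3)
qed

lemma fold_apply_gate_attach:
  assumes "\<And>g. g \<in> set gs \<Longrightarrow> valid_gate W g" "r \<noteq> []"
  shows "fold apply_gate gs (attach W r \<psi>) = attach W r (fold apply_gate gs \<psi>)"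
  using assms by (induction gs arbitrary: \<psi>) (auto simp: apply_gate_attach)

section \<open>Preservation of the norm, and measuring a computed flag\<close>

definition norm_sq :: "nat \<Rightarrow> qstate \<Rightarrow> real" where
  "norm_sq w \<psi> = (\<Sum>b | length b = w. (cmod (\<psi> b))\<^sup>2)"

lemma finite_bits [simp]: "finite {b :: bool list. length b = w}"
  using finite_lists_length_eq[of "UNIV :: bool set" w] by simp

lemma finite_bits_conj [simp]: "finite {b :: bool list. length b = w \<and> P b}"
  by (rule finite_subset[OF _ finite_bits[of w]]) auto

text \<open>The strings are grouped into pairs that differ in bit i only. These are the pairs that a
  Hadamard gate on wire i mixes.\<close>

lemma sum_bits_split:
  assumes "i < w"
  shows "(\<Sum>b | length b = w. F b) = (\<Sum>b | length b = w \<and> \<not> b ! i. F b + F (b[i := True]) :: real)"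
proof -
  have upd: "b[i := v] = b" if "b ! i = v" for b :: "bool list" and v using list_update_id[of b i] that by simp
  have "{b. length b = w} = {b. length b = w \<and> \<not> b ! i} \<union> {b. length b = w \<and> b ! i}" by auto
  hence "(\<Sum>b | length b = w. F b) = (\<Sum>b | length b = w \<and> \<not> b ! i. F b) + (\<Sum>b | length b = w \<and> b ! i. F b)"
    by (simp only:) (subst sum.union_disjoint; auto)
  also have "(\<Sum>b | length b = w \<and> b ! i. F b) = (\<Sum>b | length b = w \<and> \<not> b ! i. F (b[i := True]))"
    by (rule sum.reindex_bij_witness[of _ "\<lambda>b. b[i := True]" "\<lambda>b. b[i := False]"])
       (use assms in \<open>auto simp: upd\<close>)
  finally show ?thesis by (simp add: sum.distrib)
qed

lemma norm_sq_apply_gate: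
  assumes "valid_gate w g"
  shows "norm_sq w (apply_gate g \<psi>) = norm_sq w \<psi>"
proof (cases "classical_gate g")
  case True
  have "(\<Sum>b | length b = w. (cmod (\<psi> (gate_perm g b)))\<^sup>2) = (\<Sum>b | length b = w. (cmod (\<psi> b))\<^sup>2)"
    by (rule sum.reindex_bij_witness[of _ "gate_perm g" "gate_perm g"])
       (use assms gate_perm_involution in auto)
  thus ?thesis using True by (simp add: norm_sq_def apply_gate_classical)
next
  case False
  then consider i where "g = Gate_H i" | i where "g = Gate_T i" by (auto simp: classical_gate_def)
  thus ?thesis
  proof cases
    case (1 i)
    hence i: "i < w" using assms by (simp add: valid_gate_def)
    \<comment> \<open>The parallelogram law, which is unitarity of the Hadamard matrix on one pair
      of amplitudes.\<close>
    have par: "(cmod ((x + y) / complex_of_real (sqrt 2)))\<^sup>2 + (cmod ((x - y) / complex_of_real (sqrt 2)))\<^sup>2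
        = (cmod x)\<^sup>2 + (cmod y)\<^sup>2" for x y
    proof -
      have "(cmod (x + y))\<^sup>2 + (cmod (x - y))\<^sup>2 = 2 * ((cmod x)\<^sup>2 + (cmod y)\<^sup>2)"
        unfolding cmod_power2 by (simp add: power2_eq_square algebra_simps)
      thus ?thesis by (simp add: norm_divide power_divide field_simps)
    qed
    have upd: "b[i := False] = b" if "\<not> b ! i" for b :: "bool list" using list_update_id[of b i] that by simp
    show ?thesis unfolding norm_sq_def sum_bits_split[OF i]
      by (rule sum.cong) (use 1 i par upd in auto)
  next
    case (2 i)
    show ?thesis unfolding norm_sq_def by (rule sum.cong) (auto simp: 2 norm_mult)
  qed
qed

lemma norm_sq_fold_apply_gate:
  assumes "\<And>g. g \<in> set gs \<Longrightarrow> valid_gate w g"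
  shows "norm_sq w (fold apply_gate gs \<psi>) = norm_sq w \<psi>"
  using assms by (induction gs arbitrary: \<psi>) (auto simp: norm_sq_apply_gate)

lemma norm_sq_basis: "length c = w \<Longrightarrow> norm_sq w (basis c) = 1"
  by (simp add: norm_sq_def basis_def if_distrib[of cmod] if_distrib[of "\<lambda>x. x\<^sup>2"] sum.delta cong: if_cong)

text \<open>Reversible gates only permute the basis strings and with them the weights, so reading
  wire p afterwards has the distribution of evaluating h on a measured string beforehand, even for a
  superposition. Only strings that end in r carry weight.\<close>

lemma measure_flag:
  assumes gs: "reversible (W + length r) gs"
    and flag: "\<And>c. length c = W \<Longrightarrow> fold gate_perm gs (c @ r) ! p = h c"
  shows "(\<Sum>b | length b = W + length r \<and> b ! p = \<beta>. (cmod (fold apply_gate gs (attach W r \<psi>) b))\<^sup>2) =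
    (\<Sum>c | length c = W \<and> h c = \<beta>. (cmod (\<psi> c))\<^sup>2)"
proof -
  let ?w = "W + length r"
  let ?F = "\<lambda>b. (cmod (attach W r \<psi> b))\<^sup>2"
  have "(\<Sum>b | length b = ?w \<and> b ! p = \<beta>. (cmod (fold apply_gate gs (attach W r \<psi>) b))\<^sup>2) =
    (\<Sum>b | length b = ?w \<and> b ! p = \<beta>. ?F (fold gate_perm (rev gs) b))"
    by (simp add: fold_apply_gate_classical[OF gs])
  also have "\<dots> = (\<Sum>b | length b = ?w \<and> fold gate_perm gs b ! p = \<beta>. ?F b)"
    by (rule sum.reindex_bij_witness[of _ "fold gate_perm gs" "fold gate_perm (rev gs)"])
       (use gs fold_gate_perm_rev fold_gate_perm_rev' in auto)
  also have "\<dots> = (\<Sum>b \<in> (\<lambda>c. c @ r) ` {c. length c = W \<and> h c = \<beta>}. ?F b)"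
  proof (rule sum.mono_neutral_right)
    show "(\<lambda>c. c @ r) ` {c. length c = W \<and> h c = \<beta>} \<subseteq> {b. length b = ?w \<and> fold gate_perm gs b ! p = \<beta>}"
      using flag by auto
    show "\<forall>b \<in> {b. length b = ?w \<and> fold gate_perm gs b ! p = \<beta>} - (\<lambda>c. c @ r) ` {c. length c = W \<and> h c = \<beta>}. ?F b = 0"
    proof
      fix b assume b: "b \<in> {b. length b = ?w \<and> fold gate_perm gs b ! p = \<beta>} - (\<lambda>c. c @ r) ` {c. length c = W \<and> h c = \<beta>}"
      have "drop W b \<noteq> r"
      proof
        assume "drop W b = r"
        hence 1: "b = take W b @ r" using append_take_drop_id[of W b] by simp
        have 2: "length (take W b) = W" using b by simp
        have "h (take W b) = \<beta>" using b flag[OF 2] 1 by simp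
        thus False using b 1 2 by blast
      qed
      thus "?F b = 0" by (simp add: attach_def)
    qed
  qed simp
  also have "\<dots> = (\<Sum>c | length c = W \<and> h c = \<beta>. (cmod (\<psi> c))\<^sup>2)"
    by (subst sum.reindex) (auto simp: inj_on_def attach_def intro!: sum.cong)
  finally show ?thesis .
qed

section \<open>Uniform samples and the leftover hash lemma\<close>

lemma finite_zq [simp]: "finite (zq q)" and card_zq [simp]: "card (zq q) = q"
  by (auto simp: zq_def)

lemma zq_nonempty: "0 < q \<Longrightarrow> zq q \<noteq> {}"
  by (auto simp: zq_def)

lemma mod_in_zq: "0 < q \<Longrightarrow> a mod int q \<in> zq q"
  by (simp add: zq_def)

lemma zvec_nth: "v \<in> zvec q d \<Longrightarrow> i < d \<Longrightarrow> v $ i \<in> zq q"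
  by (simp add: zvec_def)

lemma zvec_dim: "v \<in> zvec q d \<Longrightarrow> dim_vec v = d"
  by (auto simp: zvec_def)

lemma bij_betw_zvec: "bij_betw vec_of_list {xs. set xs \<subseteq> zq q \<and> length xs = d} (zvec q d)"
proof (rule bij_betw_byWitness[where f' = list_of_vec])
  show "vec_of_list ` {xs. set xs \<subseteq> zq q \<and> length xs = d} \<subseteq> zvec q d"
  proof (rule image_subsetI)
    fix xs assume "xs \<in> {xs. set xs \<subseteq> zq q \<and> length xs = d}"
    hence xs: "set xs \<subseteq> zq q" "length xs = d" by simp_all
    have "vec_of_list xs $ i \<in> zq q" if "i < d" for i
      using subsetD[OF xs(1) nth_mem[of i xs]] that xs(2) by (simp add: vec_of_list_index)
    moreover have "vec_of_list xs \<in> carrier_vec d" using xs(2) by (intro carrier_vecI) simp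
    ultimately show "vec_of_list xs \<in> zvec q d" unfolding zvec_def by blast
  qed
  show "list_of_vec ` zvec q d \<subseteq> {xs. set xs \<subseteq> zq q \<and> length xs = d}"
  proof (rule image_subsetI)
    fix v assume v: "v \<in> zvec q d"
    have "x \<in> zq q" if "x \<in> set (list_of_vec v)" for x
    proof -
      from that[unfolded in_set_conv_nth]
      obtain i where i: "i < length (list_of_vec v)" "list_of_vec v ! i = x" by blast
      hence "i < d" "x = v $ i" using zvec_dim[OF v] by (simp_all add: list_of_vec_index)
      thus ?thesis using zvec_nth[OF v] by simp
    qed
    thus "list_of_vec v \<in> {xs. set xs \<subseteq> zq q \<and> length xs = d}" using zvec_dim[OF v] by auto
  qed
qed (simp_all add: vec_list list_vec)

lemma finite_zvec [simp]: "finite (zvec q d)"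
  using bij_betw_finite[OF bij_betw_zvec] finite_lists_length_eq[of "zq q" d] by simp

lemma card_zvec: "card (zvec q d) = q ^ d"
  using bij_betw_same_card[OF bij_betw_zvec, of q d] card_lists_length_eq[of "zq q" d] by simp

lemma zvec_nonempty: "0 < q \<Longrightarrow> zvec q d \<noteq> {}"
  using card_zvec[of q d] by force

lemma bij_betw_zmat: "bij_betw (mat_of_rows c) {rs. set rs \<subseteq> zvec q c \<and> length rs = r} (zmat q r c)"
proof (rule bij_betw_byWitness[where f' = rows])
  show "\<forall>rs \<in> {rs. set rs \<subseteq> zvec q c \<and> length rs = r}. rows (mat_of_rows c rs) = rs"
    by (intro ballI rows_mat_of_rows) (auto simp: zvec_def)
  show "\<forall>A \<in> zmat q r c. mat_of_rows c (rows A) = A"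
    by (auto simp: zmat_def)
  show "mat_of_rows c ` {rs. set rs \<subseteq> zvec q c \<and> length rs = r} \<subseteq> zmat q r c"
  proof (clarsimp simp: zmat_def mat_of_rows_index)
    fix rs i j assume "set rs \<subseteq> zvec q c" "i < length rs" "j < c"
    thus "rs ! i $ j \<in> zq q" using nth_mem[of i rs] zvec_nth[of "rs ! i" q c j] by blast
  qed
  show "rows ` zmat q r c \<subseteq> {rs. set rs \<subseteq> zvec q c \<and> length rs = r}"
    by (auto simp: zmat_def zvec_def rows_def)
qed

lemma finite_zmat [simp]: "finite (zmat q r c)"
  using bij_betw_finite[OF bij_betw_zmat] finite_lists_length_eq[of "zvec q c" r] by simp

lemma zmat_nonempty:
  assumes "0 < q"
  shows "zmat q r c \<noteq> {}"
proof -
  have "card (zmat q r c) = (q ^ c) ^ r"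
    using bij_betw_same_card[OF bij_betw_zmat[of c q r]] card_lists_length_eq[of "zvec q c" r] by (simp add: card_zvec)
  thus ?thesis using assms by force
qed

lemma finite_messages [simp]: "finite (messages n m q)"
  by (simp add: messages_def)

lemma messages_nonempty: "0 < q \<Longrightarrow> messages n m q \<noteq> {}"
  by (simp add: messages_def zvec_nonempty zmat_nonempty zq_nonempty)

section \<open>The message as a function of LWE samples, and its hash property\<close>

definition sample_lists :: "nat \<Rightarrow> nat \<Rightarrow> nat \<Rightarrow> (int vec \<times> int) list set" where
  "sample_lists n m q = {ds. set ds \<subseteq> zvec q n \<times> zq q \<and> length ds = m}"

lemma finite_sample_lists [simp]: "finite (sample_lists n m q)"
  unfolding sample_lists_def by (rule finite_lists_length_eq) simp

lemma sample_lists_nth: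
  assumes "ds \<in> sample_lists n m q" "i < m"
  shows "fst (ds ! i) \<in> zvec q n" "snd (ds ! i) \<in> zq q"
proof -
  have "set ds \<subseteq> zvec q n \<times> zq q" "i < length ds" using assms by (simp_all add: sample_lists_def)
  hence "ds ! i \<in> zvec q n \<times> zq q" using nth_mem[of i ds] by blast
  thus "fst (ds ! i) \<in> zvec q n" "snd (ds ! i) \<in> zq q" by (simp_all add: mem_Times_iff)
qed

text \<open>What the adversary hands to Guess. Here f is an argument instead of a random choice,
  because the adversary will have it built in.\<close>

definition sample_msg :: "nat \<Rightarrow> nat \<Rightarrow> int \<Rightarrow> int vec \<Rightarrow> (int vec \<times> int) list \<Rightarrow> message" where
  "sample_msg n q y f ds = (let A = mat_of_rows n (map fst ds); v = vec_of_list (map snd ds)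
     in (A, v, mod_vec q (transpose_mat A *\<^sub>v f), (scalar_prod f v + y) mod int q))"

lemma transpose_mult_index:
  fixes ds :: "(int vec \<times> int) list"
  assumes "length ds = m" "dim_vec f = m" "j < n"
  shows "(transpose_mat (mat_of_rows n (map fst ds)) *\<^sub>v f) $ j = (\<Sum>i<m. f $ i * fst (ds ! i) $ j)"
proof -
  have "(transpose_mat (mat_of_rows n (map fst ds)) *\<^sub>v f) $ j = (\<Sum>i<m. fst (ds ! i) $ j * f $ i)"
    using assms by (auto simp: mult_mat_vec_def scalar_prod_def mat_of_rows_index lessThan_atLeast0 intro!: sum.cong)
  also have "\<dots> = (\<Sum>i<m. f $ i * fst (ds ! i) $ j)" by (intro sum.cong refl mult.commute)
  finally show ?thesis .
qed

lemma scalar_prod_samples: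
  fixes ds :: "(int vec \<times> int) list"
  assumes "length ds = m"
  shows "scalar_prod f (vec_of_list (map snd ds)) = (\<Sum>i<m. f $ i * snd (ds ! i))"
  using assms by (auto simp: scalar_prod_def vec_of_list_index dim_vec_of_list lessThan_atLeast0 intro!: sum.cong)

lemma mod_mult_in_zvec:
  assumes "0 < q" "dim_row B = n"
  shows "mod_vec q (B *\<^sub>v f) \<in> zvec q n"
proof -
  have "mod_vec q (B *\<^sub>v f) \<in> carrier_vec n" using assms(2) by (intro carrier_vecI) (simp add: mod_vec_def)
  thus ?thesis using assms by (simp add: zvec_def mod_vec_def mod_in_zq)
qed

lemma bij_betw_sample_lists:
  "bij_betw (\<lambda>ds. (mat_of_rows n (map fst ds), vec_of_list (map snd ds))) (sample_lists n m q) (zmat q m n \<times> zvec q m)"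
proof -
  have 1: "bij_betw (\<lambda>ds. (map fst ds, map snd ds)) (sample_lists n m q)
    ({rs. set rs \<subseteq> zvec q n \<and> length rs = m} \<times> {xs. set xs \<subseteq> zq q \<and> length xs = m})"
  proof (rule bij_betw_byWitness[where f' = "\<lambda>(rs, xs). zip rs xs"])
    show "(\<lambda>ds. (map fst ds, map snd ds)) ` sample_lists n m q \<subseteq>
      {rs. set rs \<subseteq> zvec q n \<and> length rs = m} \<times> {xs. set xs \<subseteq> zq q \<and> length xs = m}"
      by (fastforce simp: sample_lists_def)
    show "(\<lambda>(rs, xs). zip rs xs) ` ({rs. set rs \<subseteq> zvec q n \<and> length rs = m} \<times> {xs. set xs \<subseteq> zq q \<and> length xs = m})
      \<subseteq> sample_lists n m q"
      by (auto simp: sample_lists_def dest: set_zip_leftD set_zip_rightD)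
  qed (auto simp: sample_lists_def zip_map_fst_snd)
  have "bij_betw (map_prod (mat_of_rows n) vec_of_list)
    ({rs. set rs \<subseteq> zvec q n \<and> length rs = m} \<times> {xs. set xs \<subseteq> zq q \<and> length xs = m}) (zmat q m n \<times> zvec q m)"
    by (rule bij_betw_map_prod[OF bij_betw_zmat bij_betw_zvec])
  from bij_betw_trans[OF 1 this] show ?thesis by (simp add: o_def)
qed

lemma sample_msg_in_messages:
  assumes "0 < q" "ds \<in> sample_lists n m q"
  shows "sample_msg n q y f ds \<in> messages n m q"
proof -
  have "(mat_of_rows n (map fst ds), vec_of_list (map snd ds)) \<in> zmat q m n \<times> zvec q m"
    using bij_betwE[OF bij_betw_sample_lists] assms(2) by auto
  thus ?thesis using assms(1)
    by (simp add: sample_msg_def messages_def Let_def mod_mult_in_zvec mod_in_zq)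
qed

text \<open>Cauchy--Schwarz over all pairs \<open>(b, k)\<close>, with the collision probability bounding the second
  moment of the hash distribution.\<close>

lemma leftover_hash:
  fixes h :: "'b \<Rightarrow> 'f \<Rightarrow> 'k" and p :: "'b \<Rightarrow> 'k \<Rightarrow> real"
  assumes fin: "finite B" "finite F" "finite K" and ne: "B \<noteq> {}" "F \<noteq> {}" "K \<noteq> {}"
    and h: "\<And>b f. b \<in> B \<Longrightarrow> f \<in> F \<Longrightarrow> h b f \<in> K"
    and p: "\<And>b k. b \<in> B \<Longrightarrow> k \<in> K \<Longrightarrow> \<bar>p b k\<bar> \<le> 1"
    and coll: "\<And>f f'. f \<in> F \<Longrightarrow> f' \<in> F \<Longrightarrow> f \<noteq> f' \<Longrightarrow> card {b \<in> B. h b f = h b f'} * card K \<le> card B"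
  shows "\<bar>(\<Sum>b\<in>B. \<Sum>f\<in>F. p b (h b f)) / (card B * card F) - (\<Sum>b\<in>B. \<Sum>k\<in>K. p b k) / (card B * card K)\<bar>
    \<le> sqrt (card K / card F)"
proof -
  define nB nF nK where "nB = real (card B)" and "nF = real (card F)" and "nK = real (card K)"
  have pos: "nB > 0" "nF > 0" "nK > 0" using fin ne by (simp_all add: nB_def nF_def nK_def card_gt_0_iff)
  \<comment> \<open>For the seed b, \<open>c\<close> counts the inputs hashed to k, and
    \<open>d\<close> below is the deviation of the hash distribution from uniform at k.\<close>
  define c where "c b k = (\<Sum>f\<in>F. of_bool (h b f = k) :: real)" for b k
  define d where "d b k = c b k / nF - 1 / nK" for b k
  have pc: "(\<Sum>f\<in>F. p b (h b f)) = (\<Sum>k\<in>K. p b k * c b k)" if b: "b \<in> B" for b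
  proof -
    have "(\<Sum>k\<in>K. p b k * c b k) = (\<Sum>f\<in>F. \<Sum>k\<in>K. p b k * of_bool (h b f = k))"
      unfolding c_def sum_distrib_left by (rule sum.swap)
    also have "\<dots> = (\<Sum>f\<in>F. p b (h b f))"
    proof (rule sum.cong[OF refl])
      fix f assume "f \<in> F"
      have "(\<Sum>k\<in>K. p b k * of_bool (h b f = k)) = (\<Sum>k\<in>K. if k = h b f then p b k else 0)"
        by (rule sum.cong) auto
      thus "(\<Sum>k\<in>K. p b k * of_bool (h b f = k)) = p b (h b f)"
        using h[OF b \<open>f \<in> F\<close>] fin(3) by simp
    qed
    finally show ?thesis by simp
  qed
  have diff: "(\<Sum>b\<in>B. \<Sum>f\<in>F. p b (h b f)) / (nB * nF) - (\<Sum>b\<in>B. \<Sum>k\<in>K. p b k) / (nB * nK)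
    = (\<Sum>b\<in>B. \<Sum>k\<in>K. p b k * d b k) / nB"
  proof -
    have "(\<Sum>b\<in>B. \<Sum>k\<in>K. p b k * d b k) = (\<Sum>b\<in>B. \<Sum>k\<in>K. p b k * c b k) / nF - (\<Sum>b\<in>B. \<Sum>k\<in>K. p b k) / nK"
      by (simp add: d_def right_diff_distrib sum_subtractf sum_divide_distrib)
    also have "(\<Sum>b\<in>B. \<Sum>k\<in>K. p b k * c b k) = (\<Sum>b\<in>B. \<Sum>f\<in>F. p b (h b f))"
      by (rule sum.cong) (simp_all add: pc)
    finally have e: "(\<Sum>b\<in>B. \<Sum>k\<in>K. p b k * d b k) =
      (\<Sum>b\<in>B. \<Sum>f\<in>F. p b (h b f)) / nF - (\<Sum>b\<in>B. \<Sum>k\<in>K. p b k) / nK" .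
    show ?thesis unfolding e by (simp add: diff_divide_distrib mult.commute)
  qed
  have c_sum: "(\<Sum>k\<in>K. c b k) = nF" if "b \<in> B" for b
  proof -
    have "(\<Sum>k\<in>K. c b k) = (\<Sum>f\<in>F. \<Sum>k\<in>K. of_bool (h b f = k))"
      unfolding c_def by (rule sum.swap)
    also have "\<dots> = (\<Sum>f\<in>F. 1)"
    proof (rule sum.cong[OF refl])
      fix f assume "f \<in> F"
      have "(\<Sum>k\<in>K. of_bool (h b f = k) :: real) = (\<Sum>k\<in>K. if k = h b f then 1 else 0)"
        by (rule sum.cong) auto
      thus "(\<Sum>k\<in>K. of_bool (h b f = k) :: real) = 1" using h[OF that \<open>f \<in> F\<close>] fin(3) by simp
    qed
    finally show ?thesis by (simp add: nF_def)
  qed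
  have c_sq: "(\<Sum>k\<in>K. (c b k)\<^sup>2) = (\<Sum>f\<in>F. \<Sum>f'\<in>F. of_bool (h b f = h b f'))" if "b \<in> B" for b
  proof -
    have "(\<Sum>k\<in>K. (c b k)\<^sup>2) = (\<Sum>k\<in>K. \<Sum>f\<in>F. \<Sum>f'\<in>F. of_bool (h b f = k) * of_bool (h b f' = k))"
      by (simp add: c_def power2_eq_square sum_product)
    also have "\<dots> = (\<Sum>f\<in>F. \<Sum>f'\<in>F. \<Sum>k\<in>K. of_bool (h b f = k) * of_bool (h b f' = k))"
      by (subst sum.swap, rule sum.cong[OF refl], rule sum.swap)
    also have "\<dots> = (\<Sum>f\<in>F. \<Sum>f'\<in>F. of_bool (h b f = h b f'))"
    proof (intro sum.cong refl)
      fix f f' assume "f \<in> F" "f' \<in> F"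
      have "(\<Sum>k\<in>K. of_bool (h b f = k) * of_bool (h b f' = k) :: real) =
        (\<Sum>k\<in>K. if k = h b f then of_bool (h b f = h b f') else 0)"
        by (rule sum.cong) auto
      thus "(\<Sum>k\<in>K. of_bool (h b f = k) * of_bool (h b f' = k)) = (of_bool (h b f = h b f') :: real)"
        using h[OF that \<open>f \<in> F\<close>] fin(3) by simp
    qed
    finally show ?thesis .
  qed
  have "(\<Sum>b\<in>B. \<Sum>k\<in>K. (c b k)\<^sup>2) = (\<Sum>b\<in>B. \<Sum>f\<in>F. \<Sum>f'\<in>F. of_bool (h b f = h b f'))"
    by (rule sum.cong) (simp_all add: c_sq)
  also have "\<dots> = (\<Sum>f\<in>F. \<Sum>f'\<in>F. \<Sum>b\<in>B. of_bool (h b f = h b f'))"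
    by (subst sum.swap, rule sum.cong[OF refl], rule sum.swap)
  \<comment> \<open>Pairs on the diagonal always collide. They are granted the extra
    \<open>nB / nK\<close> as well, so that these terms add up to the value for a perfectly uniform
    hash and cancel in \<open>d_sq\<close>.\<close>
  also have "\<dots> \<le> (\<Sum>f\<in>F. \<Sum>f'\<in>F. (if f' = f then nB else 0) + nB / nK)"
  proof (intro sum_mono)
    fix f f' assume f: "f \<in> F" "f' \<in> F"
    have "(\<Sum>b\<in>B. of_bool (h b f = h b f') :: real) = real (card {b \<in> B. h b f = h b f'})"
      using fin(1) by (simp add: of_bool_def sum.If_cases Int_def)
    also have "\<dots> \<le> (if f' = f then nB else 0) + nB / nK"
    proof (cases "f = f'")
      case True
      thus ?thesis using pos by (simp add: nB_def)
    next
      case False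
      have "real (card {b \<in> B. h b f = h b f'} * card K) \<le> nB"
        unfolding nB_def of_nat_le_iff by (rule coll[OF f False])
      thus ?thesis using pos False by (simp add: nK_def field_simps)
    qed
    finally show "(\<Sum>b\<in>B. of_bool (h b f = h b f')) \<le> (if f' = f then nB else 0) + nB / nK" .
  qed
  also have "\<dots> = nF * nB + nF\<^sup>2 * nB / nK"
    using fin(2) by (simp add: sum.distrib nF_def[symmetric] power2_eq_square distrib_left)
  finally have c_bd: "(\<Sum>b\<in>B. \<Sum>k\<in>K. (c b k)\<^sup>2) \<le> nF * nB + nF\<^sup>2 * nB / nK" .
  have d_sq: "(\<Sum>b\<in>B. \<Sum>k\<in>K. (d b k)\<^sup>2) \<le> nB / nF"
  proof -
    \<comment> \<open>As for a variance: the cross term is known because the counts add up to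
      \<open>nF\<close>, so only the second moment remains.\<close>
    have "(\<Sum>k\<in>K. (d b k)\<^sup>2) = (\<Sum>k\<in>K. (c b k)\<^sup>2) / nF\<^sup>2 - 1 / nK" if "b \<in> B" for b
    proof -
      have "(\<Sum>k\<in>K. (d b k)\<^sup>2) = (\<Sum>k\<in>K. (c b k)\<^sup>2 / nF\<^sup>2 - 2 / (nF * nK) * c b k + 1 / nK\<^sup>2)"
        using pos by (intro sum.cong refl) (simp add: d_def power2_eq_square field_simps)
      also have "\<dots> = (\<Sum>k\<in>K. (c b k)\<^sup>2) / nF\<^sup>2 - 2 / (nF * nK) * (\<Sum>k\<in>K. c b k) + nK * (1 / nK\<^sup>2)"
        by (simp add: sum.distrib sum_subtractf sum_divide_distrib[symmetric] sum_distrib_left[symmetric] nK_def)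
      also have "\<dots> = (\<Sum>k\<in>K. (c b k)\<^sup>2) / nF\<^sup>2 - 1 / nK"
        unfolding c_sum[OF that] using pos by (simp add: power2_eq_square)
      finally show ?thesis .
    qed
    hence "(\<Sum>b\<in>B. \<Sum>k\<in>K. (d b k)\<^sup>2) = (\<Sum>b\<in>B. (\<Sum>k\<in>K. (c b k)\<^sup>2) / nF\<^sup>2 - 1 / nK)"
      by (intro sum.cong) auto
    also have "\<dots> = (\<Sum>b\<in>B. \<Sum>k\<in>K. (c b k)\<^sup>2) / nF\<^sup>2 - nB / nK"
      by (simp add: sum_subtractf sum_divide_distrib[symmetric] nB_def)
    also have "\<dots> \<le> (nF * nB + nF\<^sup>2 * nB / nK) / nF\<^sup>2 - nB / nK"
      using c_bd pos by (simp add: divide_right_mono)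
    also have "\<dots> = nB / nF" using pos by (simp add: field_simps power2_eq_square)
    finally show ?thesis .
  qed
  have p_sq: "(\<Sum>b\<in>B. \<Sum>k\<in>K. (p b k)\<^sup>2) \<le> nB * nK"
  proof -
    have "(\<Sum>b\<in>B. \<Sum>k\<in>K. (p b k)\<^sup>2) \<le> (\<Sum>b\<in>B. \<Sum>k\<in>K. 1)"
      using p by (intro sum_mono) (auto simp: abs_square_le_1)
    thus ?thesis by (simp add: nB_def nK_def)
  qed
  have "(\<Sum>b\<in>B. \<Sum>k\<in>K. p b k * d b k)\<^sup>2 \<le> (\<Sum>b\<in>B. \<Sum>k\<in>K. (p b k)\<^sup>2) * (\<Sum>b\<in>B. \<Sum>k\<in>K. (d b k)\<^sup>2)"
    unfolding sum.cartesian_product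
    using Cauchy_Schwarz_ineq_sum[of "\<lambda>(b, k). p b k" "\<lambda>(b, k). d b k" "B \<times> K"] by (simp add: split_beta)
  also have "\<dots> \<le> (nB * nK) * (nB / nF)"
    using p_sq d_sq pos by (intro mult_mono sum_nonneg) auto
  also have "\<dots> = nB\<^sup>2 * (nK / nF)" by (simp add: power2_eq_square)
  finally have "((\<Sum>b\<in>B. \<Sum>k\<in>K. p b k * d b k) / nB)\<^sup>2 \<le> nK / nF"
    using pos by (simp add: power_divide field_simps)
  hence "\<bar>(\<Sum>b\<in>B. \<Sum>k\<in>K. p b k * d b k) / nB\<bar> \<le> sqrt (nK / nF)"
    by (intro real_le_rsqrt) (simp only: power2_abs)
  thus ?thesis unfolding diff[symmetric] by (simp add: nB_def nF_def nK_def)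
qed

text \<open>Subtracting the two collision congruences cancels all positions except i0. There the
  coefficient is 1 or -1, so the values agree modulo q, and both are reduced. In a collision the
  value at i0 is thus determined by the others.\<close>

lemma linear_collision_unique:
  fixes X X' c c' :: "nat \<Rightarrow> int"
  assumes "i0 < m" "c i0 \<in> {0, 1}" "c' i0 \<in> {0, 1}" "c i0 \<noteq> c' i0"
    and eq: "\<And>i. i < m \<Longrightarrow> i \<noteq> i0 \<Longrightarrow> X i = X' i"
    and coll: "((\<Sum>i<m. c i * X i) + y) mod int q = ((\<Sum>i<m. c' i * X i) + y) mod int q"
      "((\<Sum>i<m. c i * X' i) + y) mod int q = ((\<Sum>i<m. c' i * X' i) + y) mod int q"
    and zq: "X i0 \<in> zq q" "X' i0 \<in> zq q"
  shows "X i0 = X' i0"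
proof -
  have dvd: "int q dvd (\<Sum>i<m. (c i - c' i) * V i)"
    if "((\<Sum>i<m. c i * V i) + y) mod int q = ((\<Sum>i<m. c' i * V i) + y) mod int q" for V
  proof -
    have "int q dvd ((\<Sum>i<m. c i * V i) + y) - ((\<Sum>i<m. c' i * V i) + y)" using that by (simp only: mod_eq_dvd_iff)
    also have "\<dots> = (\<Sum>i<m. (c i - c' i) * V i)" by (simp add: left_diff_distrib sum_subtractf)
    finally show ?thesis .
  qed
  have "int q dvd (\<Sum>i<m. (c i - c' i) * X i) - (\<Sum>i<m. (c i - c' i) * X' i)"
    by (rule dvd_diff[OF dvd[OF coll(1)] dvd[OF coll(2)]])
  also have "\<dots> = (\<Sum>i<m. (c i - c' i) * (X i - X' i))"
    by (simp add: right_diff_distrib sum_subtractf)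
  also have "\<dots> = (\<Sum>i<m. if i = i0 then (c i0 - c' i0) * (X i0 - X' i0) else 0)"
    using eq by (intro sum.cong) auto
  also have "\<dots> = (c i0 - c' i0) * (X i0 - X' i0)" using assms(1) by simp
  finally have "int q dvd (c i0 - c' i0) * (X i0 - X' i0)" .
  moreover have "c i0 - c' i0 = 1 \<or> c i0 - c' i0 = -1" using assms(2-4) by auto
  ultimately have "int q dvd X i0 - X' i0" by (auto simp: dvd_diff_commute)
  hence "(X i0) mod int q = X' i0 mod int q" by (simp only: mod_eq_dvd_iff)
  thus ?thesis using zq by (simp add: zq_def)
qed

text \<open>Overwriting the sample at an index where \<open>f\<close> and \<open>f'\<close> differ is injective on pairs of a
  collision and a new sample.\<close>

lemma hash_collision:
  assumes q: "0 < q" and f: "f \<in> zvec 2 m" "f' \<in> zvec 2 m" "f \<noteq> f'"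
  shows "card {ds \<in> sample_lists n m q. snd (snd (sample_msg n q y f ds)) = snd (snd (sample_msg n q y f' ds))}
    * (q ^ n * q) \<le> card (sample_lists n m q)"
proof -
  define C where "C = {ds \<in> sample_lists n m q. snd (snd (sample_msg n q y f ds)) = snd (snd (sample_msg n q y f' ds))}"
  obtain i0 where i0: "i0 < m" "f $ i0 \<noteq> f' $ i0"
    using f zvec_dim[OF f(1)] zvec_dim[OF f(2)] by (metis eq_vecI)
  have f01: "f $ i0 \<in> {0, 1}" "f' $ i0 \<in> {0, 1}"
    using zvec_nth[OF f(1) i0(1)] zvec_nth[OF f(2) i0(1)] by (auto simp: zq_def)
  let ?g = "\<lambda>(ds, k). ds[i0 := k]"
  have "inj_on ?g (C \<times> (zvec q n \<times> zq q))"
  proof (rule inj_onI)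
    fix x x' assume "x \<in> C \<times> (zvec q n \<times> zq q)" "x' \<in> C \<times> (zvec q n \<times> zq q)" and e: "?g x = ?g x'"
    moreover obtain ds k ds' k' where x: "x = (ds, k)" "x' = (ds', k')" by (metis surj_pair)
    ultimately have ds: "ds \<in> C" "ds' \<in> C" by simp_all
    hence S: "ds \<in> sample_lists n m q" "ds' \<in> sample_lists n m q" by (simp_all add: C_def)
    hence len: "length ds = m" "length ds' = m" by (simp_all add: sample_lists_def)
    have e': "ds[i0 := k] = ds'[i0 := k']" using e by (simp add: x)
    have k: "k = k'" using arg_cong[OF e', of "\<lambda>l. l ! i0"] i0 len by simp
    have other: "ds ! i = ds' ! i" if "i \<noteq> i0" for i
      using arg_cong[OF e', of "\<lambda>l. l ! i"] that by simp
    note dims = zvec_dim[OF f(1)] zvec_dim[OF f(2)]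
    have w: "((\<Sum>i<m. f $ i * snd (d ! i)) + y) mod int q = ((\<Sum>i<m. f' $ i * snd (d ! i)) + y) mod int q"
      if "d \<in> C" for d
      using that by (auto simp: C_def sample_msg_def Let_def scalar_prod_samples sample_lists_def simp flip: vec_of_list_map)
    \<comment> \<open>The summand 0 stands in the place of y, so that the same linear lemma serves
      the coordinates of a and the entry w.\<close>
    have a: "((\<Sum>i<m. f $ i * fst (d ! i) $ j) + 0) mod int q = ((\<Sum>i<m. f' $ i * fst (d ! i) $ j) + 0) mod int q"
      if "d \<in> C" "j < n" for d j
    proof -
      have len: "length d = m" using that by (simp add: C_def sample_lists_def)
      let ?B = "transpose_mat (mat_of_rows n (map fst d))"
      have *: "mod_vec q (?B *\<^sub>v g) $ j = (\<Sum>i<m. g $ i * fst (d ! i) $ j) mod int q" if "dim_vec g = m" for g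
      proof -
        have "mod_vec q (?B *\<^sub>v g) $ j = (?B *\<^sub>v g) $ j mod int q"
          unfolding mod_vec_def using \<open>j < n\<close> by (intro index_map_vec(1)) simp
        thus ?thesis unfolding transpose_mult_index[OF len that \<open>j < n\<close>] .
      qed
      have "mod_vec q (?B *\<^sub>v f) = mod_vec q (?B *\<^sub>v f')" using that(1) by (simp add: C_def sample_msg_def Let_def)
      thus ?thesis using *[OF dims(1)] *[OF dims(2)] by simp
    qed
    \<comment> \<open>The overwritten sample is recovered coordinate by coordinate: each coordinate
      of the hash is one linear collision.\<close>
    have "snd (ds ! i0) = snd (ds' ! i0)"
      by (rule linear_collision_unique[where c = "\<lambda>i. f $ i" and c' = "\<lambda>i. f' $ i" and X = "\<lambda>i. snd (ds ! i)"
            and X' = "\<lambda>i. snd (ds' ! i)", OF i0(1) f01 i0(2) _ w[OF ds(1)] w[OF ds(2)]])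
         (use other sample_lists_nth(2)[OF S(1) i0(1)] sample_lists_nth(2)[OF S(2) i0(1)] in auto)
    moreover have "fst (ds ! i0) = fst (ds' ! i0)"
    proof (rule eq_vecI)
      have d: "dim_vec (fst (ds ! i0)) = n" "dim_vec (fst (ds' ! i0)) = n"
        using sample_lists_nth(1)[OF S(1) i0(1)] sample_lists_nth(1)[OF S(2) i0(1)] zvec_dim by auto
      thus "dim_vec (fst (ds ! i0)) = dim_vec (fst (ds' ! i0))" by simp
      fix j assume "j < dim_vec (fst (ds' ! i0))"
      hence j: "j < n" using d by simp
      show "fst (ds ! i0) $ j = fst (ds' ! i0) $ j"
        by (rule linear_collision_unique[where c = "\<lambda>i. f $ i" and c' = "\<lambda>i. f' $ i" and X = "\<lambda>i. fst (ds ! i) $ j"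
            and X' = "\<lambda>i. fst (ds' ! i) $ j", OF i0(1) f01 i0(2) _ a[OF ds(1) j] a[OF ds(2) j]])
         (use other zvec_nth[OF sample_lists_nth(1)[OF S(1) i0(1)] j] zvec_nth[OF sample_lists_nth(1)[OF S(2) i0(1)] j] in auto)
    qed
    ultimately have "ds ! i0 = ds' ! i0" by (rule prod_eqI[rotated])
    hence "ds = ds'" using other len by (intro nth_equalityI) (simp, metis)
    thus "x = x'" using k x by simp
  qed
  moreover have "?g ` (C \<times> (zvec q n \<times> zq q)) \<subseteq> sample_lists n m q"
  proof (rule image_subsetI)
    fix x assume "x \<in> C \<times> (zvec q n \<times> zq q)"
    then obtain ds k where x: "x = (ds, k)" "ds \<in> C" "k \<in> zvec q n \<times> zq q" by blast
    hence "set ds \<subseteq> zvec q n \<times> zq q" "length ds = m" by (simp_all add: C_def sample_lists_def)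
    thus "?g x \<in> sample_lists n m q"
      using set_update_subset_insert[of ds i0 k] x by (auto simp: sample_lists_def)
  qed
  ultimately have "card (C \<times> (zvec q n \<times> zq q)) \<le> card (sample_lists n m q)"
    by (rule card_inj_on_le) simp
  thus ?thesis by (simp add: card_cartesian_product card_zvec C_def)
qed

lemma lists_length_nonempty:
  assumes "A \<noteq> {}"
  shows "{xs. set xs \<subseteq> A \<and> length xs = k} \<noteq> {}"
proof -
  obtain a where "a \<in> A" using assms by auto
  hence "replicate k a \<in> {xs. set xs \<subseteq> A \<and> length xs = k}" by auto
  thus ?thesis by blast
qed

lemma pair_pmf_of_set:
  assumes "finite A" "A \<noteq> {}" "finite B" "B \<noteq> {}"
  shows "pair_pmf (pmf_of_set A) (pmf_of_set B) = pmf_of_set (A \<times> B)"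
proof (rule pmf_eqI)
  fix z :: "'a \<times> 'b"
  have "A \<times> B \<noteq> {}" "finite (A \<times> B)" using assms by auto
  thus "pmf (pair_pmf (pmf_of_set A) (pmf_of_set B)) z = pmf (pmf_of_set (A \<times> B)) z"
    using assms by (cases z) (simp add: pmf_pair indicator_def card_cartesian_product)
qed

section \<open>The hybrids\<close>

lemma replicate_pmf_of_set:
  assumes "finite A" "A \<noteq> {}"
  shows "replicate_pmf k (pmf_of_set A) = pmf_of_set {xs. set xs \<subseteq> A \<and> length xs = k}"
proof (induction k)
  case 0
  have "{xs. set xs \<subseteq> A \<and> length xs = 0} = {[]}" by auto
  thus ?case by (simp add: pmf_of_set_singleton)
next
  case (Suc k)
  let ?S = "\<lambda>k. {xs. set xs \<subseteq> A \<and> length xs = k}"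
  have fin: "finite (?S k)" by (rule finite_lists_length_eq[OF assms(1)])
  have ne: "?S k \<noteq> {}" by (rule lists_length_nonempty[OF assms(2)])
  have img: "(\<lambda>(x, xs). x # xs) ` (A \<times> ?S k) = ?S (Suc k)"
    by (auto simp: image_iff length_Suc_conv)
  have "replicate_pmf (Suc k) (pmf_of_set A) = map_pmf (\<lambda>(x, xs). x # xs) (pair_pmf (pmf_of_set A) (pmf_of_set (?S k)))"
    by (simp add: Suc pair_pmf_def map_pmf_def bind_assoc_pmf bind_return_pmf)
  also have "pair_pmf (pmf_of_set A) (pmf_of_set (?S k)) = pmf_of_set (A \<times> ?S k)"
    by (rule pair_pmf_of_set[OF assms fin ne])
  also have "map_pmf (\<lambda>(x, xs). x # xs) \<dots> = pmf_of_set (?S (Suc k))"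
    unfolding img[symmetric] using assms fin ne by (intro map_pmf_of_set_inj) (auto simp: inj_on_def)
  finally show ?case .
qed

text \<open>Independent draws commute. This separates a list of LWE samples into the rows of a
  matrix and an error vector.\<close>

lemma replicate_pmf_bind2:
  "replicate_pmf k (bind_pmf P (\<lambda>a. bind_pmf R (\<lambda>e. return_pmf (g a e)))) =
    bind_pmf (replicate_pmf k P) (\<lambda>as. bind_pmf (replicate_pmf k R) (\<lambda>es. return_pmf (map2 g as es)))"
proof (induction k)
  case 0
  show ?case by (simp add: bind_return_pmf)
next
  case (Suc k)
  have "replicate_pmf (Suc k) (bind_pmf P (\<lambda>a. bind_pmf R (\<lambda>e. return_pmf (g a e)))) =
    bind_pmf P (\<lambda>a. bind_pmf R (\<lambda>e. bind_pmf (replicate_pmf k P) (\<lambda>as. bind_pmf (replicate_pmf k R)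
      (\<lambda>es. return_pmf (map2 g (a # as) (e # es))))))"
    by (simp add: Suc bind_assoc_pmf bind_return_pmf)
  also have "\<dots> = bind_pmf P (\<lambda>a. bind_pmf (replicate_pmf k P) (\<lambda>as. bind_pmf R (\<lambda>e. bind_pmf (replicate_pmf k R)
      (\<lambda>es. return_pmf (map2 g (a # as) (e # es))))))"
    by (rule bind_pmf_cong[OF refl], rule bind_commute_pmf)
  also have "\<dots> = bind_pmf (replicate_pmf (Suc k) P) (\<lambda>as. bind_pmf (replicate_pmf (Suc k) R) (\<lambda>es. return_pmf (map2 g as es)))"
    by (simp add: bind_assoc_pmf bind_return_pmf)
  finally show ?case .
qed

text \<open>The client draws the matrix first and f last. For the reduction f must come first, to be
  averaged over, and the secret before the rows, as in the LWE game.\<close>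

lemma bind_pmf_reorder:
  "bind_pmf A (\<lambda>a. bind_pmf S (\<lambda>s. bind_pmf E (\<lambda>e. bind_pmf F (\<lambda>f. T a s e f)))) =
   bind_pmf F (\<lambda>f. bind_pmf S (\<lambda>s. bind_pmf A (\<lambda>a. bind_pmf E (\<lambda>e. T a s e f))))"
proof -
  have "bind_pmf A (\<lambda>a. bind_pmf S (\<lambda>s. bind_pmf E (\<lambda>e. bind_pmf F (\<lambda>f. T a s e f)))) =
     bind_pmf A (\<lambda>a. bind_pmf S (\<lambda>s. bind_pmf F (\<lambda>f. bind_pmf E (\<lambda>e. T a s e f))))"
    by (rule bind_pmf_cong[OF refl], rule bind_pmf_cong[OF refl], rule bind_commute_pmf)
  also have "\<dots> = bind_pmf A (\<lambda>a. bind_pmf F (\<lambda>f. bind_pmf S (\<lambda>s. bind_pmf E (\<lambda>e. T a s e f))))"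
    by (rule bind_pmf_cong[OF refl], rule bind_commute_pmf)
  also have "\<dots> = bind_pmf F (\<lambda>f. bind_pmf A (\<lambda>a. bind_pmf S (\<lambda>s. bind_pmf E (\<lambda>e. T a s e f))))"
    by (rule bind_commute_pmf)
  also have "\<dots> = bind_pmf F (\<lambda>f. bind_pmf S (\<lambda>s. bind_pmf A (\<lambda>a. bind_pmf E (\<lambda>e. T a s e f))))"
    by (rule bind_pmf_cong[OF refl], rule bind_commute_pmf)
  finally show ?thesis .
qed

section \<open>The client's message and the LWE game\<close>

text \<open>Fixing A isolates the single place where the law of the matrix enters, so that GenTrap
  can be exchanged for the uniform distribution.\<close>

definition client_given :: "nat \<Rightarrow> nat \<Rightarrow> nat \<Rightarrow> int pmf \<Rightarrow> int \<Rightarrow> int mat \<Rightarrow> message pmf" where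
  "client_given n m q \<chi> y A = do {
     s \<leftarrow> pmf_of_set (zvec q n);
     e \<leftarrow> map_pmf vec_of_list (replicate_pmf m \<chi>);
     f \<leftarrow> pmf_of_set (zvec 2 m);
     let v = mod_vec q (A *\<^sub>v s + e);
     return_pmf (A, v, mod_vec q (transpose_mat A *\<^sub>v f), (scalar_prod f v + y) mod int q)
   }"

text \<open>The trapdoor never enters the message, so GenTrap matters only through the marginal law
  of A.\<close>

lemma client_dist_eq: "client_dist n m q \<chi> gt y = bind_pmf (map_pmf fst gt) (client_given n m q \<chi> y)"
  unfolding client_dist_def client_given_def map_pmf_def bind_assoc_pmf bind_return_pmf
  by (rule bind_pmf_cong) (simp_all add: split_beta)

lemma sample_msg_lwe:
  assumes "length as = m" "length es = m" "set as \<subseteq> zvec q n" "s \<in> zvec q n"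
  shows "sample_msg n q y f (map2 (\<lambda>a e. (a, (scalar_prod a s + e) mod int q)) as es) =
    (let A = mat_of_rows n as; v = mod_vec q (A *\<^sub>v s + vec_of_list es)
     in (A, v, mod_vec q (transpose_mat A *\<^sub>v f), (scalar_prod f v + y) mod int q))"
proof -
  have 1: "map fst (map2 (\<lambda>a e. (a, (scalar_prod a s + e) mod int q)) as es) = as"
    using assms by (intro nth_equalityI) auto
  have 2: "vec_of_list (map snd (map2 (\<lambda>a e. (a, (scalar_prod a s + e) mod int q)) as es)) =
    mod_vec q (mat_of_rows n as *\<^sub>v s + vec_of_list es)"
  proof (rule eq_vecI)
    fix i assume "i < dim_vec (mod_vec q (mat_of_rows n as *\<^sub>v s + vec_of_list es))"
    hence i: "i < m" using assms by (simp add: mod_vec_def)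
    hence "as ! i \<in> zvec q n" using assms by auto
    hence "row (mat_of_rows n as) i = as ! i" using i assms by (intro mat_of_rows_row) (auto simp: zvec_def)
    thus "vec_of_list (map snd (map2 (\<lambda>a e. (a, (scalar_prod a s + e) mod int q)) as es)) $ i =
      mod_vec q (mat_of_rows n as *\<^sub>v s + vec_of_list es) $ i"
      using i assms by (simp add: mod_vec_def vec_of_list_index del: vec_of_list_map)
  qed (use assms in \<open>simp add: mod_vec_def\<close>)
  show ?thesis unfolding sample_msg_def Let_def 1 2 ..
qed

lemma client_given_uniform:
  assumes "0 < q"
  shows "bind_pmf (pmf_of_set (zmat q m n)) (client_given n m q \<chi> y) =
    do {f \<leftarrow> pmf_of_set (zvec 2 m); s \<leftarrow> pmf_of_set (zvec q n); ds \<leftarrow> replicate_pmf m (lwe_sample n q \<chi> s);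
        return_pmf (sample_msg n q y f ds)}"
proof -
  let ?Z = "pmf_of_set (zvec q n)" and ?F = "pmf_of_set (zvec 2 m)"
  have ne: "zvec q n \<noteq> {}" by (rule zvec_nonempty[OF assms])
  have fin: "finite {rs. set rs \<subseteq> zvec q n \<and> length rs = m}" by (rule finite_lists_length_eq) simp
  have ne': "{rs. set rs \<subseteq> zvec q n \<and> length rs = m} \<noteq> {}" by (rule lists_length_nonempty[OF ne])
  have Z: "pmf_of_set (zmat q m n) = map_pmf (mat_of_rows n) (replicate_pmf m ?Z)"
    unfolding replicate_pmf_of_set[OF finite_zvec ne]
    by (rule map_pmf_of_set_bij_betw[symmetric, OF bij_betw_zmat ne' fin])
  let ?T = "\<lambda>as s es f. return_pmf (let A = mat_of_rows n as; v = mod_vec q (A *\<^sub>v s + vec_of_list es)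
     in (A, v, mod_vec q (transpose_mat A *\<^sub>v f), (scalar_prod f v + y) mod int q))"
  have "bind_pmf (pmf_of_set (zmat q m n)) (client_given n m q \<chi> y) =
    bind_pmf (replicate_pmf m ?Z) (\<lambda>as. bind_pmf ?Z (\<lambda>s. bind_pmf (replicate_pmf m \<chi>) (\<lambda>es. bind_pmf ?F (\<lambda>f. ?T as s es f))))"
    unfolding Z client_given_def bind_map_pmf Let_def ..
  also have "\<dots> = bind_pmf ?F (\<lambda>f. bind_pmf ?Z (\<lambda>s. bind_pmf (replicate_pmf m ?Z) (\<lambda>as. bind_pmf (replicate_pmf m \<chi>) (\<lambda>es. ?T as s es f))))"
    by (rule bind_pmf_reorder)
  also have "\<dots> = bind_pmf ?F (\<lambda>f. bind_pmf ?Z (\<lambda>s. bind_pmf (replicate_pmf m ?Z) (\<lambda>as. bind_pmf (replicate_pmf m \<chi>) (\<lambda>es.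
      return_pmf (sample_msg n q y f (map2 (\<lambda>a e. (a, (scalar_prod a s + e) mod int q)) as es))))))"
  proof (intro bind_pmf_cong refl)
    fix f s as es
    assume "s \<in> set_pmf ?Z" "as \<in> set_pmf (replicate_pmf m ?Z)" "es \<in> set_pmf (replicate_pmf m \<chi>)"
    hence "s \<in> zvec q n" "set as \<subseteq> zvec q n" "length as = m" "length es = m"
      using ne by (auto simp: set_replicate_pmf)
    thus "?T as s es f = return_pmf (sample_msg n q y f (map2 (\<lambda>a e. (a, (scalar_prod a s + e) mod int q)) as es))"
      by (simp add: sample_msg_lwe)
  qed
  also have "\<dots> = do {f \<leftarrow> ?F; s \<leftarrow> ?Z; ds \<leftarrow> replicate_pmf m (lwe_sample n q \<chi> s);
        return_pmf (sample_msg n q y f ds)}"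
    unfolding lwe_sample_def replicate_pmf_bind2 bind_assoc_pmf bind_return_pmf ..
  finally show ?thesis .
qed

lemma expectation_bind_pmf_finite:
  fixes h :: "'b \<Rightarrow> real"
  assumes "finite (set_pmf p)" "\<And>x. x \<in> set_pmf p \<Longrightarrow> finite (set_pmf (f x))"
  shows "measure_pmf.expectation (bind_pmf p f) h = measure_pmf.expectation p (\<lambda>x. measure_pmf.expectation (f x) h)"
  using pmf_expectation_bind[OF assms subset_refl, where h = h] integral_measure_pmf[OF assms(1), of p "\<lambda>x. measure_pmf.expectation (f x) h"]
  by auto

lemma expectation_pmf_cong:
  fixes f g :: "'a \<Rightarrow> real"
  assumes "\<And>x. x \<in> set_pmf p \<Longrightarrow> f x = g x"
  shows "measure_pmf.expectation p f = measure_pmf.expectation p g"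
  using assms by (intro integral_cong_AE) (auto simp: AE_measure_pmf_iff)

text \<open>The factor 2 undoes the half in \<open>stat_dist\<close>: a test with values between -1
  and 1 is bounded by the full L1 distance.\<close>

lemma expectation_diff_le_stat_dist:
  fixes h :: "'a \<Rightarrow> real"
  assumes "finite S" "set_pmf P \<subseteq> S" "set_pmf R \<subseteq> S" "\<And>x. x \<in> S \<Longrightarrow> \<bar>h x\<bar> \<le> 1"
  shows "\<bar>measure_pmf.expectation P h - measure_pmf.expectation R h\<bar> \<le> 2 * stat_dist P R"
proof -
  have E: "measure_pmf.expectation D h = (\<Sum>x\<in>S. pmf D x * h x)" if "set_pmf D \<subseteq> S" for D
    using integral_measure_pmf[OF assms(1), of D h] that by auto
  have "(\<Sum>\<^sub>\<infinity>x. \<bar>pmf P x - pmf R x\<bar>) = (\<Sum>\<^sub>\<infinity>x\<in>S. \<bar>pmf P x - pmf R x\<bar>)"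
  proof (rule infsum_cong_neutral)
    fix x assume "x \<in> UNIV - S"
    hence "x \<notin> set_pmf P" "x \<notin> set_pmf R" using assms by auto
    thus "\<bar>pmf P x - pmf R x\<bar> = 0" by (simp add: set_pmf_iff)
  qed auto
  hence sd: "2 * stat_dist P R = (\<Sum>x\<in>S. \<bar>pmf P x - pmf R x\<bar>)"
    using assms(1) by (simp add: stat_dist_def)
  have "\<bar>measure_pmf.expectation P h - measure_pmf.expectation R h\<bar> = \<bar>\<Sum>x\<in>S. (pmf P x - pmf R x) * h x\<bar>"
    using assms by (simp add: E left_diff_distrib sum_subtractf)
  also have "\<dots> \<le> (\<Sum>x\<in>S. \<bar>pmf P x - pmf R x\<bar> * 1)"
    using assms(4) by (intro order_trans[OF sum_abs] sum_mono) (simp only: abs_mult, intro mult_left_mono, auto)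
  finally show ?thesis by (simp add: sd)
qed

text \<open>The mean of the test p on the adversary's message in the LWE game with hidden bit
  \<beta>; \<open>True\<close> is the uniform oracle.\<close>

definition lwe_view :: "nat \<Rightarrow> nat \<Rightarrow> nat \<Rightarrow> int pmf \<Rightarrow> (message \<Rightarrow> real) \<Rightarrow> int \<Rightarrow> int vec \<Rightarrow> bool \<Rightarrow> real" where
  "lwe_view n m q \<chi> p y f \<beta> = measure_pmf.expectation (pmf_of_set (zvec q n))
     (\<lambda>s. measure_pmf.expectation (replicate_pmf m (lwe_oracle n q \<chi> \<beta> s)) (\<lambda>ds. p (sample_msg n q y f ds)))"

text \<open>Reduction modulo q confines the samples to a finite set whatever the support of the
  errors, so all later expectations are finite sums.\<close>

lemma set_lwe_samples:
  assumes "0 < q" "s \<in> zvec q n"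
  shows "set_pmf (replicate_pmf m (lwe_oracle n q \<chi> \<beta> s)) \<subseteq> sample_lists n m q"
proof -
  have "set_pmf (lwe_oracle n q \<chi> \<beta> s) \<subseteq> zvec q n \<times> zq q"
    using assms zvec_nonempty[OF assms(1), of n] zq_nonempty[OF assms(1)]
    by (auto simp: lwe_oracle_def lwe_sample_def mod_in_zq split: if_splits)
  thus ?thesis unfolding set_replicate_pmf sample_lists_def lists_eq_set by auto
qed

lemma finite_lwe_samples:
  "0 < q \<Longrightarrow> s \<in> zvec q n \<Longrightarrow> finite (set_pmf (replicate_pmf m (lwe_oracle n q \<chi> \<beta> s)))"
  by (rule finite_subset[OF set_lwe_samples finite_sample_lists])

lemma lwe_view_uniform:
  assumes "0 < q"
  shows "lwe_view n m q \<chi> p y f True = (\<Sum>ds\<in>sample_lists n m q. p (sample_msg n q y f ds)) / card (sample_lists n m q)"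
proof -
  have "zvec q n \<times> zq q \<noteq> {}" using assms by (simp add: zvec_nonempty zq_nonempty)
  moreover from this have "sample_lists n m q \<noteq> {}"
    unfolding sample_lists_def by (rule lists_length_nonempty)
  ultimately show ?thesis
    by (simp add: lwe_view_def lwe_oracle_def replicate_pmf_of_set sample_lists_def[symmetric] integral_pmf_of_set)
qed

lemma client_given_uniform_expectation:
  assumes "0 < q"
  shows "measure_pmf.expectation (bind_pmf (pmf_of_set (zmat q m n)) (client_given n m q \<chi> y)) p
    = (\<Sum>f\<in>zvec 2 m. lwe_view n m q \<chi> p y f False) / card (zvec 2 m)"
proof -
  have ne: "zvec q n \<noteq> {}" "zvec 2 m \<noteq> {}" using assms by (simp_all add: zvec_nonempty)
  have fin: "finite (set_pmf (replicate_pmf m (lwe_sample n q \<chi> s)))" if "s \<in> zvec q n" for s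
    using finite_lwe_samples[OF assms that, of m \<chi> False] by (simp add: lwe_oracle_def)
  let ?R = "\<lambda>f s. map_pmf (sample_msg n q y f) (replicate_pmf m (lwe_sample n q \<chi> s))"
  have finR: "finite (set_pmf (?R f s))" if "s \<in> zvec q n" for f s using fin[OF that] by simp
  have view: "measure_pmf.expectation (bind_pmf (pmf_of_set (zvec q n)) (?R f)) p = lwe_view n m q \<chi> p y f False" for f
    using ne(1) finR by (subst expectation_bind_pmf_finite) (simp_all add: lwe_view_def lwe_oracle_def)
  have "measure_pmf.expectation (bind_pmf (pmf_of_set (zmat q m n)) (client_given n m q \<chi> y)) p
    = measure_pmf.expectation (bind_pmf (pmf_of_set (zvec 2 m)) (\<lambda>f. bind_pmf (pmf_of_set (zvec q n)) (?R f))) p"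
    unfolding client_given_uniform[OF assms] map_pmf_def[symmetric] ..
  also have "\<dots> = measure_pmf.expectation (pmf_of_set (zvec 2 m)) (\<lambda>f. lwe_view n m q \<chi> p y f False)"
    using ne finR by (subst expectation_bind_pmf_finite) (auto simp: view)
  finally show ?thesis using ne(2) by (simp add: integral_pmf_of_set)
qed

lemma set_client_given:
  assumes "0 < q" "A \<in> zmat q m n"
  shows "set_pmf (client_given n m q \<chi> y A) \<subseteq> messages n m q"
proof -
  have [simp]: "dim_row A = m" "dim_col A = n" using assms(2) by (auto simp: zmat_def)
  have "mod_vec q (A *\<^sub>v s + vec_of_list es) \<in> zvec q m" if "length es = m" for s es
  proof -
    have "mod_vec q (A *\<^sub>v s + vec_of_list es) \<in> carrier_vec m" using that by (intro carrier_vecI) (simp add: mod_vec_def)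
    thus ?thesis using assms(1) that by (simp add: zvec_def mod_vec_def mod_in_zq)
  qed
  thus ?thesis using assms
    by (auto simp: client_given_def messages_def Let_def mod_mult_in_zvec mod_in_zq set_replicate_pmf)
qed

text \<open>The sample list is the public seed of the hash, f its input and (a, w) its value. The
  test also sees A and v; this is why \<open>leftover_hash\<close> lets the test depend on the
  seed.\<close>

lemma leftover_hash_sample_msg:
  assumes q: "0 < q" and p: "\<And>M. M \<in> messages n m q \<Longrightarrow> \<bar>p M\<bar> \<le> 1"
  shows "\<bar>(\<Sum>f\<in>zvec 2 m. lwe_view n m q \<chi> p y f True) / card (zvec 2 m)
      - measure_pmf.expectation (uniform_dist n m q) p\<bar> \<le> sqrt (real q ^ Suc n / 2 ^ m)"
proof -
  let ?B = "sample_lists n m q" and ?F = "zvec 2 m" and ?K = "zvec q n \<times> zq q"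
  let ?e = "\<lambda>ds. (mat_of_rows n (map fst ds), vec_of_list (map snd ds))"
  define P where "P ds k = p (fst (?e ds), snd (?e ds), k)" for ds and k :: "int vec \<times> int"
  define h where "h ds f = snd (snd (sample_msg n q y f ds))" for ds f
  have msg: "sample_msg n q y f ds = (fst (?e ds), snd (?e ds), h ds f)" for f ds
    by (simp add: h_def sample_msg_def Let_def)
  have ne: "?K \<noteq> {}" using q by (simp add: zvec_nonempty zq_nonempty)
  hence neB: "?B \<noteq> {}" unfolding sample_lists_def by (rule lists_length_nonempty)
  have cardK: "card ?K = q ^ Suc n" by (simp add: card_cartesian_product card_zvec)
  have e: "?e ds \<in> zmat q m n \<times> zvec q m" if "ds \<in> ?B" for ds
    using bij_betwE[OF bij_betw_sample_lists] that by blast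
  have "\<bar>(\<Sum>ds\<in>?B. \<Sum>f\<in>?F. P ds (h ds f)) / (card ?B * card ?F) - (\<Sum>ds\<in>?B. \<Sum>k\<in>?K. P ds k) / (card ?B * card ?K)\<bar>
    \<le> sqrt (card ?K / card ?F)"
  proof (rule leftover_hash)
    show "h ds f \<in> ?K" if "ds \<in> ?B" "f \<in> ?F" for ds f
      using sample_msg_in_messages[OF q that(1), of y f] by (simp add: msg messages_def)
    show "\<bar>P ds k\<bar> \<le> 1" if "ds \<in> ?B" "k \<in> ?K" for ds k
      unfolding P_def using e[OF that(1)] that(2) by (intro p) (auto simp: messages_def)
    show "card {ds \<in> ?B. h ds f = h ds f'} * card ?K \<le> card ?B" if "f \<in> ?F" "f' \<in> ?F" "f \<noteq> f'" for f f'
      using hash_collision[OF q that, of n y] by (simp add: h_def card_cartesian_product card_zvec)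
  qed (use ne neB zvec_nonempty[of 2 m] in auto)
  moreover have "(\<Sum>ds\<in>?B. \<Sum>f\<in>?F. P ds (h ds f)) / (card ?B * card ?F) =
    (\<Sum>f\<in>zvec 2 m. lwe_view n m q \<chi> p y f True) / card (zvec 2 m)"
  proof -
    have "(\<Sum>ds\<in>?B. \<Sum>f\<in>?F. P ds (h ds f)) = (\<Sum>f\<in>?F. \<Sum>ds\<in>?B. p (sample_msg n q y f ds))"
      unfolding P_def msg by (rule sum.swap)
    also have "\<dots> = card ?B * (\<Sum>f\<in>zvec 2 m. lwe_view n m q \<chi> p y f True)"
      using neB by (simp add: lwe_view_uniform[OF q] sum_divide_distrib[symmetric])
    finally show ?thesis using neB by simp
  qed
  moreover have "(\<Sum>ds\<in>?B. \<Sum>k\<in>?K. P ds k) / (card ?B * card ?K) = measure_pmf.expectation (uniform_dist n m q) p"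
  proof -
    have bij: "bij_betw (\<lambda>(ds, k). (fst (?e ds), snd (?e ds), k)) (?B \<times> ?K) (messages n m q)"
    proof -
      have "bij_betw (map_prod ?e id) (?B \<times> ?K) ((zmat q m n \<times> zvec q m) \<times> ?K)"
        by (rule bij_betw_map_prod[OF bij_betw_sample_lists bij_betw_id])
      moreover have "bij_betw (\<lambda>((A, v), k). (A, v, k)) ((zmat q m n \<times> zvec q m) \<times> ?K) (messages n m q)"
        by (rule bij_betw_byWitness[where f' = "\<lambda>(A, v, k). ((A, v), k)"]) (auto simp: messages_def)
      ultimately have b: "bij_betw ((\<lambda>((A, v), k). (A, v, k)) \<circ> map_prod ?e id) (?B \<times> ?K) (messages n m q)"
        by (rule bij_betw_trans)
      have e: "(\<lambda>((A, v), k). (A, v, k)) \<circ> map_prod ?e id = (\<lambda>(ds, k). (fst (?e ds), snd (?e ds), k))"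
        by (simp add: fun_eq_iff)
      show ?thesis by (rule b[unfolded e])
    qed
    have "(\<Sum>ds\<in>?B. \<Sum>k\<in>?K. P ds k) = (\<Sum>x\<in>?B \<times> ?K. p ((\<lambda>(ds, k). (fst (?e ds), snd (?e ds), k)) x))"
      by (simp add: sum.cartesian_product P_def split_beta)
    also have "\<dots> = (\<Sum>M\<in>messages n m q. p M)" by (rule sum.reindex_bij_betw[OF bij])
    finally have "(\<Sum>ds\<in>?B. \<Sum>k\<in>?K. P ds k) = (\<Sum>M\<in>messages n m q. p M)" .
    moreover have "card (messages n m q) = card ?B * card ?K"
      using bij_betw_same_card[OF bij] by (simp only: card_cartesian_product)
    ultimately show ?thesis
      by (simp add: uniform_dist_def integral_pmf_of_set messages_nonempty[OF q])
  qed
  ultimately show ?thesis unfolding cardK card_zvec by simp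
qed

lemma average_diff_le:
  fixes a b :: "'a \<Rightarrow> real"
  assumes "finite F" "F \<noteq> {}"
  obtains f where "f \<in> F" "\<bar>(\<Sum>f\<in>F. a f) / card F - (\<Sum>f\<in>F. b f) / card F\<bar> \<le> \<bar>a f - b f\<bar>"
proof -
  define D where "D f = \<bar>a f - b f\<bar>" for f
  define M where "M = Max (D ` F)"
  have "M \<in> D ` F" unfolding M_def using assms by (intro Max_in) auto
  then obtain f where f: "f \<in> F" "D f = M" by auto
  have "D g \<le> M" if "g \<in> F" for g unfolding M_def using assms that by (intro Max_ge) auto
  hence "\<bar>\<Sum>g\<in>F. a g - b g\<bar> \<le> (\<Sum>g\<in>F. M)"
    by (intro order_trans[OF sum_abs] sum_mono) (simp add: D_def)
  moreover have "(\<Sum>f\<in>F. a f) / card F - (\<Sum>f\<in>F. b f) / card F = (\<Sum>g\<in>F. a g - b g) / card F"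
    by (simp add: sum_subtractf diff_divide_distrib)
  moreover have "card F > 0" using assms by (simp add: card_gt_0_iff)
  ultimately have "\<bar>(\<Sum>f\<in>F. a f) / card F - (\<Sum>f\<in>F. b f) / card F\<bar> \<le> M"
    by (simp add: abs_divide divide_le_eq mult.commute)
  thus ?thesis using that[OF f(1)] f(2) by (simp add: D_def)
qed

text \<open>Averaging over the bit vector: some fixed \<open>f\<close> is at least as good for the distinguisher as a
  random one, so the LWE adversary can have \<open>f\<close> built in.\<close>

lemma client_uniform_hybrid:
  assumes q: "0 < q" and p: "\<And>M. M \<in> messages n m q \<Longrightarrow> \<bar>p M\<bar> \<le> 1"
    and gt: "\<And>A t. (A, t) \<in> set_pmf gt \<Longrightarrow> A \<in> zmat q m n"
  obtains f where "f \<in> zvec 2 m"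
    "\<bar>measure_pmf.expectation (client_dist n m q \<chi> gt y) p - measure_pmf.expectation (uniform_dist n m q) p\<bar>
      \<le> 2 * stat_dist (map_pmf fst gt) (pmf_of_set (zmat q m n))
        + \<bar>lwe_view n m q \<chi> p y f False - lwe_view n m q \<chi> p y f True\<bar> + sqrt (real q ^ Suc n / 2 ^ m)"
proof -
  let ?G = "client_given n m q \<chi> y" and ?U = "pmf_of_set (zmat q m n)" and ?gt = "map_pmf fst gt"
  let ?E = "\<lambda>A. measure_pmf.expectation (?G A) p"
  have set: "set_pmf ?gt \<subseteq> zmat q m n" "set_pmf ?U \<subseteq> zmat q m n"
    using gt zmat_nonempty[OF q, of m n] by force+
  have fin: "finite (set_pmf (?G A))" if "A \<in> zmat q m n" for A
    by (rule finite_subset[OF set_client_given[OF q that] finite_messages])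
  have E: "measure_pmf.expectation (bind_pmf D ?G) p = measure_pmf.expectation D ?E" if "set_pmf D \<subseteq> zmat q m n" for D
    using that fin finite_subset[OF that finite_zmat] by (intro expectation_bind_pmf_finite) auto
  have bd: "\<bar>?E A\<bar> \<le> 1" if A: "A \<in> zmat q m n" for A
  proof -
    have "\<bar>?E A\<bar> \<le> measure_pmf.expectation (?G A) (\<lambda>M. \<bar>p M\<bar>)" by (rule integral_abs_bound)
    also have "\<dots> \<le> measure_pmf.expectation (?G A) (\<lambda>M. 1)"
      using fin[OF A]
      by (intro integral_mono_AE integrable_measure_pmf_finite)
         (auto simp: AE_measure_pmf_iff intro!: p subsetD[OF set_client_given[OF q A]])
    finally show ?thesis by simp
  qed
  obtain f where f: "f \<in> zvec 2 m" and "\<bar>(\<Sum>f\<in>zvec 2 m. lwe_view n m q \<chi> p y f False) / card (zvec 2 m) -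
    (\<Sum>f\<in>zvec 2 m. lwe_view n m q \<chi> p y f True) / card (zvec 2 m)\<bar> \<le>
    \<bar>lwe_view n m q \<chi> p y f False - lwe_view n m q \<chi> p y f True\<bar>"
    by (rule average_diff_le[of "zvec 2 m" "\<lambda>f. lwe_view n m q \<chi> p y f False" "\<lambda>f. lwe_view n m q \<chi> p y f True"])
       (simp_all add: zvec_nonempty)
  moreover have "\<bar>measure_pmf.expectation ?gt ?E - measure_pmf.expectation ?U ?E\<bar> \<le> 2 * stat_dist ?gt ?U"
    by (rule expectation_diff_le_stat_dist[OF finite_zmat set bd])
  moreover have "measure_pmf.expectation ?U ?E = (\<Sum>f\<in>zvec 2 m. lwe_view n m q \<chi> p y f False) / card (zvec 2 m)"
    unfolding E[OF set(2), symmetric] by (rule client_given_uniform_expectation[OF q])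
  moreover have "measure_pmf.expectation ?gt ?E = measure_pmf.expectation (client_dist n m q \<chi> gt y) p"
    unfolding client_dist_eq E[OF set(1)] ..
  moreover have "\<bar>(\<Sum>f\<in>zvec 2 m. lwe_view n m q \<chi> p y f True) / card (zvec 2 m)
      - measure_pmf.expectation (uniform_dist n m q) p\<bar> \<le> sqrt (real q ^ Suc n / 2 ^ m)"
    by (rule leftover_hash_sample_msg[OF q]) (rule p)
  ultimately show ?thesis by (intro that[OF f]) linarith
qed

section \<open>The LWE adversary\<close>

lemma block_index_less:
  fixes i j m n :: nat
  assumes "i < m" "j < n"
  shows "i * n + j < m * n"
proof -
  have "i * n + j < Suc i * n" using assms(2) by simp
  also have "\<dots> \<le> m * n" using assms(1) by (intro mult_le_mono1) simp
  finally show ?thesis .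
qed

lemma nth_concat_uniform:
  assumes "\<forall>x\<in>set xs. length x = z" "i < length xs" "k < z"
  shows "concat xs ! (i * z + k) = xs ! i ! k"
  using assms
proof (induction xs arbitrary: i)
  case (Cons x xs)
  have x: "length x = z" using Cons.prems(1) by simp
  show ?case
  proof (cases i)
    case 0
    thus ?thesis using Cons.prems(3) x by (simp add: nth_append)
  next
    case (Suc i')
    have "concat (x # xs) ! (i * z + k) = concat xs ! (i' * z + k)"
      using x by (simp add: nth_append Suc)
    also have "\<dots> = xs ! i' ! k" using Cons.prems Suc by (intro Cons.IH) auto
    finally show ?thesis by (simp add: Suc)
  qed
qed simp

lemma length_concat_uniform:
  assumes "\<forall>x\<in>set xs. length x = z"
  shows "length (concat xs) = length xs * z"
  using assms by (induction xs) auto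

lemma length_enc_z [simp]: "length (enc_z q x) = zlen q"
  by (simp add: enc_z_def)

lemma nth_enc_z: "k < zlen q \<Longrightarrow> enc_z q x ! k = bit x k"
  by (simp add: enc_z_def)

text \<open>The entries of a message in the order of its encoding, which consists of one block of
  \<open>zlen q\<close> bits per entry.\<close>

definition entries :: "message \<Rightarrow> int list" where
  "entries = (\<lambda>(A, v, a, w). concat (map list_of_vec (rows A)) @ list_of_vec v @ list_of_vec a @ [w])"

lemma enc_message_entries: "enc_message q M = concat (map (enc_z q) (entries M))"
proof -
  obtain A v a w where M: "M = (A, v, a, w)" by (cases M)
  have "concat (map (enc_z q) (concat (map list_of_vec rs))) = concat (map (enc_vec q) rs)" for rs
    by (induction rs) (simp_all add: enc_vec_def)
  thus ?thesis by (simp add: M entries_def enc_message_def enc_mat_def enc_vec_def)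
qed

lemma length_entries:
  assumes "M \<in> messages n m q"
  shows "length (entries M) = m * n + m + n + 1"
proof -
  obtain A v a w where M: "M = (A, v, a, w)" by (cases M)
  hence A: "A \<in> carrier_mat m n" "v \<in> carrier_vec m" "a \<in> carrier_vec n"
    using assms by (auto simp: messages_def zmat_def zvec_def)
  have "length (concat (map list_of_vec (rows A))) = length (map list_of_vec (rows A)) * n"
    by (rule length_concat_uniform) (use A in \<open>auto simp: rows_def\<close>)
  thus ?thesis using A by (simp add: M entries_def)
qed

lemma nth_entries:
  assumes "(A, v, a, w) \<in> messages n m q"
  shows "\<And>i j. i < m \<Longrightarrow> j < n \<Longrightarrow> entries (A, v, a, w) ! (i * n + j) = A $$ (i, j)"
    and "\<And>i. i < m \<Longrightarrow> entries (A, v, a, w) ! (m * n + i) = v $ i"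
    and "\<And>j. j \<le> n \<Longrightarrow> entries (A, v, a, w) ! (m * n + m + j) = (if j < n then a $ j else w)"
proof -
  have A: "A \<in> carrier_mat m n" "v \<in> carrier_vec m" "a \<in> carrier_vec n"
    using assms by (auto simp: messages_def zmat_def zvec_def)
  have blocks: "\<forall>x\<in>set (map list_of_vec (rows A)). length x = n"
    using A by (auto simp: rows_def)
  have len: "length (concat (map list_of_vec (rows A))) = m * n"
    using length_concat_uniform[OF blocks] A by simp
  show "entries (A, v, a, w) ! (i * n + j) = A $$ (i, j)" if "i < m" "j < n" for i j
  proof -
    have "i * n + j < m * n" using that block_index_less[of i m j n] by simp
    hence "entries (A, v, a, w) ! (i * n + j) = concat (map list_of_vec (rows A)) ! (i * n + j)"
      using len by (simp add: entries_def nth_append)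
    also have "\<dots> = A $$ (i, j)"
      using nth_concat_uniform[OF blocks, of i j] that A by (simp add: list_of_vec_index)
    finally show ?thesis .
  qed
  show "entries (A, v, a, w) ! (m * n + i) = v $ i" if "i < m" for i
    using that A len by (simp add: entries_def nth_append list_of_vec_index)
  show "entries (A, v, a, w) ! (m * n + m + j) = (if j < n then a $ j else w)" if "j \<le> n" for j
    using that A len by (simp add: entries_def nth_append list_of_vec_index)
qed

lemma nth_enc_message:
  assumes "M \<in> messages n m q" "e < m * n + m + n + 1" "k < zlen q"
  shows "enc_message q M ! (e * zlen q + k) = bit (entries M ! e) k"
proof -
  have "concat (map (enc_z q) (entries M)) ! (e * zlen q + k) = map (enc_z q) (entries M) ! e ! k"
    by (rule nth_concat_uniform) (use assms length_entries in auto)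
  thus ?thesis using assms length_entries[OF assms(1)] by (simp add: enc_message_entries nth_enc_z)
qed

lemma length_enc_message:
  assumes "M \<in> messages n m q"
  shows "length (enc_message q M) = (m * n + m + n + 1) * zlen q"
proof -
  have "length (concat (map (enc_z q) (entries M))) = length (map (enc_z q) (entries M)) * zlen q"
    by (rule length_concat_uniform) auto
  thus ?thesis using length_entries[OF assms] by (simp add: enc_message_entries)
qed

lemma zlen_bound: "0 < q \<Longrightarrow> q \<le> 2 ^ zlen q"
proof -
  assume q: "0 < q"
  have "real q = 2 powr log 2 (real q)" using q by simp
  also have "\<dots> \<le> 2 powr real (zlen q)"
    unfolding zlen_def by (intro powr_mono) linarith+
  also have "\<dots> = real (2 ^ zlen q)" by (simp add: powr_realpow)
  finally show ?thesis by (simp only: of_nat_le_iff)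
qed

lemma zlen_pos: "2 \<le> q \<Longrightarrow> 0 < zlen q"
proof (rule ccontr)
  assume "2 \<le> q" "\<not> 0 < zlen q"
  thus False using zlen_bound[of q] by simp
qed

section \<open>Loading the samples by queries\<close>

text \<open>The \<open>i\<close>-th query loads row \<open>i\<close> of \<open>A\<close> and entry \<open>i\<close> of \<open>v\<close> into the input wires of the guesser.\<close>

definition query_wires :: "nat \<Rightarrow> nat \<Rightarrow> nat \<Rightarrow> nat \<Rightarrow> nat list" where
  "query_wires n m z i = [i * n * z..<Suc i * n * z] @ [(m * n + i) * z..<(m * n + Suc i) * z]"

lemma length_query_wires: "length (query_wires n m z i) = (n + 1) * z"
  by (simp add: query_wires_def algebra_simps)

lemma nth_query_wires:
  assumes "k < z"
  shows "j < n \<Longrightarrow> query_wires n m z i ! (j * z + k) = (i * n + j) * z + k"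
    and "query_wires n m z i ! (n * z + k) = (m * n + i) * z + k"
proof -
  have l: "length [i * n * z..<Suc i * n * z] = n * z" by (simp add: algebra_simps)
  show "query_wires n m z i ! (j * z + k) = (i * n + j) * z + k" if "j < n"
  proof -
    have "j * z + k < n * z" using that assms block_index_less[of j n k z] by simp
    thus ?thesis by (simp add: query_wires_def nth_append l[simplified] algebra_simps)
  qed
  show "query_wires n m z i ! (n * z + k) = (m * n + i) * z + k"
    using assms by (simp add: query_wires_def nth_append l[simplified] algebra_simps)
qed

lemma interval_subset_lessThan: "b \<le> c \<Longrightarrow> {a..<b} \<subseteq> {..<c :: nat}"
  by auto

lemma set_query_wires:
  assumes "i < m"
  shows "set (query_wires n m z i) \<subseteq> {..<(m * n + m) * z}"
proof -
  have "Suc i * n * z \<le> m * n * z" "(m * n + Suc i) * z \<le> (m * n + m) * z"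
    using assms by (intro mult_le_mono; simp)+
  moreover have "m * n * z \<le> (m * n + m) * z" by (intro mult_le_mono) simp_all
  ultimately have "Suc i * n * z \<le> (m * n + m) * z" "(m * n + Suc i) * z \<le> (m * n + m) * z"
    by (blast intro: order_trans)+
  from this[THEN interval_subset_lessThan] have "{i * n * z..<Suc i * n * z} \<subseteq> {..<(m * n + m) * z}"
    "{(m * n + i) * z..<(m * n + Suc i) * z} \<subseteq> {..<(m * n + m) * z}"
    by blast+
  thus ?thesis by (simp only: query_wires_def set_append set_upt Un_subset_iff)
qed

lemma interval_blocks_disjoint:
  fixes i j b :: nat
  assumes "i < j"
  shows "{i * b..<Suc i * b} \<inter> {j * b..<Suc j * b} = {}"
proof -
  have "Suc i * b \<le> j * b" using assms by (intro mult_le_mono1) simp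
  thus ?thesis by auto
qed

lemma query_wires_disjoint:
  assumes "i < j" "j < m"
  shows "set (query_wires n m z i) \<inter> set (query_wires n m z j) = {}"
proof -
  have "{i * (n * z)..<Suc i * (n * z)} \<inter> {j * (n * z)..<Suc j * (n * z)} = {}"
    by (rule interval_blocks_disjoint[OF assms(1)])
  moreover have "{(m * n + i) * z..<Suc (m * n + i) * z} \<inter> {(m * n + j) * z..<Suc (m * n + j) * z} = {}"
    by (rule interval_blocks_disjoint) (use assms in simp)
  moreover have sub: "{l * (n * z)..<Suc l * (n * z)} \<subseteq> {..<m * (n * z)}" if "l < m" for l
  proof -
    have "Suc l * (n * z) \<le> m * (n * z)" using that by (intro mult_le_mono1) simp
    thus ?thesis by (rule interval_subset_lessThan)
  qed
  moreover have "{(m * n + l) * z..<Suc (m * n + l) * z} \<inter> {..<m * (n * z)} = {}" for l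
    by (auto simp: algebra_simps)
  moreover have "i < m" using assms by simp
  moreover have "set (query_wires n m z l) = {l * (n * z)..<Suc l * (n * z)} \<union> {(m * n + l) * z..<Suc (m * n + l) * z}" for l
    by (simp only: query_wires_def set_append set_upt mult.assoc add_Suc_right)
  ultimately show ?thesis using assms(2) by blast
qed

lemma distinct_query_wires: "i < m \<Longrightarrow> distinct (query_wires n m z i)"
proof -
  assume "i < m"
  hence "Suc i * n * z \<le> m * n * z" by (intro mult_le_mono1) simp
  moreover have "m * n * z \<le> (m * n + i) * z" by (intro mult_le_mono1) simp
  ultimately show ?thesis by (auto simp: query_wires_def)
qed

lemma distinct_concat_query_wires:
  assumes "0 < z"
  shows "distinct (concat (map (query_wires n m z) [0..<m]))"
proof (rule distinct_concat)
  have disj: "set (query_wires n m z i) \<inter> set (query_wires n m z j) = {}" if "i < m" "j < m" "i \<noteq> j" for i j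
    using query_wires_disjoint[of i j m n z] query_wires_disjoint[of j i m n z] that by (cases "i < j") auto
  \<comment> \<open>Disjoint lists are distinct as lists only if they are nonempty, which is where
    \<open>0 < z\<close> enters.\<close>
  have ne: "query_wires n m z i \<noteq> []" for i using length_query_wires[of n m z i] assms by auto
  have "inj_on (query_wires n m z) {..<m}"
  proof (rule inj_onI)
    fix i j assume ij: "i \<in> {..<m}" "j \<in> {..<m}" "query_wires n m z i = query_wires n m z j"
    show "i = j"
    proof (rule ccontr)
      assume "i \<noteq> j"
      thus False using disj[of i j] ij ne[of j] by simp
    qed
  qed
  thus "distinct (map (query_wires n m z) [0..<m])" by (simp add: distinct_map atLeast0LessThan)
  fix ws assume "ws \<in> set (map (query_wires n m z) [0..<m])"
  then obtain i where i: "i < m" "ws = query_wires n m z i" by auto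
  thus "distinct ws" by (simp add: distinct_query_wires)
  fix vs assume "vs \<in> set (map (query_wires n m z) [0..<m])" "ws \<noteq> vs"
  then obtain j where "j < m" "vs = query_wires n m z j" by auto
  thus "set ws \<inter> set vs = {}" using disj[of i j] i \<open>ws \<noteq> vs\<close> by blast
qed

lemma length_enc_sample:
  assumes "fst d \<in> zvec q n"
  shows "length (enc_sample q d) = (n + 1) * zlen q"
proof -
  have "length (concat (map (enc_z q) (list_of_vec (fst d)))) = length (map (enc_z q) (list_of_vec (fst d))) * zlen q"
    by (rule length_concat_uniform) auto
  thus ?thesis using zvec_dim[OF assms] by (simp add: enc_sample_def enc_vec_def split_beta)
qed

lemma nth_enc_sample:
  assumes "fst d \<in> zvec q n" "k < zlen q"
  shows "j < n \<Longrightarrow> enc_sample q d ! (j * zlen q + k) = bit (fst d $ j) k"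
    and "enc_sample q d ! (n * zlen q + k) = bit (snd d) k"
proof -
  let ?c = "concat (map (enc_z q) (list_of_vec (fst d)))"
  have dim: "dim_vec (fst d) = n" by (rule zvec_dim[OF assms(1)])
  have "length ?c = length (map (enc_z q) (list_of_vec (fst d))) * zlen q"
    by (rule length_concat_uniform) auto
  hence l: "length ?c = n * zlen q" by (simp add: dim)
  show "enc_sample q d ! (j * zlen q + k) = bit (fst d $ j) k" if "j < n"
  proof -
    have "j * zlen q + k < n * zlen q" using that assms block_index_less[of j n k "zlen q"] by simp
    hence "enc_sample q d ! (j * zlen q + k) = ?c ! (j * zlen q + k)"
      using l by (simp add: enc_sample_def enc_vec_def split_beta nth_append)
    also have "\<dots> = map (enc_z q) (list_of_vec (fst d)) ! j ! k"
      by (rule nth_concat_uniform) (use that assms dim in auto)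
    finally show ?thesis using that assms dim by (simp add: nth_enc_z list_of_vec_index)
  qed
  show "enc_sample q d ! (n * zlen q + k) = bit (snd d) k"
    using assms l by (simp add: enc_sample_def enc_vec_def split_beta nth_append nth_enc_z)
qed

definition loaded :: "nat \<Rightarrow> nat \<Rightarrow> nat \<Rightarrow> nat \<Rightarrow> (int vec \<times> int) list \<Rightarrow> bool list" where
  "loaded n m q w ds = xor_bits (concat (map (query_wires n m (zlen q)) [0..<m])) (concat (map (enc_sample q) ds))
     (replicate w False)"

lemma query_wires_concat_subset:
  "set (concat (map (query_wires n m z) [0..<m])) \<subseteq> {..<(m * n + m) * z}"
proof
  fix p assume "p \<in> set (concat (map (query_wires n m z) [0..<m]))"
  then obtain i where "i < m" "p \<in> set (query_wires n m z i)" by auto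
  thus "p \<in> {..<(m * n + m) * z}" using set_query_wires[of i m n z] by blast
qed

lemma length_loaded [simp]: "length (loaded n m q w ds) = w"
  by (simp add: loaded_def)

lemma run_load:
  assumes "ds \<in> sample_lists n m q" "0 < zlen q" "(m * n + m) * zlen q \<le> w"
  shows "run (map (\<lambda>i. Query (query_wires n m (zlen q) i)) [0..<m] @ is) (map (enc_sample q) ds) (basis (replicate w False))
    = run is [] (basis (loaded n m q w ds))"
proof -
  have len: "length ds = m" using assms(1) by (simp add: sample_lists_def)
  let ?wss = "map (query_wires n m (zlen q)) [0..<m]"
  have "run (map Query ?wss @ is) (map (enc_sample q) ds) (basis (replicate w False)) =
    run is [] (basis (xor_bits (concat ?wss) (concat (map (enc_sample q) ds)) (replicate w False)))"
  proof (rule run_queries)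
    show "length (?wss ! i) = length (map (enc_sample q) ds ! i)" if "i < length ?wss" for i
      using that len length_enc_sample[OF sample_lists_nth(1)[OF assms(1), of i]] by (simp add: length_query_wires)
    show "set (concat ?wss) \<subseteq> {..<length (replicate w False)}"
      using query_wires_concat_subset[of n m "zlen q"] assms(3) by auto
  qed (use len distinct_concat_query_wires[OF assms(2)] in simp_all)
  thus ?thesis by (simp add: loaded_def comp_def)
qed

text \<open>The query lists are disjoint and all wires start at zero, so XOR amounts to writing each
  bit of the answers once; the other wires stay zero.\<close>

lemma nth_loaded:
  assumes ds: "ds \<in> sample_lists n m q" and z: "0 < zlen q" and w: "(m * n + m) * zlen q \<le> w"
  shows "\<And>i j k. i < m \<Longrightarrow> j < n \<Longrightarrow> k < zlen q \<Longrightarrow> loaded n m q w ds ! ((i * n + j) * zlen q + k) = bit (fst (ds ! i) $ j) k"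
    and "\<And>i k. i < m \<Longrightarrow> k < zlen q \<Longrightarrow> loaded n m q w ds ! ((m * n + i) * zlen q + k) = bit (snd (ds ! i)) k"
    and "\<And>p. (m * n + m) * zlen q \<le> p \<Longrightarrow> p < w \<Longrightarrow> \<not> loaded n m q w ds ! p"
proof -
  let ?z = "zlen q"
  let ?ws = "concat (map (query_wires n m ?z) [0..<m])" and ?d = "concat (map (enc_sample q) ds)"
  let ?b = "(n + 1) * ?z"
  have len: "length ds = m" using ds by (simp add: sample_lists_def)
  have lw: "\<forall>x\<in>set (map (query_wires n m ?z) [0..<m]). length x = ?b"
    by (auto simp: length_query_wires simp del: mult_Suc_right)
  have ld: "\<forall>x\<in>set (map (enc_sample q) ds). length x = ?b"
  proof
    fix x assume "x \<in> set (map (enc_sample q) ds)"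
    then obtain i where "i < m" "x = enc_sample q (ds ! i)" using len by (auto simp: in_set_conv_nth)
    thus "length x = ?b" using length_enc_sample[OF sample_lists_nth(1)[OF ds \<open>i < m\<close>]] by simp
  qed
  have lenw: "length ?ws = m * ?b" using length_concat_uniform[OF lw] by simp
  have lend: "length ?d = m * ?b" using length_concat_uniform[OF ld] len by simp
  have sub: "set ?ws \<subseteq> {..<length (replicate w False)}" using query_wires_concat_subset[of n m ?z] w by auto
  note X = nth_xor_bits[OF trans[OF lenw lend[symmetric]] distinct_concat_query_wires[OF z] sub, folded loaded_def]
  have main: "loaded n m q w ds ! (query_wires n m ?z i ! t) = enc_sample q (ds ! i) ! t" if i: "i < m" and t: "t < ?b" for i t
  proof -
    have lt: "i * ?b + t < length ?ws" using i t lenw block_index_less[of i m t ?b] by simp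
    have ws: "?ws ! (i * ?b + t) = query_wires n m ?z i ! t"
      using nth_concat_uniform[OF lw, of i t] i t by simp
    have "?ws ! (i * ?b + t) < w" using nth_mem[OF lt] sub by auto
    hence "loaded n m q w ds ! (?ws ! (i * ?b + t)) = ?d ! (i * ?b + t)" using X lt by simp
    also have "\<dots> = enc_sample q (ds ! i) ! t" using nth_concat_uniform[OF ld, of i t] i t len by simp
    finally show ?thesis unfolding ws .
  qed
  show "loaded n m q w ds ! ((i * n + j) * ?z + k) = bit (fst (ds ! i) $ j) k" if "i < m" "j < n" "k < ?z" for i j k
  proof -
    have "j * ?z + k < n * ?z" using that block_index_less[of j n k ?z] by simp
    hence "j * ?z + k < ?b" by simp
    from main[OF that(1) this] show ?thesis
      using that nth_query_wires(1)[of k ?z j n m i] nth_enc_sample(1)[OF sample_lists_nth(1)[OF ds that(1)] that(3,2)] by simp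
  qed
  show "loaded n m q w ds ! ((m * n + i) * ?z + k) = bit (snd (ds ! i)) k" if "i < m" "k < ?z" for i k
  proof -
    have "n * ?z + k < ?b" using that by simp
    from main[OF that(1) this] show ?thesis
      using that nth_query_wires(2)[of k ?z n m i] nth_enc_sample(2)[OF sample_lists_nth(1)[OF ds that(1)] that(2)] by simp
  qed
  show "\<not> loaded n m q w ds ! p" if p: "(m * n + m) * ?z \<le> p" "p < w" for p
  proof -
    have "p \<notin> set ?ws"
    proof
      assume "p \<in> set ?ws"
      hence "p < (m * n + m) * ?z" using query_wires_concat_subset[of n m ?z] by blast
      thus False using p by simp
    qed
    thus ?thesis using X p by simp
  qed
qed

section \<open>The hash and the output comparison as NAND programs\<close>

text \<open>Column \<open>n\<close> stands for \<open>v\<close>, so that \<open>hash_entry\<close> at \<open>n\<close> is \<open>w\<close>. The inner reduction modulo \<open>q\<close> is the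
  identity on genuine samples; it makes the range assumptions of the adder hold on every list.\<close>

definition column :: "nat \<Rightarrow> nat \<Rightarrow> int vec \<times> int \<Rightarrow> int" where
  "column n j d = (if j < n then fst d $ j else snd d)"

definition hash_entry :: "nat \<Rightarrow> nat \<Rightarrow> nat \<Rightarrow> int \<Rightarrow> int vec \<Rightarrow> nat \<Rightarrow> (int vec \<times> int) list \<Rightarrow> int" where
  "hash_entry n m q y f j ds = ((\<Sum>i<m. f $ i * (column n j (ds ! i) mod int q)) + (if j < n then 0 else y)) mod int q"

lemma hash_entry_eq:
  assumes "ds \<in> sample_lists n m q" "f \<in> zvec 2 m" "0 < q" "j \<le> n"
  shows "hash_entry n m q y f j ds = entries (sample_msg n q y f ds) ! (m * n + m + j)"
proof -
  obtain A v a w where M: "sample_msg n q y f ds = (A, v, a, w)" by (cases "sample_msg n q y f ds")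
  have len: "length ds = m" using assms by (simp add: sample_lists_def)
  have a: "a = mod_vec q (transpose_mat (mat_of_rows n (map fst ds)) *\<^sub>v f)"
    and w: "w = (scalar_prod f (vec_of_list (map snd ds)) + y) mod int q"
    using M by (auto simp: sample_msg_def Let_def)
  have "(A, v, a, w) \<in> messages n m q" using sample_msg_in_messages[OF assms(3,1), of y f] by (simp add: M)
  hence e: "entries (A, v, a, w) ! (m * n + m + j) = (if j < n then a $ j else w)" by (rule nth_entries(3)[OF _ assms(4)])
  have s: "((\<Sum>i<m. f $ i * (column n j (ds ! i) mod int q)) + c) mod int q = ((\<Sum>i<m. f $ i * column n j (ds ! i)) + c) mod int q" for c
  proof -
    have "(\<Sum>i<m. f $ i * (column n j (ds ! i) mod int q)) mod int q = (\<Sum>i<m. f $ i * column n j (ds ! i)) mod int q"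
      by (subst (1 2) mod_sum_eq[symmetric]) (simp add: mod_mult_right_eq)
    thus ?thesis by (rule mod_add_cong[OF _ refl])
  qed
  show ?thesis
  proof (cases "j < n")
    case True
    hence "a $ j = (transpose_mat (mat_of_rows n (map fst ds)) *\<^sub>v f) $ j mod int q"
      unfolding a mod_vec_def by (intro index_map_vec(1)) simp
    also have "\<dots> = (\<Sum>i<m. f $ i * fst (ds ! i) $ j) mod int q"
      unfolding transpose_mult_index[OF len zvec_dim[OF assms(2)] True] ..
    finally have "entries (A, v, a, w) ! (m * n + m + j) = (\<Sum>i<m. f $ i * fst (ds ! i) $ j) mod int q"
      using e True by simp
    thus ?thesis unfolding M hash_entry_def s using True by (simp add: column_def)
  next
    case False
    hence "entries (A, v, a, w) ! (m * n + m + j) = ((\<Sum>i<m. f $ i * snd (ds ! i)) + y) mod int q"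
      using e w unfolding scalar_prod_samples[OF len] by simp
    thus ?thesis unfolding M hash_entry_def s using False by (simp add: column_def)
  qed
qed

text \<open>Three steps make the constants; then each of the n entries of a, and w as the last one,
  takes at most m modular additions.\<close>

definition hash_cost :: "nat \<Rightarrow> nat \<Rightarrow> nat \<Rightarrow> nat" where
  "hash_cost n m z = 3 + Suc n * (m * (22 * Suc z))"

text \<open>The constants are made once, from the first bit of the first sample, and shared by all
  entries. Positive m and z guarantee that this bit exists.\<close>

lemma reaches_hash:
  assumes q: "0 < q" "q \<le> 2 ^ z" and f: "f \<in> zvec 2 m" and pos: "0 < m" "0 < z"
  shows "reaches {\<lambda>ds. bit (column n j (ds ! i) mod int q) k | i j k. i < m \<and> j \<le> n \<and> k < z} (hash_cost n m z)
    {\<lambda>ds. bit (hash_entry n m q y f j ds) k | j k. j \<le> n \<and> k < z}"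
proof -
  let ?G = "{\<lambda>ds. bit (column n j (ds ! i) mod int q) k | i j k. i < m \<and> j \<le> n \<and> k < z}"
  let ?C = "{\<lambda>ds. True, \<lambda>ds. False}"
  let ?T = "\<lambda>j. (\<lambda>k ds. bit (hash_entry n m q y f j ds) k) ` {..<z}"
  have "(\<lambda>ds. bit (column n 0 (ds ! 0) mod int q) 0) \<in> ?G" using pos by blast
  hence 1: "reaches ?G 3 ?C" by (rule reaches_const)
  have 2: "reaches (?G \<union> ?C) (Suc n * (m * (22 * Suc z))) (\<Union>j<Suc n. ?T j)"
  proof (rule reaches_UN)
    fix j assume j: "j < Suc n"
    show "reaches (?G \<union> ?C) (m * (22 * Suc z)) (?T j)"
      unfolding hash_entry_def
    proof (rule reaches_mod_subset_sum)
      show "(\<lambda>ds. bit (column n j (ds ! i) mod int q) k) \<in> ?G \<union> ?C" if "i < m" "k < z" for i k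
        by (rule UnI1, rule CollectI, rule exI[of _ i], rule exI[of _ j], rule exI[of _ k]) (use that j in simp)
      show "f $ i \<in> {0, 1}" if "i < m" for i
        using zvec_nth[OF f that] by (auto simp: zq_def)
      show "int q \<le> 2 ^ z" using q(2) by (metis of_nat_le_iff of_nat_numeral of_nat_power)
    qed (use q in auto)
  qed
  have "{\<lambda>ds. bit (hash_entry n m q y f j ds) k | j k. j \<le> n \<and> k < z} \<subseteq> ?C \<union> (\<Union>j<Suc n. ?T j)"
    by (auto simp: less_Suc_eq_le)
  with reaches_trans[OF 1 2] show ?thesis
    unfolding hash_cost_def by (rule reaches_mono[OF _ subset_refl order_refl])
qed

text \<open>Three steps for the constants, three for each compared bit, and one for the negation
  when s is false.\<close>

lemma reaches_flag:
  assumes "length X = length os" "os \<noteq> []"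
  shows "reaches ((\<lambda>i b. b ! i) ` set os) (4 + 3 * length os) {\<lambda>b. (map ((!) b) os = X) = s}"
proof -
  let ?G = "(\<lambda>i b. b ! i) ` set os :: (bool list \<Rightarrow> bool) set"
  let ?P = "\<lambda>b. \<forall>i<length os. b ! (os ! i) = X ! i"
  have P: "map ((!) b) os = X \<longleftrightarrow> ?P b" for b
    unfolding list_eq_iff_nth_eq using assms(1) by simp
  have "(\<lambda>b. b ! (os ! 0)) \<in> ?G" using assms by (intro imageI) simp
  hence 1: "reaches ?G 3 {\<lambda>b. True, \<lambda>b. False}" by (rule reaches_const)
  have 2: "reaches (?G \<union> {\<lambda>b. True, \<lambda>b. False}) (3 * length os) {?P}"
    by (rule reaches_all[where g = "\<lambda>i b. b ! (os ! i)" and c = "(!) X"]) auto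
  have 3: "reaches ?G (3 + 3 * length os) {?P}"
    by (rule reaches_mono[OF reaches_trans[OF 1 2]]) auto
  show ?thesis
  proof (cases s)
    case True
    thus ?thesis unfolding P by (intro reaches_mono[OF 3]) auto
  next
    case False
    have 4: "reaches (?G \<union> {?P}) 1 {\<lambda>b. \<not> (?P b \<and> ?P b)}"
      unfolding One_nat_def by (rule reaches_nand[where f = ?P and g = ?P]) (auto intro: reaches_refl)
    have "reaches ?G (4 + 3 * length os) {\<lambda>b. \<not> (?P b \<and> ?P b)}"
      by (rule reaches_mono[OF reaches_trans[OF 3 4]]) auto
    thus ?thesis unfolding P using False by simp
  qed
qed

section \<open>The circuit of the adversary\<close>

lemma quantum_circuit_body:
  assumes "quantum_circuit inlen outlen C"
  obtains gs where "body C = map Gate gs" "\<And>g. g \<in> set gs \<Longrightarrow> valid_gate (wires C) g"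
proof -
  have "\<exists>g. i = Gate g" if "i \<in> set (body C)" for i
    using assms that by (cases i) (auto simp: quantum_circuit_def num_queries_def filter_empty_conv)
  hence "\<forall>i\<in>set (body C). i \<in> range Gate" by blast
  hence "\<exists>gs. body C = map Gate gs" using ex_map_conv[of "body C" Gate] by blast
  then obtain gs where gs: "body C = map Gate gs" ..
  moreover have "valid_gate (wires C) g" if "g \<in> set gs" for g
  proof -
    have "Gate g \<in> set (body C)" using that gs by simp
    hence "distinct (instr_wires (Gate g)) \<and> set (instr_wires (Gate g)) \<subseteq> {..<wires C}"
      using assms unfolding quantum_circuit_def oracle_circuit_def by blast
    thus ?thesis by (simp add: valid_gate_def)
  qed
  ultimately show ?thesis by (rule that)
qed

text \<open>A compiled NAND program leaves its results on wires of its own choosing, while Guess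
  expects a and w right behind A and v. So the hash is computed on scratch wires from W on and then
  copied by CNOT gates. The scratch wires stay dirty; those from W + \<open>hash_cost\<close> on
  remain zero for the final comparison.\<close>

lemma message_preparation:
  assumes q2: "2 \<le> q" and f: "f \<in> zvec 2 m" and m: "0 < m"
    and N: "(m * n + m + n + 1) * zlen q \<le> W" and w: "W + hash_cost n m (zlen q) \<le> w"
  obtains gs where "reversible w gs" "length gs \<le> 2 * hash_cost n m (zlen q) + (n + 1) * zlen q"
    "\<And>ds. ds \<in> sample_lists n m q \<Longrightarrow> take W (fold gate_perm gs (loaded n m q w ds)) =
       enc_message q (sample_msg n q y f ds) @ replicate (W - (m * n + m + n + 1) * zlen q) False"
    "\<And>ds p. ds \<in> sample_lists n m q \<Longrightarrow> W + hash_cost n m (zlen q) \<le> p \<Longrightarrow> p < w \<Longrightarrow>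
       \<not> fold gate_perm gs (loaded n m q w ds) ! p"
proof -
  define z where "z = zlen q"
  define k where "k = hash_cost n m z"
  define D where "D = (m * n + m) * z"
  define U where "U = sample_lists n m q"
  let ?b = "loaded n m q w"
  let ?N = "(m * n + m + n + 1) * z"
  have q: "0 < q" using q2 by simp
  have z: "0 < z" unfolding z_def by (rule zlen_pos[OF q2])
  have DN: "?N = D + (n + 1) * z" by (simp add: D_def algebra_simps)
  have NW: "D + (n + 1) * z \<le> W" using N DN by (simp add: z_def)
  have Dw: "D \<le> W" "D \<le> w" using NW w by simp_all
  note load = nth_loaded[where w = w and n = n and m = m and q = q, folded z_def U_def, OF _ z Dw(2)[unfolded D_def], folded D_def]
  let ?G = "{\<lambda>ds. bit (column n j (ds ! i) mod int q) k | i j k. i < m \<and> j \<le> n \<and> k < z}"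
  let ?T = "{\<lambda>ds. bit (hash_entry n m q y f j ds) k | j k. j \<le> n \<and> k < z}"
  have R: "reaches ?G k ?T"
    unfolding k_def by (rule reaches_hash[OF q _ f m z]) (simp add: z_def zlen_bound[OF q])
  have tr: "tracks U ?b {..<D} ?G"
    unfolding tracks_def
  proof
    fix h assume "h \<in> ?G"
    then obtain i j l where h: "h = (\<lambda>ds. bit (column n j (ds ! i) mod int q) l)" "i < m" "j \<le> n" "l < z" by blast
    have mod: "a mod int q = a" if "a \<in> zq q" for a using that by (simp add: zq_def)
    show "\<exists>p\<in>{..<D}. \<forall>u\<in>U. loaded n m q w u ! p = h u"
    proof (cases "j < n")
      case True
      have "(i * n + j) * z + l < m * n * z" by (intro block_index_less) (use h True block_index_less in auto)
      also have "\<dots> \<le> D" unfolding D_def by (intro mult_le_mono1) simp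
      finally have "(i * n + j) * z + l < D" .
      moreover have "loaded n m q w u ! ((i * n + j) * z + l) = h u" if "u \<in> U" for u
        using load(1)[OF that h(2) True h(4)] mod zvec_nth[OF sample_lists_nth(1)[OF that[unfolded U_def] h(2)] True] True
        by (simp add: h(1) column_def)
      ultimately show ?thesis by blast
    next
      case False
      have "(m * n + i) * z + l < D" unfolding D_def by (intro block_index_less) (use h in auto)
      moreover have "loaded n m q w u ! ((m * n + i) * z + l) = h u" if "u \<in> U" for u
        using load(2)[OF that h(2) h(4)] mod sample_lists_nth(2)[OF that[unfolded U_def] h(2)] False
        by (simp add: h(1) column_def)
      ultimately show ?thesis by blast
    qed
  qed
  \<comment> \<open>All wires from D on are zero at this point, but the program gets only those from
    W on: the wires between D and W are the slots of a and w and the zero wires that Guess itself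
    needs.\<close>
  have fr: "fresh_from U ?b W w"
    using load(3) Dw(1) by (simp add: fresh_from_def)
  have sub: "{..<D} \<subseteq> {..<W}" using Dw by auto
  have wk: "W + k \<le> w" using w by (simp add: k_def z_def)
  obtain gs where gs: "length gs \<le> 2 * k" "reversible w gs"
    and T: "tracks U (\<lambda>u. fold gate_perm gs (?b u)) ({..<D} \<union> {W..<W + k}) ?T"
    and fresh: "fresh_from U (\<lambda>u. fold gate_perm gs (?b u)) (W + k) w"
    and old: "\<And>u p. u \<in> U \<Longrightarrow> p < W \<Longrightarrow> fold gate_perm gs (?b u) ! p = ?b u ! p"
    by (rule reversible_of_reaches[OF R tr sub fr wk]) (rule that)
  let ?Q = "{..<D} \<union> {W..<W + k}"
  \<comment> \<open>\<open>tracks\<close> only promises some wire for each result bit; one is picked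
    here. It lies below D or from W on, hence never among the targets of the copying.\<close>
  define src where "src j l = (SOME p. p \<in> ?Q \<and> (\<forall>u\<in>U. fold gate_perm gs (?b u) ! p = bit (hash_entry n m q y f j u) l))" for j l
  have src: "src j l \<in> ?Q \<and> (\<forall>u\<in>U. fold gate_perm gs (?b u) ! src j l = bit (hash_entry n m q y f j u) l)"
    if "j \<le> n" "l < z" for j l
  proof -
    have "(\<lambda>ds. bit (hash_entry n m q y f j ds) l) \<in> ?T" using that by blast
    from bspec[OF T[unfolded tracks_def] this]
    obtain p where "p \<in> ?Q" "\<forall>u\<in>U. fold gate_perm gs (?b u) ! p = bit (hash_entry n m q y f j u) l" by (rule bexE)
    hence "\<exists>p. p \<in> ?Q \<and> (\<forall>u\<in>U. fold gate_perm gs (?b u) ! p = bit (hash_entry n m q y f j u) l)"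
      by (intro exI conjI)
    from someI_ex[OF this] show ?thesis unfolding src_def .
  qed
  have dm: "t div z \<le> n" "t mod z < z" if "t < (n + 1) * z" for t
    using that z less_mult_imp_div_less[of t "n + 1" z] by simp_all
  define ps where "ps = map (\<lambda>t. (src (t div z) (t mod z), D + t)) [0..<(n + 1) * z]"
  have snd_ps: "map snd ps = map ((+) D) [0..<(n + 1) * z]" by (simp add: ps_def comp_def)
  have fst_ps: "set (map fst ps) \<subseteq> ?Q"
  proof
    fix p assume "p \<in> set (map fst ps)"
    then obtain t where t: "t < (n + 1) * z" "p = src (t div z) (t mod z)" by (auto simp: ps_def)
    show "p \<in> ?Q" unfolding t(2) using src[OF dm[OF t(1)]] by (rule conjunct1)
  qed
  have set_snd: "set (map snd ps) = {D..<D + (n + 1) * z}" unfolding snd_ps set_map set_upt by (simp add: add.commute)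
  have disj: "set (map fst ps) \<inter> set (map snd ps) = {}" using fst_ps set_snd NW by fastforce
  have dist: "distinct (map snd ps)" unfolding snd_ps by (simp add: distinct_map)
  have "?Q \<subseteq> {..<w}" using Dw(2) w by (auto simp: k_def z_def)
  hence rev: "reversible w (map (\<lambda>(p, d). Gate_CNOT p d) ps)"
    using disj fst_ps set_snd NW w by (intro reversible_CNOT) auto
  define gs' where "gs' = gs @ map (\<lambda>(p, d). Gate_CNOT p d) ps"
  have copy: "(\<forall>(p, d) \<in> set ps. fold gate_perm gs' (?b u) ! d = (fold gate_perm gs (?b u) ! d \<noteq> fold gate_perm gs (?b u) ! p)) \<and>
     (\<forall>d. d \<notin> set (map snd ps) \<longrightarrow> fold gate_perm gs' (?b u) ! d = fold gate_perm gs (?b u) ! d)" for u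
    unfolding gs'_def fold_append comp_apply
    by (rule fold_CNOT[OF dist disj]) (use set_snd NW w in auto)
  have hashed: "fold gate_perm gs' (?b u) ! (D + t) = bit (hash_entry n m q y f (t div z) u) (t mod z)"
    if u: "u \<in> U" and t: "t < (n + 1) * z" for u t
  proof -
    have "(src (t div z) (t mod z), D + t) \<in> set ps" using t by (auto simp: ps_def)
    hence "fold gate_perm gs' (?b u) ! (D + t) =
      (fold gate_perm gs (?b u) ! (D + t) \<noteq> fold gate_perm gs (?b u) ! src (t div z) (t mod z))"
      using copy[of u] by blast
    moreover have "\<not> fold gate_perm gs (?b u) ! (D + t)"
      using old[OF u, of "D + t"] load(3)[OF u, of "D + t"] t NW w by simp
    ultimately show ?thesis using src[OF dm[OF t]] u by simp
  qed
  have keep: "fold gate_perm gs' (?b u) ! p = fold gate_perm gs (?b u) ! p" if "p < D \<or> D + (n + 1) * z \<le> p" for u p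
  proof -
    have "p \<notin> set (map snd ps)" unfolding set_snd using that by auto
    thus ?thesis using copy[of u] by blast
  qed
  show ?thesis
  proof (rule that[of gs'])
    show "reversible w gs'" using gs(2) rev by (simp add: gs'_def)
    show "length gs' \<le> 2 * hash_cost n m (zlen q) + (n + 1) * zlen q"
      using gs(1) by (simp add: gs'_def ps_def k_def z_def)
    fix ds assume "ds \<in> sample_lists n m q"
    hence ds: "ds \<in> U" by (simp add: U_def)
    show "\<not> fold gate_perm gs' (loaded n m q w ds) ! p" if "W + hash_cost n m (zlen q) \<le> p" "p < w" for p
      using that NW fresh ds keep[of p ds] by (simp add: fresh_from_def k_def z_def)
    obtain A v a c where M: "sample_msg n q y f ds = (A, v, a, c)" by (cases "sample_msg n q y f ds")
    have msg: "(A, v, a, c) \<in> messages n m q"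
      using sample_msg_in_messages[OF q ds[unfolded U_def], of y f] by (simp add: M)
    have len: "length ds = m" using ds by (simp add: U_def sample_lists_def)
    have Av: "A = mat_of_rows n (map fst ds)" "v = vec_of_list (map snd ds)" using M by (auto simp: sample_msg_def Let_def)
    let ?e = "enc_message q (A, v, a, c)"
    have le: "length ?e = D + (n + 1) * z" using length_enc_message[OF msg] DN by (simp add: z_def)
    show "take W (fold gate_perm gs' (loaded n m q w ds)) =
       enc_message q (sample_msg n q y f ds) @ replicate (W - (m * n + m + n + 1) * zlen q) False"
      unfolding M
    proof (rule nth_equalityI)
      show "length (take W (fold gate_perm gs' (loaded n m q w ds))) =
        length (?e @ replicate (W - (m * n + m + n + 1) * zlen q) False)"
        using le NW w DN by (simp add: z_def)
      fix p assume "p < length (take W (fold gate_perm gs' (loaded n m q w ds)))"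
      hence p: "p < W" by simp
      consider "p < D" | "D \<le> p" "p < D + (n + 1) * z" | "D + (n + 1) * z \<le> p" by linarith
      hence "fold gate_perm gs' (?b ds) ! p = (?e @ replicate (W - (m * n + m + n + 1) * zlen q) False) ! p"
      proof cases
        case 1
        define e l where "e = p div z" and "l = p mod z"
        have pe: "p = e * z + l" "l < z" using z by (simp_all add: e_def l_def)
        have e: "e < m * n + m" using 1 unfolding D_def e_def by (rule less_mult_imp_div_less)
        have "?e ! p = bit (entries (A, v, a, c) ! e) l"
          using nth_enc_message[OF msg, of e l] e pe by (simp add: z_def)
        moreover have "?b ds ! p = bit (entries (A, v, a, c) ! e) l"
        proof (cases "e < m * n")
          case True
          hence "0 < n" by (cases n) simp_all
          define i j where "i = e div n" and "j = e mod n"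
          have ij: "e = i * n + j" "i < m" "j < n"
            using True \<open>0 < n\<close> by (simp_all add: i_def j_def less_mult_imp_div_less)
          have "entries (A, v, a, c) ! e = fst (ds ! i) $ j"
            unfolding ij(1) nth_entries(1)[OF msg ij(2,3)] using ij len by (simp add: Av mat_of_rows_index)
          thus ?thesis using load(1)[OF ds ij(2,3) pe(2)] by (simp add: pe(1) ij(1))
        next
          case False
          define i where "i = e - m * n"
          have i: "e = m * n + i" "i < m" using False e by (simp_all add: i_def)
          have "entries (A, v, a, c) ! e = snd (ds ! i)"
            unfolding i(1) nth_entries(2)[OF msg i(2)] using i len by (simp add: Av vec_of_list_index del: vec_of_list_map)
          thus ?thesis using load(2)[OF ds i(2) pe(2)] by (simp add: pe(1) i(1))
        qed
        ultimately show ?thesis using keep[of p ds] old[OF ds p] 1 le by (simp add: nth_append)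
      next
        case 2
        define t where "t = p - D"
        have t: "p = D + t" "t < (n + 1) * z" using 2 by (simp_all add: t_def)
        have "p = (m * n + m + t div z) * z + t mod z" unfolding t(1) D_def by (simp add: algebra_simps)
        hence "?e ! p = bit (entries (A, v, a, c) ! (m * n + m + t div z)) (t mod z)"
          using nth_enc_message[OF msg, of "m * n + m + t div z" "t mod z"] dm[OF t(2)] by (simp add: z_def)
        moreover have "hash_entry n m q y f (t div z) ds = entries (A, v, a, c) ! (m * n + m + t div z)"
          using hash_entry_eq[OF ds[unfolded U_def] f q dm(1)[OF t(2)]] by (simp add: M)
        ultimately show ?thesis using hashed[OF ds t(2)] 2 le by (simp add: nth_append t(1))
      next
        case 3
        thus ?thesis using keep[of p ds] old[OF ds p] load(3)[OF ds, of p] p w le DN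
          by (simp add: nth_append z_def)
      qed
      thus "take W (fold gate_perm gs' (loaded n m q w ds)) ! p =
        (?e @ replicate (W - (m * n + m + n + 1) * zlen q) False) ! p" using p by simp
    qed
  qed
qed

text \<open>The circuit answers s if Guess outputs x and the opposite bit otherwise. In the size
  bound the factor 3 stands for one scratch wire and two gates per NAND step; the remaining terms
  are the m queries and the CNOT gates that copy a and w.\<close>

lemma lwe_adversary:
  assumes q2: "2 \<le> q" and f: "f \<in> zvec 2 m" and m: "0 < m"
    and C0: "quantum_circuit ((m * n + m + n + 1) * zlen q) (zlen q) C0"
  obtains C where "oracle_circuit 0 ((n + 1) * zlen q) 1 C" "num_queries C = m"
    "circuit_size C \<le> circuit_size C0 + m + 3 * hash_cost n m (zlen q) + (n + 1) * zlen q + 3 * (4 + 3 * zlen q)"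
    "\<And>ds \<beta>. ds \<in> sample_lists n m q \<Longrightarrow> out_prob C [] (map (enc_sample q) ds) [\<beta>] =
       (if \<beta> = s then guess_prob q C0 (sample_msg n q y f ds) x else 1 - guess_prob q C0 (sample_msg n q y f ds) x)"
proof -
  define z where "z = zlen q"
  define k where "k = hash_cost n m z"
  define k' where "k' = 4 + 3 * z"
  define W where "W = wires C0"
  define w where "w = W + k + k'"
  define X where "X = enc_z q x"
  have q: "0 < q" using q2 by simp
  have z: "0 < z" unfolding z_def by (rule zlen_pos[OF q2])
  let ?N = "(m * n + m + n + 1) * z"
  have os: "distinct (outs C0)" "set (outs C0) \<subseteq> {..<W}" "length (outs C0) = z" and NW: "?N \<le> W"
    using C0 by (simp_all add: quantum_circuit_def oracle_circuit_def W_def z_def)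
  obtain gs0 where gs0: "body C0 = map Gate gs0" "\<And>g. g \<in> set gs0 \<Longrightarrow> valid_gate W g"
    using quantum_circuit_body[OF C0] unfolding W_def by metis
  have wk1: "W + k \<le> w" by (simp add: w_def)
  obtain gs1 where gs1: "reversible w gs1" "length gs1 \<le> 2 * k + (n + 1) * z"
    and msg: "\<And>ds. ds \<in> sample_lists n m q \<Longrightarrow> take W (fold gate_perm gs1 (loaded n m q w ds)) =
       enc_message q (sample_msg n q y f ds) @ replicate (W - ?N) False"
    and fresh: "\<And>ds p. ds \<in> sample_lists n m q \<Longrightarrow> W + k \<le> p \<Longrightarrow> p < w \<Longrightarrow>
       \<not> fold gate_perm gs1 (loaded n m q w ds) ! p"
    by (rule message_preparation[where y = y, OF q2 f m NW[unfolded z_def] wk1[unfolded k_def z_def],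
          folded z_def, folded k_def]) (rule that)
  \<comment> \<open>Guess leaves a superposition, so the comparison is compiled for every basis
    string whose last k' wires are zero, not only for strings that come from samples.\<close>
  define U where "U = {b. length b = w \<and> (\<forall>p. W + k \<le> p \<longrightarrow> p < w \<longrightarrow> \<not> b ! p)}"
  let ?flag = "\<lambda>b. (map ((!) b) (outs C0) = X) = s"
  have ne: "outs C0 \<noteq> []" using os(3) z by auto
  have R: "reaches ((\<lambda>i b. b ! i) ` set (outs C0)) k' {?flag}"
    using reaches_flag[of X "outs C0" s, OF _ ne] os(3) by (simp add: k'_def X_def z_def)
  have tr: "tracks U (\<lambda>b. b) {..<W} ((\<lambda>i b. b ! i) ` set (outs C0))"
    unfolding tracks_def using os(2) by blast
  have fr: "fresh_from U (\<lambda>b. b) (W + k) w" by (simp add: fresh_from_def U_def)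
  have sub: "{..<W} \<subseteq> {..<W + k}" by auto
  have wk: "W + k + k' \<le> w" by (simp add: w_def)
  obtain gs2 where gs2: "length gs2 \<le> 2 * k'" "reversible w gs2"
    and T: "tracks U (\<lambda>b. fold gate_perm gs2 b) ({..<W} \<union> {W + k..<W + k + k'}) {?flag}"
    by (rule reversible_of_reaches[OF R tr sub fr wk]) (rule that)
  from bspec[OF T[unfolded tracks_def] singletonI]
  obtain p where p1: "p \<in> {..<W} \<union> {W + k..<W + k + k'}" and p2: "\<forall>b\<in>U. fold gate_perm gs2 b ! p = ?flag b"
    by (rule bexE)
  note p = p1 bspec[OF p2]
  have pw: "p < w" using p(1) by (auto simp: w_def)
  let ?queries = "map (\<lambda>i. Query (query_wires n m z i)) [0..<m]"
  define C where "C = Circuit w (?queries @ map Gate gs1 @ map Gate gs0 @ map Gate gs2) [p]"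
  have valid0: "valid_gate w g" if "g \<in> set gs0" for g
  proof -
    have "distinct (gate_wires g)" and "set (gate_wires g) \<subseteq> {..<W}"
      using gs0(2)[OF that] by (simp_all add: valid_gate_def)
    moreover have "{..<W} \<subseteq> {..<w}" by (auto simp: w_def)
    ultimately show ?thesis unfolding valid_gate_def by (meson order_trans)
  qed
  have DW: "(m * n + m) * z \<le> W"
  proof -
    have "(m * n + m) * z \<le> ?N" by (intro mult_le_mono1) simp
    thus ?thesis using NW by simp
  qed
  show ?thesis
  proof (rule that[of C])
    show "num_queries C = m"
      by (simp add: C_def num_queries_def filter_map comp_def)
    show "circuit_size C \<le> circuit_size C0 + m + 3 * hash_cost n m (zlen q) + (n + 1) * zlen q + 3 * (4 + 3 * zlen q)"
      using gs1(2) gs2(1) gs0(1) unfolding z_def[symmetric] k_def[symmetric] k'_def[symmetric]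
      by (simp add: circuit_size_def C_def w_def W_def)
    show "oracle_circuit 0 ((n + 1) * zlen q) 1 C"
      unfolding oracle_circuit_def z_def[symmetric]
    proof (intro conjI ballI allI impI)
      fix i assume "i \<in> set (body C)"
      then consider j where "j < m" "i = Query (query_wires n m z j)" | g where "i = Gate g" "valid_gate w g"
        using gs1(1) gs2(2) valid0 by (auto simp: C_def reversible_def)
      hence "distinct (instr_wires i) \<and> set (instr_wires i) \<subseteq> {..<w}"
      proof cases
        case (1 j)
        have "set (query_wires n m z j) \<subseteq> {..<w}" using set_query_wires[OF 1(1), of n z] DW by (auto simp: w_def)
        thus ?thesis using 1 distinct_query_wires by simp
      next
        case (2 g)
        thus ?thesis by (simp add: valid_gate_def)
      qed
      thus "distinct (instr_wires i)" "set (instr_wires i) \<subseteq> {..<wires C}" by (simp_all add: C_def)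
    next
      fix ws assume "Query ws \<in> set (body C)"
      then obtain j where "ws = query_wires n m z j" by (auto simp: C_def)
      thus "length ws = (n + 1) * z" using length_query_wires by simp
    qed (use pw in \<open>simp_all add: C_def\<close>)
    fix ds \<beta> assume ds: "ds \<in> sample_lists n m q"
    define c where "c = fold gate_perm gs1 (loaded n m q w ds)"
    define r where "r = drop W c"
    have lc: "length c = w" by (simp add: c_def)
    have lr: "W + length r = w" using lc by (simp add: r_def w_def)
    have rne: "r \<noteq> []" using lc by (simp add: r_def w_def k'_def)
    let ?M = "sample_msg n q y f ds"
    \<comment> \<open>The first W wires carry the encoded message followed by zeros, which is
      precisely the initial state of Guess on this message.\<close>
    have tk: "take W c = enc_message q ?M @ replicate (W - length (enc_message q ?M)) False"
      using msg[OF ds] length_enc_message[OF sample_msg_in_messages[OF q ds]] by (simp add: c_def z_def)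
    have ini: "basis (take W c) = init_state W (enc_message q ?M)"
      unfolding tk by (simp add: basis_def init_state_def)
    define \<psi> where "\<psi> = fold apply_gate gs0 (init_state W (enc_message q ?M))"
    have "init_state w [] = basis (replicate w False)" by (simp add: init_state_def basis_def)
    hence "run (body C) (map (enc_sample q) ds) (init_state w []) =
      run (map Gate gs1 @ map Gate gs0 @ map Gate gs2) [] (basis (loaded n m q w ds))"
      using run_load[OF ds _ , of w "map Gate gs1 @ map Gate gs0 @ map Gate gs2"] z DW
      by (simp add: C_def z_def w_def)
    also have "\<dots> = run (map Gate gs2 @ []) [] (fold apply_gate gs0 (basis c))"
      using fold_apply_gate_basis[of "loaded n m q w ds" gs1] gs1(1) by (simp add: run_gates c_def)
    also have "\<dots> = fold apply_gate gs2 (fold apply_gate gs0 (basis c))" by (simp only: run_gates run.simps)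
    also have "basis c = attach W r (init_state W (enc_message q ?M))"
      using basis_append[of "take W c" W r] lc ini by (simp add: r_def w_def)
    also have "fold apply_gate gs0 \<dots> = attach W r \<psi>"
      unfolding \<psi>_def by (rule fold_apply_gate_attach[OF gs0(2) rne])
    finally have fin: "run (body C) (map (enc_sample q) ds) (init_state w []) = fold apply_gate gs2 (attach W r \<psi>)" .
    have flag: "fold gate_perm gs2 (d @ r) ! p = ?flag d" if "length d = W" for d
    proof -
      have "\<not> (d @ r) ! p" if "W + k \<le> p" "p < w" for p
      proof -
        have "(d @ r) ! p = c ! p" using that \<open>length d = W\<close> lc by (simp add: nth_append r_def)
        thus ?thesis using fresh[OF ds that] by (simp add: c_def)
      qed
      hence U: "d @ r \<in> U" using that lr by (simp add: U_def)
      have eq: "map ((!) (d @ r)) (outs C0) = map ((!) d) (outs C0)"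
        using os(2) that by (intro map_cong refl) (auto simp: nth_append)
      show ?thesis using p(2)[OF U] unfolding eq .
    qed
    have "out_prob C [] (map (enc_sample q) ds) [\<beta>] =
      (\<Sum>b | length b = W + length r \<and> b ! p = \<beta>. (cmod (fold apply_gate gs2 (attach W r \<psi>) b))\<^sup>2)"
      using fin by (simp add: out_prob_def C_def lr)
    also have "\<dots> = (\<Sum>d | length d = W \<and> ?flag d = \<beta>. (cmod (\<psi> d))\<^sup>2)"
      by (rule measure_flag) (use gs2(2) lr flag in auto)
    finally have out: "out_prob C [] (map (enc_sample q) ds) [\<beta>] = (\<Sum>d | length d = W \<and> ?flag d = \<beta>. (cmod (\<psi> d))\<^sup>2)" .
    have "run (map Gate gs0 @ []) [] (init_state W (enc_message q ?M)) = \<psi>"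
      by (simp only: run_gates run.simps \<psi>_def)
    hence g: "guess_prob q C0 ?M x = (\<Sum>d | length d = W \<and> map ((!) d) (outs C0) = X. (cmod (\<psi> d))\<^sup>2)"
      by (simp add: guess_prob_def out_prob_def gs0(1) W_def[symmetric] X_def)
    have "length (take W c) = W" using lc by (simp add: w_def)
    hence "norm_sq W (init_state W (enc_message q ?M)) = 1" unfolding ini[symmetric] by (rule norm_sq_basis)
    \<comment> \<open>Unitarity keeps the total weight at 1, so all outcomes other than the encoding
      of x together have the complementary probability.\<close>
    hence norm: "norm_sq W \<psi> = 1" unfolding \<psi>_def using norm_sq_fold_apply_gate[of gs0 W] gs0(2) by simp
    have "norm_sq W \<psi> = (\<Sum>d \<in> {d. length d = W \<and> map ((!) d) (outs C0) = X} \<union> {d. length d = W \<and> map ((!) d) (outs C0) \<noteq> X}. (cmod (\<psi> d))\<^sup>2)"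
      unfolding norm_sq_def by (rule sum.cong) auto
    also have "\<dots> = guess_prob q C0 ?M x + (\<Sum>d | length d = W \<and> map ((!) d) (outs C0) \<noteq> X. (cmod (\<psi> d))\<^sup>2)"
      unfolding g by (rule sum.union_disjoint) auto
    finally have co: "(\<Sum>d | length d = W \<and> map ((!) d) (outs C0) \<noteq> X. (cmod (\<psi> d))\<^sup>2) = 1 - guess_prob q C0 ?M x"
      using norm by simp
    show "out_prob C [] (map (enc_sample q) ds) [\<beta>] = (if \<beta> = s then guess_prob q C0 ?M x else 1 - guess_prob q C0 ?M x)"
    proof (cases "\<beta> = s")
      case True
      hence "{d. length d = W \<and> ?flag d = \<beta>} = {d. length d = W \<and> map ((!) d) (outs C0) = X}" by auto
      thus ?thesis unfolding out g using True by simp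
    next
      case False
      hence "{d. length d = W \<and> ?flag d = \<beta>} = {d. length d = W \<and> map ((!) d) (outs C0) \<noteq> X}" by auto
      thus ?thesis unfolding out co[symmetric] using False by (simp only: if_False)
    qed
  qed
qed

section \<open>Asymptotics and conclusion\<close>

text \<open>For the hidden bit \<beta> the answer is right with the mean of p if \<beta> = s, and
  with 1 minus that mean otherwise. Averaging over the fair bit leaves 1/2 plus half the difference
  of the views, oriented by s.\<close>

lemma lwe_success_eq:
  assumes q: "0 < q"
    and nq: "num_queries C = m"
    and out: "\<And>ds \<beta>. ds \<in> sample_lists n m q \<Longrightarrow> out_prob C [] (map (enc_sample q) ds) [\<beta>] =
      (if \<beta> = s then p (sample_msg n q y f ds) else 1 - p (sample_msg n q y f ds))"
  shows "lwe_success n q \<chi> C = 1 / 2 +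
    (if s then lwe_view n m q \<chi> p y f True - lwe_view n m q \<chi> p y f False
     else lwe_view n m q \<chi> p y f False - lwe_view n m q \<chi> p y f True) / 2"
proof -
  let ?Z = "pmf_of_set (zvec q n)"
  let ?R = "\<lambda>\<beta> s. replicate_pmf m (lwe_oracle n q \<chi> \<beta> s)"
  let ?o = "\<lambda>\<beta> ds. out_prob C [] (map (enc_sample q) ds) [\<beta>]"
  have ne: "zvec q n \<noteq> {}" by (rule zvec_nonempty[OF q])
  have set_Z: "set_pmf ?Z = zvec q n" using ne by simp
  have finR: "finite (set_pmf (?R \<beta> s))" if "s \<in> zvec q n" for \<beta> s by (rule finite_lwe_samples[OF q that])
  define E where "E \<beta> = measure_pmf.expectation ?Z (\<lambda>s. measure_pmf.expectation (?R \<beta> s) (?o \<beta>))" for \<beta>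
  have inner: "measure_pmf.expectation (bind_pmf ?Z (\<lambda>s. map_pmf (Pair \<beta>) (?R \<beta> s)))
      (\<lambda>(\<beta>, ds). ?o \<beta> ds) = E \<beta>" for \<beta>
    using finR set_Z by (subst expectation_bind_pmf_finite) (simp_all add: E_def)
  have "lwe_success n q \<chi> C = measure_pmf.expectation
    (bind_pmf (pmf_of_set (UNIV :: bool set)) (\<lambda>\<beta>. bind_pmf ?Z (\<lambda>s. map_pmf (Pair \<beta>) (?R \<beta> s)))) (\<lambda>(\<beta>, ds). ?o \<beta> ds)"
    unfolding lwe_success_def nq map_pmf_def ..
  also have "\<dots> = measure_pmf.expectation (pmf_of_set (UNIV :: bool set)) E"
    using finR set_Z by (subst expectation_bind_pmf_finite) (simp_all add: inner)
  also have "\<dots> = (E True + E False) / 2"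
    by (simp add: integral_pmf_of_set UNIV_bool)
  finally have succ: "lwe_success n q \<chi> C = (E True + E False) / 2" .
  have E_eq: "E \<beta> = (if \<beta> = s then lwe_view n m q \<chi> p y f \<beta> else 1 - lwe_view n m q \<chi> p y f \<beta>)" for \<beta>
  proof -
    have "E \<beta> = measure_pmf.expectation ?Z (\<lambda>s'. if \<beta> = s
        then measure_pmf.expectation (?R \<beta> s') (\<lambda>ds. p (sample_msg n q y f ds))
        else 1 - measure_pmf.expectation (?R \<beta> s') (\<lambda>ds. p (sample_msg n q y f ds)))"
      unfolding E_def
    proof (rule expectation_pmf_cong)
      fix s' assume "s' \<in> set_pmf ?Z"
      hence s': "s' \<in> zvec q n" by (simp add: set_Z)
      have "measure_pmf.expectation (?R \<beta> s') (?o \<beta>) = measure_pmf.expectation (?R \<beta> s')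
          (\<lambda>ds. if \<beta> = s then p (sample_msg n q y f ds) else 1 - p (sample_msg n q y f ds))"
        using set_lwe_samples[OF q s', of m \<chi> \<beta>] out by (intro expectation_pmf_cong) blast
      moreover have I: "integrable (measure_pmf (?R \<beta> s')) h" for h :: "_ \<Rightarrow> real"
        by (rule integrable_measure_pmf_finite[OF finR[OF s']])
      ultimately show "measure_pmf.expectation (?R \<beta> s') (?o \<beta>) = (if \<beta> = s
        then measure_pmf.expectation (?R \<beta> s') (\<lambda>ds. p (sample_msg n q y f ds))
        else 1 - measure_pmf.expectation (?R \<beta> s') (\<lambda>ds. p (sample_msg n q y f ds)))"
        by (cases "\<beta> = s") (simp, simp add: Bochner_Integration.integral_diff[OF I I])
    qed
    moreover have I: "integrable (measure_pmf ?Z) h" for h :: "_ \<Rightarrow> real"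
      by (rule integrable_measure_pmf_finite) (simp add: set_Z)
    ultimately show ?thesis by (simp add: lwe_view_def Bochner_Integration.integral_diff[OF I I])
  qed
  show ?thesis unfolding succ E_eq by (cases s) (simp_all add: field_simps)
qed

section \<open>Negligible and polynomially bounded functions\<close>

lemma negl_add: "negl f \<Longrightarrow> negl g \<Longrightarrow> negl (\<lambda>l. f l + g l)"
  by (auto simp: negl_def intro: sum_in_bigo)

lemma negl_cmult: "negl f \<Longrightarrow> 0 \<le> c \<Longrightarrow> negl (\<lambda>l. c * f l)"
  by (auto simp: negl_def)

lemma negl_exponential: "negl (\<lambda>l. real l ^ k * 2 powr (- real l / 2))"
  unfolding negl_def
proof (intro conjI allI impI)
  fix C :: real
  show "(\<lambda>l. real l ^ k * 2 powr (- real l / 2)) \<in> O(\<lambda>l. real l powr - C)"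
    by real_asymp
qed simp

lemma negl_poly_exponential:
  assumes "poly_bounded f" "\<And>l. 0 \<le> f l"
  shows "negl (\<lambda>l. f l * 2 powr (- real l / 2))"
  unfolding negl_def
proof (intro conjI allI impI)
  fix C :: real assume "C > 0"
  obtain k where "f \<in> O(\<lambda>l. real l ^ k)" using assms(1) by (auto simp: poly_bounded_def)
  hence "(\<lambda>l. f l * 2 powr (- real l / 2)) \<in> O(\<lambda>l. real l ^ k * 2 powr (- real l / 2))"
    by (intro landau_o.big.mult) auto
  also have "(\<lambda>l. real l ^ k * 2 powr (- real l / 2)) \<in> O(\<lambda>l. real l powr - C)"
    using negl_exponential[of k] \<open>C > 0\<close> by (simp add: negl_def)
  finally show "(\<lambda>l. f l * 2 powr (- real l / 2)) \<in> O(\<lambda>l. real l powr - C)" .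
qed (use assms(2) in auto)

lemma poly_bounded_mult: "poly_bounded f \<Longrightarrow> poly_bounded g \<Longrightarrow> poly_bounded (\<lambda>l. f l * g l)"
  unfolding poly_bounded_def
proof (elim exE)
  fix a b assume "f \<in> O(\<lambda>l. real l ^ a)" "g \<in> O(\<lambda>l. real l ^ b)"
  from landau_o.big.mult[OF this] show "\<exists>k. (\<lambda>l. f l * g l) \<in> O(\<lambda>l. real l ^ k)"
    by (intro exI[of _ "a + b"]) (simp add: power_add)
qed

lemma bigo_power_mono: "a \<le> b \<Longrightarrow> (\<lambda>l. real l ^ a) \<in> O(\<lambda>l. real l ^ b)"
proof (rule landau_o.big_mono)
  assume "a \<le> b"
  show "\<forall>\<^sub>F l in sequentially. norm (real l ^ a) \<le> norm (real l ^ b)"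
    using eventually_ge_at_top[of 1]
  proof eventually_elim
    case (elim l)
    thus ?case using \<open>a \<le> b\<close> by (simp add: power_increasing)
  qed
qed

lemma poly_bounded_add: "poly_bounded f \<Longrightarrow> poly_bounded g \<Longrightarrow> poly_bounded (\<lambda>l. f l + g l)"
  unfolding poly_bounded_def
proof (elim exE)
  fix a b assume "f \<in> O(\<lambda>l. real l ^ a)" "g \<in> O(\<lambda>l. real l ^ b)"
  moreover have "(\<lambda>l. real l ^ a) \<in> O(\<lambda>l. real l ^ (max a b))" "(\<lambda>l. real l ^ b) \<in> O(\<lambda>l. real l ^ (max a b))"
    by (rule bigo_power_mono; simp)+
  ultimately show "\<exists>k. (\<lambda>l. f l + g l) \<in> O(\<lambda>l. real l ^ k)"
    by (intro exI[of _ "max a b"] sum_in_bigo) (blast intro: landau_o.big_trans)+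
qed

lemma poly_bounded_const: "poly_bounded (\<lambda>l. c)"
  unfolding poly_bounded_def by (rule exI[of _ 0]) simp

lemma poly_bounded_ident: "poly_bounded real"
  unfolding poly_bounded_def by (rule exI[of _ 1]) simp

lemma poly_bounded_le:
  assumes "poly_bounded g" "\<And>l. l \<ge> 1 \<Longrightarrow> \<bar>f l\<bar> \<le> g l"
  shows "poly_bounded f"
proof -
  obtain k where k: "g \<in> O(\<lambda>l. real l ^ k)" using assms(1) by (auto simp: poly_bounded_def)
  have "\<forall>\<^sub>F l in sequentially. norm (f l) \<le> norm (g l)"
    using eventually_ge_at_top[of 1] by eventually_elim (use assms(2) in force)
  hence "f \<in> O(g)" by (rule landau_o.big_mono)
  thus ?thesis using k unfolding poly_bounded_def by (blast intro: landau_o.big_trans)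
qed

lemma lwe_hard_imp_negl:
  assumes hard: "lwe_hard n q \<chi>" and C: "poly_size C"
    "\<And>l. l \<ge> 1 \<Longrightarrow> oracle_circuit 0 ((n l + 1) * zlen (q l)) 1 (C l)"
    and d: "\<And>l. l \<ge> 1 \<Longrightarrow> lwe_success (n l) (q l) (\<chi> l) (C l) = 1 / 2 + d l / 2"
  obtains \<epsilon> where "negl \<epsilon>" "\<And>l. l \<ge> 1 \<Longrightarrow> d l \<le> 2 * \<epsilon> l"
proof -
  obtain \<epsilon> where e: "negl \<epsilon>" "\<forall>l\<ge>1. lwe_success (n l) (q l) (\<chi> l) (C l) \<le> 1 / 2 + \<epsilon> l"
    using hard C unfolding lwe_hard_def by blast
  have "d l \<le> 2 * \<epsilon> l" if "l \<ge> 1" for l using e(2) d[OF that] that by force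
  thus ?thesis using that e(1) by blast
qed

theorem theorem6p3:
  fixes n m q Q :: "nat \<Rightarrow> nat" and \<sigma> \<tau> :: "nat \<Rightarrow> real"
    and tlen :: "nat \<Rightarrow> nat"
    and GenTrap :: "nat \<Rightarrow> (int mat \<times> bool list) pmf"
    and Invert :: "nat \<Rightarrow> int mat \<Rightarrow> int vec \<Rightarrow> bool list \<Rightarrow> int vec"
    and Guess :: "nat \<Rightarrow> circuit"
    and x y :: "nat \<Rightarrow> int"
  assumes log_q: "poly_bounded (\<lambda>l. log 2 (real (q l)))"
    and log_\<sigma>: "poly_bounded (\<lambda>l. log 2 (\<sigma> l))"
    and \<sigma>_ge_1: "\<And>l. l \<ge> 1 \<Longrightarrow> \<sigma> l \<ge> 1"
    and q_prime: "\<And>l. l \<ge> 1 \<Longrightarrow> prime (q l) \<and> odd (q l)"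
    and Q_eq: "\<And>l. l \<ge> 1 \<Longrightarrow> int (Q l) = \<lceil>log 2 (real (q l))\<rceil>"
    and n_eq: "\<And>l. l \<ge> 1 \<Longrightarrow> n l = l"
    and m_eq: "\<And>l. l \<ge> 1 \<Longrightarrow> m l = n l * (2 * Q l + 1)"
    and \<tau>_eq: "\<And>l. l \<ge> 1 \<Longrightarrow> \<tau> l = real (q l) / (4 * real (m l) * real (Q l))"
    and \<tau>_ge: "\<And>l. l \<ge> 1 \<Longrightarrow> \<tau> l \<ge> 2 * real (m l) * \<sigma> l"
    and gentrap: "gentrap_algorithm n m q tlen GenTrap"
    and invert: "invert_algorithm n m q tlen Invert"
    and gentrap_uniform: "\<And>l. l \<ge> 1 \<Longrightarrow>
      stat_dist (map_pmf fst (GenTrap l)) (pmf_of_set (zmat (q l) (m l) (n l)))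
        \<le> real (n l) * real (Q l) * 2 powr (- real (n l) / 2)"
    and invert_correct: "\<And>l A t s e. \<lbrakk>l \<ge> 1; (A, t) \<in> set_pmf (GenTrap l); s \<in> zvec (q l) (n l);
      e \<in> zvec (q l) (m l); real_of_int (norm_inf (q l) e) \<le> 2 * \<tau> l\<rbrakk> \<Longrightarrow>
      Invert l A (mod_vec (q l) (A *\<^sub>v s + e)) t = s"
    and guess: "guess_algorithm n m q Guess"
    and hard: "lwe_hard n q (\<lambda>l. dgauss_trunc (\<sigma> l) (\<tau> l))"
    and x: "\<And>l. l \<ge> 1 \<Longrightarrow> x l \<in> zq (q l)"
    and y: "\<And>l. l \<ge> 1 \<Longrightarrow> y l \<in> zq (q l)"
  shows "\<exists>\<epsilon>. negl \<epsilon> \<and> (\<forall>l\<ge>1.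
    \<bar>guess_prob_on (q l) (Guess l)
        (client_dist (n l) (m l) (q l) (dgauss_trunc (\<sigma> l) (\<tau> l)) (GenTrap l) (y l)) (x l)
      - guess_prob_on (q l) (Guess l) (uniform_dist (n l) (m l) (q l)) (x l)\<bar> \<le> \<epsilon> l)"
proof -
  let ?\<chi> = "\<lambda>l. dgauss_trunc (\<sigma> l) (\<tau> l)"
  define z where "z l = zlen (q l)" for l
  define p where "p l M = guess_prob (q l) (Guess l) M (x l)" for l M
  define V where "V l f \<beta> = lwe_view (n l) (m l) (q l) (?\<chi> l) (p l) (y l) f \<beta>" for l f \<beta>
  let ?D = "\<lambda>l. measure_pmf.expectation (client_dist (n l) (m l) (q l) (?\<chi> l) (GenTrap l) (y l)) (p l)
    - measure_pmf.expectation (uniform_dist (n l) (m l) (q l)) (p l)"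
  have q2: "2 \<le> q l" if "l \<ge> 1" for l using q_prime[OF that] prime_ge_2_nat by blast
  have Qz: "Q l = z l" if "l \<ge> 1" for l
    using Q_eq[OF that] by (simp add: z_def zlen_def flip: nat_int)
  have z_pos: "0 < z l" if "l \<ge> 1" for l unfolding z_def by (rule zlen_pos[OF q2[OF that]])
  have m: "m l = l * (2 * z l + 1)" if "l \<ge> 1" for l using m_eq[OF that] n_eq[OF that] Qz[OF that] by simp
  have m_pos: "0 < m l" if "l \<ge> 1" for l using m[OF that] that by simp
  have poly_z: "poly_bounded (\<lambda>l. real (z l))"
  proof (rule poly_bounded_le)
    show "poly_bounded (\<lambda>l. log 2 (real (q l)) + 1)" by (intro poly_bounded_add log_q poly_bounded_const)
    fix l :: nat assume "l \<ge> 1"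
    hence "0 \<le> log 2 (real (q l))" using q2[of l] by simp
    thus "\<bar>real (z l)\<bar> \<le> log 2 (real (q l)) + 1" unfolding z_def zlen_def by linarith
  qed
  have quantum: "quantum_circuit ((m l * n l + m l + n l + 1) * zlen (q l)) (zlen (q l)) (Guess l)"
    and total: "\<And>M. M \<in> messages (n l) (m l) (q l) \<Longrightarrow> (\<Sum>x \<in> zq (q l). guess_prob (q l) (Guess l) M x) = 1"
    if "l \<ge> 1" for l
    using guess that unfolding guess_algorithm_def by blast+
  have p_bound: "\<bar>p l M\<bar> \<le> 1" if "l \<ge> 1" "M \<in> messages (n l) (m l) (q l)" for l M
  proof -
    have nonneg: "0 \<le> guess_prob (q l) (Guess l) M x'" for x'
      unfolding guess_prob_def out_prob_def by (rule sum_nonneg) simp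
    have "p l M \<le> (\<Sum>x' \<in> zq (q l). guess_prob (q l) (Guess l) M x')"
      unfolding p_def by (rule member_le_sum) (use x[OF that(1)] nonneg in auto)
    thus ?thesis using total[OF that] nonneg by (simp add: p_def)
  qed
  have "\<exists>f. f \<in> zvec 2 (m l) \<and> \<bar>?D l\<bar> \<le> 2 * stat_dist (map_pmf fst (GenTrap l)) (pmf_of_set (zmat (q l) (m l) (n l)))
      + \<bar>V l f False - V l f True\<bar> + sqrt (real (q l) ^ Suc (n l) / 2 ^ m l)" if l: "l \<ge> 1" for l
  proof -
    have q0: "0 < q l" using q2[OF l] by simp
    have gt: "A \<in> zmat (q l) (m l) (n l)" if "(A, t) \<in> set_pmf (GenTrap l)" for A t
      using gentrap l that unfolding gentrap_algorithm_def by blast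
    show ?thesis
      by (rule client_uniform_hybrid[where p = "p l" and gt = "GenTrap l" and n = "n l" and m = "m l"
            and y = "y l" and \<chi> = "?\<chi> l", OF q0])
         (use p_bound[OF l] gt in \<open>auto simp: V_def\<close>)
  qed
  then obtain f where f: "\<And>l. l \<ge> 1 \<Longrightarrow> f l \<in> zvec 2 (m l)"
    and hybrid: "\<And>l. l \<ge> 1 \<Longrightarrow> \<bar>?D l\<bar> \<le> 2 * stat_dist (map_pmf fst (GenTrap l)) (pmf_of_set (zmat (q l) (m l) (n l)))
      + \<bar>V l (f l) False - V l (f l) True\<bar> + sqrt (real (q l) ^ Suc (n l) / 2 ^ m l)"
    by metis
  \<comment> \<open>The orientation of the advantage, chosen anew for each l: x is taken as a sign
    of uniform samples exactly when they make it at least as likely. This turns the oriented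
    difference into its absolute value.\<close>
  define s where "s l \<longleftrightarrow> V l (f l) False \<le> V l (f l) True" for l
  define B where "B l = circuit_size (Guess l) + m l + 3 * hash_cost (n l) (m l) (zlen (q l))
    + (n l + 1) * zlen (q l) + 3 * (4 + 3 * zlen (q l))" for l
  have "\<exists>C. oracle_circuit 0 ((n l + 1) * zlen (q l)) 1 C \<and> circuit_size C \<le> B l \<and>
      lwe_success (n l) (q l) (?\<chi> l) C = 1 / 2 + \<bar>V l (f l) False - V l (f l) True\<bar> / 2" if l: "l \<ge> 1" for l
  proof -
    obtain C where C: "oracle_circuit 0 ((n l + 1) * zlen (q l)) 1 C" "num_queries C = m l" "circuit_size C \<le> B l"
      and out: "\<And>ds \<beta>. ds \<in> sample_lists (n l) (m l) (q l) \<Longrightarrow> out_prob C [] (map (enc_sample (q l)) ds) [\<beta>] =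
       (if \<beta> = s l then guess_prob (q l) (Guess l) (sample_msg (n l) (q l) (y l) (f l) ds) (x l)
        else 1 - guess_prob (q l) (Guess l) (sample_msg (n l) (q l) (y l) (f l) ds) (x l))"
      by (rule lwe_adversary[OF q2[OF l] f[OF l] m_pos[OF l] quantum[OF l], where s = "s l" and x = "x l" and y = "y l",
            folded B_def]) (rule that)
    have q0: "0 < q l" using q2[OF l] by simp
    have "lwe_success (n l) (q l) (?\<chi> l) C = 1 / 2 + (if s l then V l (f l) True - V l (f l) False
        else V l (f l) False - V l (f l) True) / 2"
      unfolding V_def by (rule lwe_success_eq[OF q0 C(2)]) (rule out[folded p_def])
    hence "lwe_success (n l) (q l) (?\<chi> l) C = 1 / 2 + \<bar>V l (f l) False - V l (f l) True\<bar> / 2"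
      by (simp add: s_def)
    thus ?thesis using C by blast
  qed
  then obtain C where C: "\<And>l. l \<ge> 1 \<Longrightarrow> oracle_circuit 0 ((n l + 1) * zlen (q l)) 1 (C l)"
    and size: "\<And>l. l \<ge> 1 \<Longrightarrow> circuit_size (C l) \<le> B l"
    and success: "\<And>l. l \<ge> 1 \<Longrightarrow> lwe_success (n l) (q l) (?\<chi> l) (C l) = 1 / 2 + \<bar>V l (f l) False - V l (f l) True\<bar> / 2"
    by metis
  have "poly_size C"
    unfolding poly_size_def
  proof (rule poly_bounded_le)
    \<comment> \<open>The equations for n and m hold from l = 1 on, whereas polynomial bounds are
      asserted for functions on all of the naturals. The bound is therefore written in terms of l
      and \<open>z\<close>.\<close>
    define M where "M l = real l * (2 * real (z l) + 1)" for l
    let ?B = "\<lambda>l. real (circuit_size (Guess l)) + M l + 3 * (3 + (real l + 1) * (M l * (22 * (real (z l) + 1))))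
      + (real l + 1) * real (z l) + 3 * (4 + 3 * real (z l))"
    have "poly_bounded M" unfolding M_def
      by (intro poly_bounded_mult poly_bounded_add poly_bounded_const poly_bounded_ident poly_z)
    thus "poly_bounded ?B"
      using guess unfolding guess_algorithm_def poly_size_def
      by (intro poly_bounded_mult poly_bounded_add poly_bounded_const poly_bounded_ident poly_z) simp_all
    fix l :: nat assume l: "l \<ge> 1"
    have "real (B l) = ?B l"
      by (simp add: B_def hash_cost_def M_def m[OF l] n_eq[OF l] z_def[symmetric] algebra_simps)
    thus "\<bar>real (circuit_size (C l))\<bar> \<le> ?B l" using size[OF l] by simp
  qed
  then obtain \<epsilon> where \<epsilon>: "negl \<epsilon>" "\<And>l. l \<ge> 1 \<Longrightarrow> \<bar>V l (f l) False - V l (f l) True\<bar> \<le> 2 * \<epsilon> l"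
    by (rule lwe_hard_imp_negl[where d = "\<lambda>l. \<bar>V l (f l) False - V l (f l) True\<bar>", OF hard _ C success]) (assumption | rule that)+
  have lhl: "sqrt (real (q l) ^ Suc (n l) / 2 ^ m l) \<le> 2 powr (- real l / 2)" if l: "l \<ge> 1" for l
  proof -
    have "real (q l) \<le> 2 ^ z l"
    proof -
      have "q l \<le> 2 ^ z l" unfolding z_def by (rule zlen_bound) (use q2[OF l] in simp)
      hence "real (q l) \<le> real (2 ^ z l)" by (simp only: of_nat_le_iff)
      thus ?thesis by simp
    qed
    hence "real (q l) ^ Suc l \<le> (2 ^ z l) ^ Suc l" by (intro power_mono) simp_all
    also have "\<dots> = 2 ^ (z l * Suc l)" by (simp only: power_mult)
    finally have "real (q l) ^ Suc l / 2 ^ m l \<le> 2 ^ (z l * Suc l) / 2 ^ m l" by (simp add: divide_right_mono)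
    also have "\<dots> \<le> 1 / 2 ^ l"
    proof -
      \<comment> \<open>As m = 2 z l + l and z is at most l z, hashing to z (l + 1) bits leaves l
        bits of slack; the square root keeps half of them in the exponent.\<close>
      have "z l * Suc l + l \<le> m l"
      proof -
        have "z l \<le> l * z l" using l by simp
        thus ?thesis unfolding m[OF l] by (simp add: algebra_simps)
      qed
      hence "(2::real) ^ (z l * Suc l + l) \<le> 2 ^ m l" by (intro power_increasing) simp_all
      hence "(2::real) ^ (z l * Suc l) * 2 ^ l \<le> 2 ^ m l" by (simp only: power_add)
      moreover have "a / b \<le> 1 / d" if "a * d \<le> b" "0 < b" "0 < d" for a b d :: real
        using that by (simp add: field_simps)
      ultimately show ?thesis by simp
    qed
    also have "\<dots> = (2 powr (- real l / 2))\<^sup>2"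
    proof -
      have "(2 powr (- real l / 2))\<^sup>2 = 2 powr (- real l / 2 + - real l / 2)"
        unfolding power2_eq_square by (rule powr_add[symmetric])
      also have "- real l / 2 + - real l / 2 = - real l" by simp
      also have "2 powr (- real l) = 1 / 2 ^ l" by (simp add: powr_minus powr_realpow divide_inverse)
      finally show ?thesis by simp
    qed
    finally have "sqrt (real (q l) ^ Suc l / 2 ^ m l) \<le> sqrt ((2 powr (- real l / 2))\<^sup>2)" by (rule real_sqrt_le_mono)
    thus ?thesis by (simp add: n_eq[OF l])
  qed
  \<comment> \<open>The summands come from GenTrap, LWE and the leftover hash lemma. Writing 1 as
    \<open>real l ^ 0\<close> makes the last one an instance of
    \<open>negl_exponential\<close>.\<close>
  let ?bound = "\<lambda>l. 2 * (real l * real (z l) * 2 powr (- real l / 2)) + 2 * \<epsilon> l + real l ^ 0 * 2 powr (- real l / 2)"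
  have "negl ?bound"
    by (intro negl_add negl_cmult \<epsilon>(1) negl_exponential negl_poly_exponential poly_bounded_mult poly_bounded_ident poly_z) simp_all
  moreover have "\<bar>?D l\<bar> \<le> ?bound l" if l: "l \<ge> 1" for l
    using hybrid[OF l] \<epsilon>(2)[OF l] lhl[OF l] gentrap_uniform[OF l] by (simp add: n_eq[OF l] Qz[OF l])
  ultimately show ?thesis
    unfolding guess_prob_on_def p_def[symmetric] by blast
qed

end
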